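(* Let $G$ be a complex reductive group, let $V$ be an admissible $G$-module with quotient morphism $\pi\colon V\to Z=V/\!\!/G$, and let $\varphi\in\mathrm{Aut}_{\mathcal H}(Z)$ be a holomorphic automorphism of $Z$ with $\varphi(\pi(0))=\pi(0)$. Then there is a holomorphic family $\varphi_t\in\mathrm{Aut}_{\mathcal H}(Z)$, $t\in\mathbb C$, with $\varphi_0\in\mathrm{Aut}_{q\ell}(Z)$ and $\varphi_1=\varphi$.
   Context: The base field is $\mathbb C$. $G$ is a complex reductive algebraic group (not necessarily connected), $V$ a finite-dimensional $G$-module, $\mathcal O(V)$ the algebra of polynomial functions on $V$, $Z=V/\!\!/G$ the affine variety with $\mathcal O(Z)=\mathcal O(V)^G$, and $\pi\colon V\to Z$ the morphism dual to $\mathcal O(V)^G\subset\mathcal O(V)$. The points of $Z$ correspond to the closed $G$-orbits in $V$. For a reductive subgroup $H\subset G$, the stratum $Z_{(H)}$ is the set of points of $Z$ whose closed orbits have isotropy groups conjugate to $H$; these give a finite stratification of $Z$ by locally closed smooth subvarieties with a unique open stratum $Z_{\mathrm{pr}}$, the principal stratum. The isotropy groups of closed orbits over $Z_{\mathrm{pr}}$ are the principal isotropy groups. Set $V_{\mathrm{pr}}=\pi^{-1}(Z_{\mathrm{pr}})$. $V$ is $k$-principal if its principal isotropy groups are finite and $\operatorname{codim}(V\setminus V_{\mathrm{pr}})\ge k$. $\mathcal D^k(V)$ and $\mathcal D^k(Z)$ denote the algebraic differential operators of order at most $k$ on $V$ and $Z$, and $\pi_*\colon\mathcal D^k(V)^G\to\mathcal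 D^k(Z)$ is given by restricting $G$-invariant operators to $\mathcal O(V)^G=\mathcal O(Z)$. $V$ is admissible if $V$ is $2$-principal and $\pi_*\colon\mathcal D^k(V)^G\to\mathcal D^k(Z)$ is surjective for all $k$. $\mathrm{Aut}_{\mathcal H}(Z)$ is the group of holomorphic automorphisms of $Z$. $\mathrm{Aut}_{q\ell}(Z)$ (quasilinear automorphisms) is the group of algebraic automorphisms of $Z$ which preserve the grading of $\mathcal O(Z)=\mathcal O(V)^G$ (by polynomial degree). A family $\varphi_t$, $t\in\mathbb C$, is holomorphic if $(t,z)\mapsto\varphi_t(z)$ is holomorphic on $\mathbb C\times Z$. *)

theory Defs
  imports
    "HOL-Analysis.Analysis"
    "HOL-Library.Function_Algebras"
    "HOL-Library.Extended_Nat"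
    "HOL-Library.FuncSet"
begin

text \<open>Sums and products of complex-valued functions are pointwise, by
  \<^theory>\<open>HOL-Library.Function_Algebras\<close>.\<close>

inductive_set generated_algebra :: "('x \<Rightarrow> complex) set \<Rightarrow> ('x \<Rightarrow> complex) set"
  for R :: "('x \<Rightarrow> complex) set" where
  const: "(\<lambda>_. c) \<in> generated_algebra R"
| gen: "f \<in> R \<Longrightarrow> f \<in> generated_algebra R"
| add: "f \<in> generated_algebra R \<Longrightarrow> h \<in> generated_algebra R \<Longrightarrow> f + h \<in> generated_algebra R"
| mult: "f \<in> generated_algebra R \<Longrightarrow> h \<in> generated_algebra R \<Longrightarrow> f * h \<in> generated_algebra R"

section \<open>Linear algebraic groups and rational modules\<close>

definition GL_regular :: "((complex^'n^'n) \<Rightarrow> complex) set" where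
  "GL_regular = generated_algebra ({\<lambda>g. g $ i $ j | i j. True} \<union> {\<lambda>g. inverse (det g)})"

definition linear_algebraic_group :: "(complex^'n^'n) set \<Rightarrow> bool" where
  "linear_algebraic_group G \<longleftrightarrow>
     mat 1 \<in> G \<and> (\<forall>g\<in>G. \<forall>h\<in>G. g ** h \<in> G) \<and> (\<forall>g\<in>G. matrix_inv g \<in> G) \<and>
     (\<exists>E \<subseteq> GL_regular. G = {g. invertible g \<and> (\<forall>f\<in>E. f g = 0)})"

text \<open>The module is a finite-dimensional subspace \<open>W\<close> of a complex vector space which is
  given by its scalar multiplication. Only the values of \<open>\<rho>\<close> on \<open>G\<close> and \<open>W\<close> matter.\<close>

definition rational_module ::
  "(complex^'n^'n) set \<Rightarrow> (complex \<Rightarrow> 'v::ab_group_add \<Rightarrow> 'v) \<Rightarrow> 'v set \<Rightarrow>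
   (complex^'n^'n \<Rightarrow> 'v \<Rightarrow> 'v) \<Rightarrow> bool" where
  "rational_module G smul W \<rho> \<longleftrightarrow>
     vector_space smul \<and>
     (\<exists>B. finite B \<and> W = module.span smul B) \<and>
     (\<forall>g\<in>G. \<forall>v\<in>W. \<rho> g v \<in> W) \<and>
     (\<forall>g\<in>G. \<forall>v\<in>W. \<forall>w\<in>W. \<rho> g (v + w) = \<rho> g v + \<rho> g w) \<and>
     (\<forall>g\<in>G. \<forall>c. \<forall>v\<in>W. \<rho> g (smul c v) = smul c (\<rho> g v)) \<and>
     (\<forall>v\<in>W. \<rho> (mat 1) v = v) \<and>
     (\<forall>g\<in>G. \<forall>h\<in>G. \<forall>v\<in>W. \<rho> (g ** h) v = \<rho> g (\<rho> h v)) \<and>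
     (\<forall>l. Vector_Spaces.linear smul (*) l \<longrightarrow>
        (\<forall>v\<in>W. \<exists>f\<in>GL_regular. \<forall>g\<in>G. l (\<rho> g v) = f g))"

definition submodule ::
  "(complex^'n^'n) set \<Rightarrow> (complex \<Rightarrow> 'v::ab_group_add \<Rightarrow> 'v) \<Rightarrow> 'v set \<Rightarrow>
   (complex^'n^'n \<Rightarrow> 'v \<Rightarrow> 'v) \<Rightarrow> 'v set \<Rightarrow> bool" where
  "submodule G smul W \<rho> U \<longleftrightarrow>
     U \<subseteq> W \<and> module.subspace smul U \<and> (\<forall>g\<in>G. \<forall>u\<in>U. \<rho> g u \<in> U)"

definition completely_reducible ::
  "(complex^'n^'n) set \<Rightarrow> (complex \<Rightarrow> 'v::ab_group_add \<Rightarrow> 'v) \<Rightarrow> 'v set \<Rightarrow>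
   (complex^'n^'n \<Rightarrow> 'v \<Rightarrow> 'v) \<Rightarrow> bool" where
  "completely_reducible G smul W \<rho> \<longleftrightarrow>
     (\<forall>U. submodule G smul W \<rho> U \<longrightarrow>
        (\<exists>U'. submodule G smul W \<rho> U' \<and> U \<inter> U' = {0} \<and> W = {u + u' | u u'. u \<in> U \<and> u' \<in> U'}))"

text \<open>Reductivity (over the complex numbers): all rational modules are completely reducible.
  As HOL cannot quantify over types inside a formula, the modules range over the
  finite-dimensional subspaces of the space of complex sequences; every finite-dimensional
  module is isomorphic to one of these.\<close>

definition reductive_group :: "(complex^'n^'n) set \<Rightarrow> bool" where
  "reductive_group G \<longleftrightarrow> linear_algebraic_group G \<and>
     (\<forall>W (\<sigma> :: complex^'n^'n \<Rightarrow> (nat \<Rightarrow> complex) \<Rightarrow> (nat \<Rightarrow> complex)).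
        rational_module G (\<lambda>c x i. c * x i) W \<sigma> \<longrightarrow>
        completely_reducible G (\<lambda>c x i. c * x i) W \<sigma>)"

section \<open>Polynomial functions and the Zariski topology on \<open>V\<close>\<close>

text \<open>From here on \<open>V\<close> is the whole type \<open>'v\<close>, with scalar multiplication \<open>smul\<close>.\<close>

definition polynomials :: "(complex \<Rightarrow> 'v::ab_group_add \<Rightarrow> 'v) \<Rightarrow> ('v \<Rightarrow> complex) set" where
  "polynomials smul = generated_algebra {l. Vector_Spaces.linear smul (*) l}"

definition invariants ::
  "(complex^'n^'n) set \<Rightarrow> (complex \<Rightarrow> 'v::ab_group_add \<Rightarrow> 'v) \<Rightarrow> (complex^'n^'n \<Rightarrow> 'v \<Rightarrow> 'v) \<Rightarrow>
   ('v \<Rightarrow> complex) set" where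
  "invariants G smul \<rho> = {f \<in> polynomials smul. \<forall>g\<in>G. \<forall>v. f (\<rho> g v) = f v}"

definition homogeneous_invariants ::
  "(complex^'n^'n) set \<Rightarrow> (complex \<Rightarrow> 'v::ab_group_add \<Rightarrow> 'v) \<Rightarrow> (complex^'n^'n \<Rightarrow> 'v \<Rightarrow> 'v) \<Rightarrow>
   nat \<Rightarrow> ('v \<Rightarrow> complex) set" where
  "homogeneous_invariants G smul \<rho> d =
     {f \<in> invariants G smul \<rho>. \<forall>c v. f (smul c v) = c ^ d * f v}"

definition zariski_closed :: "(complex \<Rightarrow> 'v::ab_group_add \<Rightarrow> 'v) \<Rightarrow> 'v set \<Rightarrow> bool" where
  "zariski_closed smul X \<longleftrightarrow> (\<exists>E \<subseteq> polynomials smul. X = {v. \<forall>f\<in>E. f v = 0})"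

definition irreducible_closed :: "(complex \<Rightarrow> 'v::ab_group_add \<Rightarrow> 'v) \<Rightarrow> 'v set \<Rightarrow> bool" where
  "irreducible_closed smul X \<longleftrightarrow> zariski_closed smul X \<and> X \<noteq> {} \<and>
     (\<forall>A B. zariski_closed smul A \<and> zariski_closed smul B \<and> X = A \<union> B \<longrightarrow> X = A \<or> X = B)"

definition irreducible_codim :: "(complex \<Rightarrow> 'v::ab_group_add \<Rightarrow> 'v) \<Rightarrow> 'v set \<Rightarrow> enat" where
  "irreducible_codim smul Y =
     Sup {enat n | n. \<exists>C. C 0 = Y \<and> (\<forall>i\<le>n. irreducible_closed smul (C i)) \<and>
                           (\<forall>i<n. C i \<subset> C (Suc i))}"

text \<open>Codimension in \<open>V\<close> of a Zariski closed subset; it is \<open>\<infinity>\<close> for the empty set.\<close>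

definition codimension :: "(complex \<Rightarrow> 'v::ab_group_add \<Rightarrow> 'v) \<Rightarrow> 'v set \<Rightarrow> enat" where
  "codimension smul X =
     Inf {irreducible_codim smul Y | Y. irreducible_closed smul Y \<and> Y \<subseteq> X}"

section \<open>The quotient \<open>Z\<close>\<close>

text \<open>The points of the affine variety with coordinate ring \<open>A\<close> are the complex algebra
  homomorphisms from \<open>A\<close> to the complex numbers. The value of \<open>f \<in> A\<close> at a point \<open>z\<close> is \<open>z f\<close>.\<close>

definition affine_points :: "('x \<Rightarrow> complex) set \<Rightarrow> (('x \<Rightarrow> complex) \<Rightarrow> complex) set" where
  "affine_points A = {z \<in> extensional A. (\<forall>c. z (\<lambda>_. c) = c) \<and>
     (\<forall>f\<in>A. \<forall>h\<in>A. z (f + h) = z f + z h \<and> z (f * h) = z f * z h)}"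

definition git_quotient ::
  "(complex^'n^'n) set \<Rightarrow> (complex \<Rightarrow> 'v::ab_group_add \<Rightarrow> 'v) \<Rightarrow> (complex^'n^'n \<Rightarrow> 'v \<Rightarrow> 'v) \<Rightarrow>
   (('v \<Rightarrow> complex) \<Rightarrow> complex) set" where
  "git_quotient G smul \<rho> = affine_points (invariants G smul \<rho>)"

definition git_quotient_map ::
  "(complex^'n^'n) set \<Rightarrow> (complex \<Rightarrow> 'v::ab_group_add \<Rightarrow> 'v) \<Rightarrow> (complex^'n^'n \<Rightarrow> 'v \<Rightarrow> 'v) \<Rightarrow>
   'v \<Rightarrow> (('v \<Rightarrow> complex) \<Rightarrow> complex)" where
  "git_quotient_map G smul \<rho> v = restrict (\<lambda>f. f v) (invariants G smul \<rho>)"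

section \<open>The stratification of \<open>Z\<close>\<close>

definition orbit ::
  "(complex^'n^'n) set \<Rightarrow> (complex^'n^'n \<Rightarrow> 'v \<Rightarrow> 'v) \<Rightarrow> 'v \<Rightarrow> 'v set" where
  "orbit G \<rho> v = (\<lambda>g. \<rho> g v) ` G"

definition isotropy_group ::
  "(complex^'n^'n) set \<Rightarrow> (complex^'n^'n \<Rightarrow> 'v \<Rightarrow> 'v) \<Rightarrow> 'v \<Rightarrow> (complex^'n^'n) set" where
  "isotropy_group G \<rho> v = {g \<in> G. \<rho> g v = v}"

definition conjugate_in ::
  "(complex^'n^'n) set \<Rightarrow> (complex^'n^'n) set \<Rightarrow> (complex^'n^'n) set \<Rightarrow> bool" where
  "conjugate_in G H K \<longleftrightarrow> (\<exists>g\<in>G. K = (\<lambda>h. g ** h ** matrix_inv g) ` H)"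

definition stratum ::
  "(complex^'n^'n) set \<Rightarrow> (complex \<Rightarrow> 'v::ab_group_add \<Rightarrow> 'v) \<Rightarrow> (complex^'n^'n \<Rightarrow> 'v \<Rightarrow> 'v) \<Rightarrow>
   (complex^'n^'n) set \<Rightarrow> (('v \<Rightarrow> complex) \<Rightarrow> complex) set" where
  "stratum G smul \<rho> H = {z \<in> git_quotient G smul \<rho>.
     \<exists>v. git_quotient_map G smul \<rho> v = z \<and> zariski_closed smul (orbit G \<rho> v) \<and>
         conjugate_in G H (isotropy_group G \<rho> v)}"

definition open_in_quotient ::
  "(complex^'n^'n) set \<Rightarrow> (complex \<Rightarrow> 'v::ab_group_add \<Rightarrow> 'v) \<Rightarrow> (complex^'n^'n \<Rightarrow> 'v \<Rightarrow> 'v) \<Rightarrow>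
   (('v \<Rightarrow> complex) \<Rightarrow> complex) set \<Rightarrow> bool" where
  "open_in_quotient G smul \<rho> S \<longleftrightarrow>
     (\<exists>E \<subseteq> invariants G smul \<rho>. S = {z \<in> git_quotient G smul \<rho>. \<exists>f\<in>E. z f \<noteq> 0})"

text \<open>The empty set is excluded: \<open>stratum G smul \<rho> H\<close> is empty when \<open>H\<close> is not an
  isotropy group of a closed orbit.\<close>

definition principal_stratum ::
  "(complex^'n^'n) set \<Rightarrow> (complex \<Rightarrow> 'v::ab_group_add \<Rightarrow> 'v) \<Rightarrow> (complex^'n^'n \<Rightarrow> 'v \<Rightarrow> 'v) \<Rightarrow>
   (('v \<Rightarrow> complex) \<Rightarrow> complex) set" where
  "principal_stratum G smul \<rho> =
     (THE S. S \<noteq> {} \<and> open_in_quotient G smul \<rho> S \<and>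
        (\<exists>H \<subseteq> G. reductive_group H \<and> S = stratum G smul \<rho> H))"

definition principal_points ::
  "(complex^'n^'n) set \<Rightarrow> (complex \<Rightarrow> 'v::ab_group_add \<Rightarrow> 'v) \<Rightarrow> (complex^'n^'n \<Rightarrow> 'v \<Rightarrow> 'v) \<Rightarrow>
   'v set" where
  "principal_points G smul \<rho> = git_quotient_map G smul \<rho> -` principal_stratum G smul \<rho>"

definition principal_isotropy_groups ::
  "(complex^'n^'n) set \<Rightarrow> (complex \<Rightarrow> 'v::ab_group_add \<Rightarrow> 'v) \<Rightarrow> (complex^'n^'n \<Rightarrow> 'v \<Rightarrow> 'v) \<Rightarrow>
   (complex^'n^'n) set set" where
  "principal_isotropy_groups G smul \<rho> =
     {isotropy_group G \<rho> v | v. v \<in> principal_points G smul \<rho> \<and> zariski_closed smul (orbit G \<rho> v)}"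

definition k_principal ::
  "nat \<Rightarrow> (complex^'n^'n) set \<Rightarrow> (complex \<Rightarrow> 'v::ab_group_add \<Rightarrow> 'v) \<Rightarrow>
   (complex^'n^'n \<Rightarrow> 'v \<Rightarrow> 'v) \<Rightarrow> bool" where
  "k_principal k G smul \<rho> \<longleftrightarrow>
     (\<forall>H \<in> principal_isotropy_groups G smul \<rho>. finite H) \<and>
     codimension smul (UNIV - principal_points G smul \<rho>) \<ge> enat k"

section \<open>Differential operators and admissibility\<close>

definition linear_operator ::
  "('x \<Rightarrow> complex) set \<Rightarrow> (('x \<Rightarrow> complex) \<Rightarrow> ('x \<Rightarrow> complex)) \<Rightarrow> bool" where
  "linear_operator A P \<longleftrightarrow> P \<in> A \<rightarrow> A \<and>
     (\<forall>f\<in>A. \<forall>h\<in>A. P (f + h) = P f + P h) \<and>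
     (\<forall>c. \<forall>f\<in>A. P ((\<lambda>_. c) * f) = (\<lambda>_. c) * P f)"

text \<open>Grothendieck's definition: operators of order at most \<open>0\<close> commute with multiplication by
  elements of \<open>A\<close>, and the commutator of an operator of order at most \<open>k + 1\<close> with such a
  multiplication has order at most \<open>k\<close>.\<close>

primrec has_order_at_most ::
  "nat \<Rightarrow> ('x \<Rightarrow> complex) set \<Rightarrow> (('x \<Rightarrow> complex) \<Rightarrow> ('x \<Rightarrow> complex)) \<Rightarrow> bool" where
  "has_order_at_most 0 A P \<longleftrightarrow>
     linear_operator A P \<and> (\<forall>a\<in>A. \<forall>f\<in>A. P (a * f) = a * P f)"
| "has_order_at_most (Suc k) A P \<longleftrightarrow>
     linear_operator A P \<and> (\<forall>a\<in>A. has_order_at_most k A (\<lambda>f. P (a * f) - a * P f))"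

definition diff_ops ::
  "nat \<Rightarrow> ('x \<Rightarrow> complex) set \<Rightarrow> (('x \<Rightarrow> complex) \<Rightarrow> ('x \<Rightarrow> complex)) set" where
  "diff_ops k A = {P \<in> extensional A. has_order_at_most k A P}"

definition invariant_diff_ops ::
  "nat \<Rightarrow> (complex^'n^'n) set \<Rightarrow> (complex \<Rightarrow> 'v::ab_group_add \<Rightarrow> 'v) \<Rightarrow>
   (complex^'n^'n \<Rightarrow> 'v \<Rightarrow> 'v) \<Rightarrow> (('v \<Rightarrow> complex) \<Rightarrow> ('v \<Rightarrow> complex)) set" where
  "invariant_diff_ops k G smul \<rho> =
     {P \<in> diff_ops k (polynomials smul). \<forall>g\<in>G. \<forall>f\<in>polynomials smul.
        P (\<lambda>v. f (\<rho> (matrix_inv g) v)) = (\<lambda>v. P f (\<rho> (matrix_inv g) v))}"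

text \<open>The algebra of regular functions on \<open>Z\<close> is \<open>invariants G smul \<rho>\<close>, and \<open>\<pi>\<^sub>*\<close> is
  restriction of operators to it.\<close>

definition admissible ::
  "(complex^'n^'n) set \<Rightarrow> (complex \<Rightarrow> 'v::ab_group_add \<Rightarrow> 'v) \<Rightarrow>
   (complex^'n^'n \<Rightarrow> 'v \<Rightarrow> 'v) \<Rightarrow> bool" where
  "admissible G smul \<rho> \<longleftrightarrow> k_principal 2 G smul \<rho> \<and>
     (\<forall>k. (\<lambda>P. restrict P (invariants G smul \<rho>)) ` invariant_diff_ops k G smul \<rho>
            = diff_ops k (invariants G smul \<rho>))"

section \<open>Holomorphic functions and automorphisms\<close>

text \<open>\<open>F\<close> is a function of the first \<open>n\<close> entries of its argument which, on a polydisc around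
  \<open>a\<close>, is the sum of a power series that converges absolutely on the closed polydisc.\<close>

definition holomorphic_near ::
  "nat \<Rightarrow> (nat \<Rightarrow> complex) \<Rightarrow> ((nat \<Rightarrow> complex) \<Rightarrow> complex) \<Rightarrow> bool" where
  "holomorphic_near n a F \<longleftrightarrow>
     (\<exists>r>0. \<exists>c :: (nat \<Rightarrow> nat) \<Rightarrow> complex. let M = {\<alpha>. \<forall>i\<ge>n. \<alpha> i = 0} in
        (\<lambda>\<alpha>. norm (c \<alpha>) * r ^ (\<Sum>i<n. \<alpha> i)) summable_on M \<and>
        (\<forall>w. (\<forall>i<n. norm (w i - a i) < r) \<longrightarrow>
           ((\<lambda>\<alpha>. c \<alpha> * (\<Prod>i<n. (w i - a i) ^ \<alpha> i)) has_sum F w) M))"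

text \<open>\<open>X\<close> is an affine variety whose coordinate ring is generated by \<open>R\<close>, with its reduced
  complex structure: holomorphic functions are locally the pullbacks of holomorphic functions
  of finitely many variables under tuples of elements of \<open>R\<close>.\<close>

definition holomorphic_fun :: "'x set \<Rightarrow> ('x \<Rightarrow> complex) set \<Rightarrow> ('x \<Rightarrow> complex) \<Rightarrow> bool" where
  "holomorphic_fun X R f \<longleftrightarrow>
     (\<forall>x\<in>X. \<exists>n p F. (\<forall>i<n. p i \<in> R) \<and> holomorphic_near n (\<lambda>i. p i x) F \<and>
        (\<exists>r>0. \<forall>y\<in>X. (\<forall>i<n. norm (p i y - p i x) < r) \<longrightarrow> f y = F (\<lambda>i. p i y)))"

text \<open>Maps to an affine variety with coordinate ring \<open>A\<close> are holomorphic if their compositions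
  with all elements of \<open>A\<close> are.\<close>

definition holomorphic_self_map ::
  "('x \<Rightarrow> complex) set \<Rightarrow> ((('x \<Rightarrow> complex) \<Rightarrow> complex) \<Rightarrow> (('x \<Rightarrow> complex) \<Rightarrow> complex)) \<Rightarrow> bool" where
  "holomorphic_self_map A \<phi> \<longleftrightarrow> \<phi> \<in> affine_points A \<rightarrow> affine_points A \<and>
     (\<forall>f\<in>A. holomorphic_fun (affine_points A) {\<lambda>z. z h | h. h \<in> A} (\<lambda>z. \<phi> z f))"

definition holomorphic_automorphisms ::
  "('x \<Rightarrow> complex) set \<Rightarrow> ((('x \<Rightarrow> complex) \<Rightarrow> complex) \<Rightarrow> (('x \<Rightarrow> complex) \<Rightarrow> complex)) set" where
  "holomorphic_automorphisms A =
     {\<phi> \<in> extensional (affine_points A). bij_betw \<phi> (affine_points A) (affine_points A) \<and>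
        holomorphic_self_map A \<phi> \<and> holomorphic_self_map A (inv_into (affine_points A) \<phi>)}"

definition holomorphic_family ::
  "('x \<Rightarrow> complex) set \<Rightarrow>
   (complex \<Rightarrow> (('x \<Rightarrow> complex) \<Rightarrow> complex) \<Rightarrow> (('x \<Rightarrow> complex) \<Rightarrow> complex)) \<Rightarrow> bool" where
  "holomorphic_family A \<Phi> \<longleftrightarrow> (\<forall>t. \<Phi> t \<in> affine_points A \<rightarrow> affine_points A) \<and>
     (\<forall>f\<in>A. holomorphic_fun (UNIV \<times> affine_points A)
        (insert (\<lambda>(t, z). t) {\<lambda>(t, z). z h | h. h \<in> A}) (\<lambda>(t, z). \<Phi> t z f))"

definition algebraic_automorphisms ::
  "('x \<Rightarrow> complex) set \<Rightarrow> ((('x \<Rightarrow> complex) \<Rightarrow> complex) \<Rightarrow> (('x \<Rightarrow> complex) \<Rightarrow> complex)) set" where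
  "algebraic_automorphisms A =
     {\<phi> \<in> extensional (affine_points A). bij_betw \<phi> (affine_points A) (affine_points A) \<and>
        (\<forall>f\<in>A. \<exists>h\<in>A. \<forall>z\<in>affine_points A. \<phi> z f = z h) \<and>
        (\<forall>f\<in>A. \<exists>h\<in>A. \<forall>z\<in>affine_points A. inv_into (affine_points A) \<phi> z f = z h)}"

definition quasilinear_automorphisms ::
  "(complex^'n^'n) set \<Rightarrow> (complex \<Rightarrow> 'v::ab_group_add \<Rightarrow> 'v) \<Rightarrow> (complex^'n^'n \<Rightarrow> 'v \<Rightarrow> 'v) \<Rightarrow>
   ((('v \<Rightarrow> complex) \<Rightarrow> complex) \<Rightarrow> (('v \<Rightarrow> complex) \<Rightarrow> complex)) set" where
  "quasilinear_automorphisms G smul \<rho> =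
     {\<phi> \<in> algebraic_automorphisms (invariants G smul \<rho>).
        \<forall>d. \<forall>f \<in> homogeneous_invariants G smul \<rho> d.
          \<exists>h \<in> homogeneous_invariants G smul \<rho> d. \<forall>z \<in> git_quotient G smul \<rho>. \<phi> z f = z h}"

end

theory Submission
  imports Defs
begin

text \<open>
  The grading of the invariants gives an action \<open>(t, z) \<mapsto> t \<cdot> z\<close> of the multiplicative monoid of complex
  numbers on the quotient, and the family is \<open>\<phi>\<^sub>t z = t\<^sup>-\<^sup>1 \<cdot> \<phi> (t \<cdot> z)\<close>. For an invariant \<open>f\<close> that is
  homogeneous of degree \<open>d\<close>, the value of \<open>f\<close> at \<open>\<phi>\<^sub>t z\<close> is \<open>\<Sum>k. t ^ (k - d) * f\<^sub>k z\<close>, where \<open>f\<^sub>k\<close> is the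
  homogeneous component of degree \<open>k\<close> at the origin of the pullback of \<open>f\<close> under \<open>\<phi>\<close>. So the family
  extends to \<open>t = 0\<close> if \<open>f\<^sub>k = 0\<close> for all \<open>k < d\<close>, and then \<open>\<phi>\<^sub>0\<close> is given by \<open>f \<mapsto> f\<^sub>d\<close>, which preserves
  degrees. What has to be shown is that \<open>\<phi>\<close> respects the filtration by degree.

  This holds because differential operators see this filtration. Suppose that \<open>f\<^sub>k \<noteq> 0\<close> and \<open>k < d\<close>. By
  complete reducibility there is an invariant functional on the homogeneous polynomials of degree \<open>k\<close>
  which is \<open>1\<close> at \<open>f\<^sub>k\<close>, hence an invariant operator \<open>P\<close> with constant coefficients and of order at most
  \<open>k\<close> which detects \<open>f\<^sub>k\<close> at the origin (\<open>invariant_op_detects\<close>). Conjugation by \<open>\<phi>\<close> turns \<open>P\<close> into a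
  holomorphic operator of order at most \<open>k\<close> on the quotient which does not kill \<open>f\<close> at the origin. Its
  part of degree \<open>-d\<close> does not kill \<open>f\<close> there either, and it is an algebraic operator of order at most
  \<open>k\<close> (\<open>has_order_conjugate_part\<close>). By admissibility it lifts to an operator on \<open>V\<close> of order at most \<open>k\<close>.
  But \<open>f\<close> is a sum of products of \<open>d\<close> functions that vanish at the origin, and every operator of order
  \<open>k < d\<close> kills such a function at the origin (\<open>homogeneous_vanishes\<close>). This contradiction is
  \<open>jet_low_degree_vanishes\<close>.

  Conjugation is carried out formally. The components \<open>f\<^sub>k\<close> define a homomorphism from the invariants to
  their completion, and it suffices to approximate its values by invariants modulo powers of the
  maximal ideal at the origin, since an operator of order at most \<open>k\<close> loses at most \<open>k\<close> of these powers.
  The approximations are truncations of the convergent power series that represent the pullbacks near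
  the origin (\<open>germ_exists\<close>), and their composition is controlled by asymptotic expansions along curves
  (\<open>inverse_jet_maps_jet\<close>).

  Holomorphy of the family near \<open>t = 0\<close> is obtained by dividing a local power series for the value of
  \<open>f\<close> at \<open>\<phi> (t \<cdot> z)\<close> by \<open>t\<close>, one factor at a time (\<open>holomorphic_at_divide\<close>). The same construction for
  the inverse of \<open>\<phi>\<close> gives the inverse family (\<open>family_inverse\<close>).
\<close>

section \<open>Algebras of functions, powers of maximal ideals, and commutators\<close>

text \<open>Functions are treated as elements of a commutative ring. Evaluation at a point is requested
  explicitly, because inductions produce eta-expanded functions, in which the simplifier would
  unfold the ring operations.\<close>

lemmas fun_apply = plus_fun_apply times_fun_apply zero_fun_apply one_fun_apply minus_apply uminus_apply

declare fun_apply [simp del]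

lemma sum_fun_apply: "(\<Sum>i\<in>I. f i) x = (\<Sum>i\<in>I. f i x)"
  for f :: "'i \<Rightarrow> 'x \<Rightarrow> 'b::comm_monoid_add"
  by (induction I rule: infinite_finite_induct) (auto simp: fun_apply)

locale function_algebra =
  fixes A :: "('x \<Rightarrow> complex) set"
  assumes const_mem: "(\<lambda>_. c) \<in> A"
    and add_mem: "f \<in> A \<Longrightarrow> h \<in> A \<Longrightarrow> f + h \<in> A"
    and mult_mem: "f \<in> A \<Longrightarrow> h \<in> A \<Longrightarrow> f * h \<in> A"
begin

lemma zero_mem: "0 \<in> A"
  using const_mem[of 0] by (simp add: zero_fun_def)

lemma one_mem: "1 \<in> A"
  using const_mem[of 1] by (simp add: one_fun_def)

lemma scale_mem: "f \<in> A \<Longrightarrow> (\<lambda>x. c * f x) \<in> A"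
  using mult_mem[OF const_mem[of c], of f] by (simp add: times_fun_def)

lemma uminus_mem: "f \<in> A \<Longrightarrow> - f \<in> A"
  using scale_mem[of f "-1"] by (simp add: fun_Compl_def)

lemma diff_mem: "f \<in> A \<Longrightarrow> h \<in> A \<Longrightarrow> f - h \<in> A"
  using add_mem[of f "- h"] uminus_mem[of h] by simp

lemma sum_mem: "(\<And>i. i \<in> I \<Longrightarrow> f i \<in> A) \<Longrightarrow> (\<Sum>i\<in>I. f i) \<in> A"
  by (induction I rule: infinite_finite_induct) (auto intro: zero_mem add_mem)

lemma power_mem: "f \<in> A \<Longrightarrow> f ^ n \<in> A"
  by (induction n) (auto intro: one_mem mult_mem)

lemma prod_mem: "(\<And>i. i \<in> I \<Longrightarrow> f i \<in> A) \<Longrightarrow> (\<Prod>i\<in>I. f i) \<in> A"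
  by (induction I rule: infinite_finite_induct) (auto intro: one_mem mult_mem)

end

lemma function_algebra_generated: "function_algebra (generated_algebra R)"
  by unfold_locales (fact generated_algebra.intros)+

text \<open>The maximal ideal is that of the functions which vanish at \<open>x\<close>. Generating its powers one
  factor at a time makes the properties below accessible to rule induction.\<close>

inductive max_ideal_power :: "('x \<Rightarrow> complex) set \<Rightarrow> 'x \<Rightarrow> nat \<Rightarrow> ('x \<Rightarrow> complex) \<Rightarrow> bool"
  for A x where
  base: "f \<in> A \<Longrightarrow> max_ideal_power A x 0 f"
| mult: "a \<in> A \<Longrightarrow> a x = 0 \<Longrightarrow> max_ideal_power A x n f \<Longrightarrow> max_ideal_power A x (Suc n) (a * f)"
| add: "max_ideal_power A x n f \<Longrightarrow> max_ideal_power A x n h \<Longrightarrow> max_ideal_power A x n (f + h)"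

primrec iterated_commutator ::
  "(('x \<Rightarrow> complex) \<Rightarrow> ('x \<Rightarrow> complex)) \<Rightarrow> ('x \<Rightarrow> complex) list \<Rightarrow>
   ('x \<Rightarrow> complex) \<Rightarrow> ('x \<Rightarrow> complex)" where
  "iterated_commutator P [] = P"
| "iterated_commutator P (a # as) = iterated_commutator (\<lambda>f. P (a * f) - a * P f) as"

text \<open>Commutators with different multiplication operators may be taken in any order, because
  multiplication operators commute; so the one taken first can be pulled to the front.\<close>

lemma iterated_commutator_Cons:
  "iterated_commutator P (a # as) f = iterated_commutator P as (a * f) - a * iterated_commutator P as f"
proof (induction as arbitrary: P f)
  case (Cons b bs)
  have "iterated_commutator P (a # b # bs) f =
    iterated_commutator (\<lambda>f. (P (b * f) - b * P f)) (a # bs) f"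
    by (simp add: algebra_simps)
  also have "\<dots> = iterated_commutator P (b # bs) (a * f) - a * iterated_commutator P (b # bs) f"
    unfolding Cons.IH by simp
  finally show ?case .
qed simp

context function_algebra
begin

lemma max_ideal_power_mem: "max_ideal_power A x n f \<Longrightarrow> f \<in> A"
  by (induction rule: max_ideal_power.induct) (auto intro: mult_mem add_mem)

lemma max_ideal_power_mult:
  "max_ideal_power A x n f \<Longrightarrow> h \<in> A \<Longrightarrow> max_ideal_power A x n (h * f)"
proof (induction rule: max_ideal_power.induct)
  case (mult a n f)
  then show ?case
    using max_ideal_power.mult[of a A x n "h * f"] by (simp add: algebra_simps)
qed (auto intro: max_ideal_power.intros mult_mem simp: distrib_left)

lemma max_ideal_power_zero: "max_ideal_power A x n 0"
proof (induction n)
  case (Suc n)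
  then show ?case using max_ideal_power.mult[OF zero_mem zero_fun_apply, of x n 0] by simp
qed (auto intro: max_ideal_power.base zero_mem)

lemma max_ideal_power_uminus: "max_ideal_power A x n f \<Longrightarrow> max_ideal_power A x n (- f)"
  using max_ideal_power_mult[of x n f "- 1"] uminus_mem[OF one_mem] by simp

lemma max_ideal_power_diff:
  "max_ideal_power A x n f \<Longrightarrow> max_ideal_power A x n h \<Longrightarrow> max_ideal_power A x n (f - h)"
  using max_ideal_power.add[of A x n f "- h"] max_ideal_power_uminus[of x n h] by simp

lemma max_ideal_power_sum:
  "(\<And>i. i \<in> I \<Longrightarrow> max_ideal_power A x n (f i)) \<Longrightarrow> max_ideal_power A x n (\<Sum>i\<in>I. f i)"
  by (induction I rule: infinite_finite_induct) (auto intro: max_ideal_power_zero max_ideal_power.add)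

lemma max_ideal_power_Suc_imp: "max_ideal_power A x (Suc n) f \<Longrightarrow> max_ideal_power A x n f"
proof (induction "Suc n" f arbitrary: n rule: max_ideal_power.induct)
  case (mult a f n)
  then show ?case by (auto intro: max_ideal_power_mult)
qed (auto intro: max_ideal_power.add)

lemma max_ideal_power_antimono:
  assumes "m \<le> n" "max_ideal_power A x n f" shows "max_ideal_power A x m f"
  using assms by (induction n) (auto simp: le_Suc_eq intro: max_ideal_power_Suc_imp)

lemma max_ideal_power_mult_mult:
  assumes "max_ideal_power A x m f" "max_ideal_power A x n h"
  shows "max_ideal_power A x (m + n) (f * h)"
  using assms
proof (induction rule: max_ideal_power.induct)
  case (mult a m f)
  then show ?case
    using max_ideal_power.mult[of a A x "m + n" "f * h"] by (simp add: algebra_simps)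
qed (auto intro: max_ideal_power_mult max_ideal_power.add simp: distrib_right)

lemma max_ideal_power_vanish: "max_ideal_power A x n f \<Longrightarrow> n > 0 \<Longrightarrow> f x = 0"
  by (induction rule: max_ideal_power.induct) (auto simp: fun_apply)

lemma has_order_linear: "has_order_at_most k A P \<Longrightarrow> linear_operator A P"
  by (cases k) auto

lemma linear_operator_commutator:
  assumes "linear_operator A P" "a \<in> A"
  shows "linear_operator A (\<lambda>f. P (a * f) - a * P f)"
proof -
  have "P (a * ((\<lambda>_. c) * f)) = (\<lambda>_. c) * P (a * f)" if "f \<in> A" for c f
    using assms that unfolding linear_operator_def
    by (metis (no_types, lifting) mult.left_commute mult_mem)
  moreover have "P (a * f) - a * P f \<in> A" if "f \<in> A" for f
    using assms that unfolding linear_operator_def by (intro diff_mem) (auto intro: mult_mem simp: Pi_iff)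
  moreover have "P (a * (f + h)) - a * P (f + h) = P (a * f) - a * P f + (P (a * h) - a * P h)"
    if "f \<in> A" "h \<in> A" for f h
  proof -
    have "P (a * f + a * h) = P (a * f) + P (a * h)" "P (f + h) = P f + P h"
      using assms that mult_mem unfolding linear_operator_def by blast+
    then show ?thesis by (simp add: distrib_left)
  qed
  moreover have "P (a * ((\<lambda>_. c) * f)) - a * P ((\<lambda>_. c) * f) = (\<lambda>_. c) * (P (a * f) - a * P f)"
    if "f \<in> A" for c f
  proof -
    have "P ((\<lambda>_. c) * f) = (\<lambda>_. c) * P f"
      using assms that unfolding linear_operator_def by blast
    then show ?thesis using calculation(1)[OF that, of c] by (simp add: right_diff_distrib mult.left_commute)
  qed
  ultimately show ?thesis unfolding linear_operator_def by blast
qed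

lemma linear_operator_zero: "linear_operator A P \<Longrightarrow> P 0 = 0"
  unfolding linear_operator_def using zero_mem by (metis add_cancel_right_left)

lemma linear_operator_sum:
  assumes "linear_operator A P" "\<And>i. i \<in> I \<Longrightarrow> f i \<in> A"
  shows "P (\<Sum>i\<in>I. f i) = (\<Sum>i\<in>I. P (f i))"
  using assms(2)
proof (induction I rule: infinite_finite_induct)
  case (insert i I)
  have "P (f i + (\<Sum>i\<in>I. f i)) = P (f i) + P (\<Sum>i\<in>I. f i)"
    using assms(1) insert.prems sum_mem[of I f] unfolding linear_operator_def by auto
  then show ?case using insert by simp
qed (auto simp: linear_operator_zero[OF assms(1)])

lemma iterated_commutator_linear:
  "linear_operator A P \<Longrightarrow> set as \<subseteq> A \<Longrightarrow> linear_operator A (iterated_commutator P as)"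
  by (induction as arbitrary: P) (auto intro: linear_operator_commutator)

lemma iterated_commutator_eq_0:
  assumes "has_order_at_most k A P" "set as \<subseteq> A" "length as = Suc k" "f \<in> A"
  shows "iterated_commutator P as f = 0"
  using assms
proof (induction k arbitrary: P as)
  case 0
  then obtain a where "as = [a]" by (cases as) auto
  then show ?case using 0 by simp
next
  case (Suc k)
  then obtain a bs where "as = a # bs" by (cases as) auto
  then show ?case using Suc by simp
qed

lemma linear_operator_add:
  assumes "linear_operator A P" "linear_operator A Q"
  shows "linear_operator A (\<lambda>f. P f + Q f)"
proof -
  have "P f + Q f \<in> A" if "f \<in> A" for f
    using assms that add_mem unfolding linear_operator_def by auto
  moreover have "P (f + h) + Q (f + h) = P f + Q f + (P h + Q h)" if "f \<in> A" "h \<in> A" for f h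
    using assms that unfolding linear_operator_def by simp
  moreover have "P ((\<lambda>_. c) * f) + Q ((\<lambda>_. c) * f) = (\<lambda>_. c) * (P f + Q f)" if "f \<in> A" for c f
    using assms that unfolding linear_operator_def by (simp add: distrib_left)
  ultimately show ?thesis unfolding linear_operator_def by blast
qed

lemma linear_operator_cong:
  assumes "linear_operator A P" "\<And>f. f \<in> A \<Longrightarrow> Q f = P f"
  shows "linear_operator A Q"
  using assms(1) add_mem mult_mem const_mem
  unfolding linear_operator_def by (simp add: assms(2) Pi_iff)

lemma has_order_at_most_add:
  "has_order_at_most k A P \<Longrightarrow> has_order_at_most k A Q \<Longrightarrow> has_order_at_most k A (\<lambda>f. P f + Q f)"
proof (induction k arbitrary: P Q)
  case 0
  then show ?case using linear_operator_add[of P Q] by (simp add: distrib_left)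
next
  case (Suc k)
  have *: "(\<lambda>f. P (a * f) + Q (a * f) - a * (P f + Q f))
     = (\<lambda>f. (P (a * f) - a * P f) + (Q (a * f) - a * Q f))" for a
    by (auto simp: algebra_simps)
  have "has_order_at_most k A (\<lambda>f. P (a * f) + Q (a * f) - a * (P f + Q f))" if "a \<in> A" for a
    unfolding * using Suc that by simp
  then show ?case
    using Suc.prems linear_operator_add[of P Q] by simp
qed

lemma has_order_at_most_cong:
  assumes "has_order_at_most k A P" "\<And>f. f \<in> A \<Longrightarrow> Q f = P f"
  shows "has_order_at_most k A Q"
  using assms
proof (induction k arbitrary: P Q)
  case 0
  then have "linear_operator A Q" using linear_operator_cong[of P Q] by simp
  moreover have "Q (a * f) = a * Q f" if "a \<in> A" "f \<in> A" for a f
    using 0 that mult_mem by simp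
  ultimately show ?case by simp
next
  case (Suc k)
  then have l: "linear_operator A Q" using linear_operator_cong[of P Q] by simp
  have "has_order_at_most k A (\<lambda>f. Q (a * f) - a * Q f)" if "a \<in> A" for a
  proof (rule Suc.IH)
    show "has_order_at_most k A (\<lambda>f. P (a * f) - a * P f)" using Suc.prems that by simp
  qed (use Suc.prems that mult_mem in simp)
  with l show ?case by simp
qed

text \<open>The iterated commutators are additive in each of the functions involved, so the order can be
  tested on a set \<open>H\<close> that spans \<open>A\<close> additively; below \<open>H\<close> consists of the homogeneous functions.\<close>

lemma has_order_at_mostI:
  assumes H: "H \<subseteq> A" "\<And>f. f \<in> A \<Longrightarrow> \<exists>(n::nat) F. (\<forall>i<n. F i \<in> H) \<and> f = (\<Sum>i<n. F i)"
    and "linear_operator A P"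
    and "\<And>as f. length as = Suc k \<Longrightarrow> set as \<subseteq> H \<Longrightarrow> f \<in> H \<Longrightarrow> iterated_commutator P as f = 0"
  shows "has_order_at_most k A P"
  using assms(3,4)
proof (induction k arbitrary: P)
  case 0
  have eq: "P (a * f) = a * P f" if "a \<in> H" "f \<in> H" for a f
    using "0.prems"(2)[of "[a]" f] that by simp
  have mem: "F i \<in> A" if "\<forall>i<n. F i \<in> H" "i \<in> {..<n}" for F and i n :: nat
    using that H by auto
  have "P (a * f) = a * P f" if af: "a \<in> A" "f \<in> A" for a f
  proof -
    obtain m :: nat and K where K: "\<forall>i<m. K i \<in> H" "a = (\<Sum>i<m. K i)" using H(2)[OF af(1)] by blast
    obtain n :: nat and F where F: "\<forall>i<n. F i \<in> H" "f = (\<Sum>i<n. F i)" using H(2)[OF af(2)] by blast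
    have "P (a * f) = P (\<Sum>i<m. \<Sum>j<n. K i * F j)"
      unfolding K(2) F(2) sum_product ..
    also have "\<dots> = (\<Sum>i<m. P (\<Sum>j<n. K i * F j))"
      by (rule linear_operator_sum[OF 0(1)]) (use mem[OF K(1)] mem[OF F(1)] in \<open>auto intro!: sum_mem mult_mem\<close>)
    also have "\<dots> = (\<Sum>i<m. \<Sum>j<n. P (K i * F j))"
      by (rule sum.cong[OF refl], rule linear_operator_sum[OF 0(1)])
        (use mem[OF K(1)] mem[OF F(1)] in \<open>auto intro!: mult_mem\<close>)
    also have "\<dots> = (\<Sum>i<m. \<Sum>j<n. K i * P (F j))"
      using K F by (auto intro!: sum.cong eq)
    also have "\<dots> = a * (\<Sum>j<n. P (F j))"
      unfolding K(2) sum_product ..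
    also have "(\<Sum>j<n. P (F j)) = P f"
      unfolding F(2) by (rule linear_operator_sum[OF 0(1), symmetric]) (rule mem[OF F(1)])
    finally show ?thesis .
  qed
  with 0 show ?case by simp
next
  case (Suc k)
  let ?C = "\<lambda>a f. P (a * f) - a * P f"
  have ord: "has_order_at_most k A (?C a)" if "a \<in> H" for a
  proof (rule Suc.IH)
    show "linear_operator A (?C a)" using that H Suc.prems by (auto intro: linear_operator_commutator)
    show "iterated_commutator (?C a) as f = 0" if "length as = Suc k" "set as \<subseteq> H" "f \<in> H" for as f
      using Suc.prems(2)[of "a # as" f] that \<open>a \<in> H\<close> by simp
  qed
  have zero: "has_order_at_most k A (?C 0)"
  proof (rule Suc.IH)
    show l: "linear_operator A (?C 0)" using linear_operator_commutator[OF Suc.prems(1) zero_mem] .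
    have "?C 0 = (\<lambda>_. 0)" using linear_operator_zero[OF Suc.prems(1)] by auto
    moreover have "iterated_commutator (\<lambda>_. 0) as f = 0" for as and f :: "'x \<Rightarrow> complex"
      by (induction as) auto
    ultimately show "iterated_commutator (?C 0) as f = 0" for as f by simp
  qed
  have "has_order_at_most k A (?C (\<Sum>i<n. F i))" if "\<forall>i<n. F i \<in> H" for n :: nat and F
    using that
  proof (induction n)
    case 0
    then show ?case using zero by simp
  next
    case (Suc n)
    have 1: "(\<Sum>i<n. F i) \<in> A" "F n \<in> A" using Suc.prems H by (auto intro!: sum_mem)
    have eq: "?C ((\<Sum>i<n. F i) + F n) f = ?C (\<Sum>i<n. F i) f + ?C (F n) f" if "f \<in> A" for f
    proof -
      have "P ((\<Sum>i<n. F i) * f + F n * f) = P ((\<Sum>i<n. F i) * f) + P (F n * f)"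
        using \<open>linear_operator A P\<close> that 1 mult_mem unfolding linear_operator_def by blast
      then show ?thesis by (simp add: algebra_simps)
    qed
    have "has_order_at_most k A (\<lambda>f. ?C (\<Sum>i<n. F i) f + ?C (F n) f)"
      using Suc ord by (intro has_order_at_most_add) auto
    then show ?case
      unfolding sum.lessThan_Suc by (rule has_order_at_most_cong) (rule eq)
  qed
  then have "has_order_at_most k A (?C a)" if "a \<in> A" for a
    using H(2)[OF that] by auto
  then show ?case using Suc.prems by simp
qed

text \<open>A commutator with an element of the maximal ideal drops the order of the operator by one,
  and each factor taken out of the ideal power costs at most one order.\<close>

lemma has_order_max_ideal_power:
  assumes "has_order_at_most k A P" "max_ideal_power A x (n + k) f"
  shows "max_ideal_power A x n (P f)"
  using assms
proof (induction k arbitrary: P f n)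
  case 0
  have f: "f \<in> A" using 0 max_ideal_power_mem by auto
  then have "P (f * 1) = f * P 1" using 0 one_mem by (metis has_order_at_most.simps(1))
  then have "P f = P 1 * f" by (simp add: mult.commute)
  moreover have "P 1 \<in> A" using 0 one_mem by (auto simp: linear_operator_def)
  ultimately show ?case using 0 max_ideal_power_mult by simp
next
  case (Suc k)
  note IH = Suc.IH
  have lin: "linear_operator A P" using Suc.prems by simp
  have PA: "P h \<in> A" if "h \<in> A" for h using lin that by (auto simp: linear_operator_def)
  show ?case using Suc.prems(2)
  proof (induction n arbitrary: f)
    case 0
    then show ?case using PA max_ideal_power_mem by (auto intro: max_ideal_power.base)
  next
    case (Suc n)
    have "max_ideal_power A x (Suc n) (P f)" if "max_ideal_power A x m f" "m = Suc n + Suc k" for m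
      using that
    proof (induction rule: max_ideal_power.induct)
      case (mult a m h)
      have h: "h \<in> A" using mult max_ideal_power_mem by auto
      have o: "has_order_at_most k A (\<lambda>f. P (a * f) - a * P f)"
        using \<open>has_order_at_most (Suc k) A P\<close> mult by simp
      have 1: "max_ideal_power A x (Suc n) (P (a * h) - a * P h)"
        by (rule IH[OF o, of "Suc n"]) (use mult in simp)
      have "max_ideal_power A x n (P h)" using Suc.IH[of h] mult by simp
      then have 2: "max_ideal_power A x (Suc n) (a * P h)" using mult by (auto intro: max_ideal_power.mult)
      show ?case using max_ideal_power.add[OF 1 2] by simp
    next
      case (add m f h)
      then show ?case using lin max_ideal_power_mem by (auto simp: linear_operator_def intro: max_ideal_power.add)
    qed simp
    then show ?case using Suc.prems by simp
  qed
qed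

end

section \<open>The grading of polynomial functions\<close>

text \<open>For a polynomial function \<open>f\<close> the restriction to the line through \<open>v\<close> in direction \<open>w\<close> determines
  the polynomial, as the field is infinite. Its coefficients are the terms of the Taylor expansion of
  \<open>f\<close> at \<open>v\<close>, evaluated at \<open>w\<close>.\<close>

definition line_poly :: "(complex \<Rightarrow> 'v::ab_group_add \<Rightarrow> 'v) \<Rightarrow> ('v \<Rightarrow> complex) \<Rightarrow> 'v \<Rightarrow> 'v \<Rightarrow> complex poly" where
  "line_poly smul f v w = (THE p. \<forall>s. f (v + smul s w) = poly p s)"

text \<open>The homogeneous component of degree \<open>d\<close>, read off on the lines through the origin.\<close>

definition hcomp :: "(complex \<Rightarrow> 'v::ab_group_add \<Rightarrow> 'v) \<Rightarrow> nat \<Rightarrow> ('v \<Rightarrow> complex) \<Rightarrow> ('v \<Rightarrow> complex)" where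
  "hcomp smul d f = (\<lambda>v. coeff (line_poly smul f 0 v) d)"

locale complex_space = vector_space smul
  for smul :: "complex \<Rightarrow> 'v::ab_group_add \<Rightarrow> 'v"
begin

abbreviation "polys \<equiv> polynomials smul"

sublocale polys: function_algebra "polynomials smul"
  unfolding polynomials_def by (rule function_algebra_generated)

lemma linear_mem: "Vector_Spaces.linear smul (*) l \<Longrightarrow> l \<in> polys"
  unfolding polynomials_def by (intro generated_algebra.intros) simp

lemma polynomials_induct [consumes 1, case_names const linear add mult]:
  assumes "f \<in> polys"
    and "\<And>c. P (\<lambda>_. c)"
    and "\<And>l. Vector_Spaces.linear smul (*) l \<Longrightarrow> P l"
    and "\<And>f h. f \<in> polys \<Longrightarrow> P f \<Longrightarrow> h \<in> polys \<Longrightarrow> P h \<Longrightarrow> P (f + h)"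
    and "\<And>f h. f \<in> polys \<Longrightarrow> P f \<Longrightarrow> h \<in> polys \<Longrightarrow> P h \<Longrightarrow> P (f * h)"
  shows "P f"
  using assms unfolding polynomials_def by (induction rule: generated_algebra.induct) auto

lemma linear_line:
  assumes "Vector_Spaces.linear smul (*) l"
  shows "l (v + smul s w) = l v + s * l w"
proof -
  interpret l: Vector_Spaces.linear smul "(*)" l by fact
  show ?thesis by (simp add: l.add l.scale)
qed

lemma linear_at_0: "Vector_Spaces.linear smul (*) l \<Longrightarrow> l 0 = 0"
  using linear_line[of l 0 0 0] linear_line[of l 0 1 0] by simp

lemma line_poly_eqI:
  assumes "\<And>s. f (v + smul s w) = poly p s"
  shows "line_poly smul f v w = p"
  unfolding line_poly_def
proof (rule the_equality)
  show "q = p" if "\<forall>s. f (v + smul s w) = poly q s" for q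
    using assms that poly_eq_poly_eq_iff[of q p] by auto
qed (use assms in auto)

lemma poly_line_poly:
  assumes "f \<in> polys"
  shows "poly (line_poly smul f v w) s = f (v + smul s w)"
proof -
  have "\<exists>p. \<forall>s. f (v + smul s w) = poly p s"
    using assms
  proof (induction rule: polynomials_induct)
    case (const c)
    show ?case by (rule exI[of _ "[:c:]"]) simp
  next
    case (linear l)
    show ?case by (rule exI[of _ "[:l v, l w:]"]) (simp add: linear_line[OF linear])
  next
    case (add f h)
    then obtain p q where "\<forall>s. f (v + smul s w) = poly p s" "\<forall>s. h (v + smul s w) = poly q s" by auto
    then show ?case by (intro exI[of _ "p + q"]) (simp add: fun_apply)
  next
    case (mult f h)
    then obtain p q where "\<forall>s. f (v + smul s w) = poly p s" "\<forall>s. h (v + smul s w) = poly q s" by auto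
    then show ?case by (intro exI[of _ "p * q"]) (simp add: fun_apply)
  qed
  then obtain p where p: "\<forall>s. f (v + smul s w) = poly p s" ..
  then have "line_poly smul f v w = p" by (intro line_poly_eqI) auto
  with p show ?thesis by simp
qed

lemma line_poly_const: "line_poly smul (\<lambda>_. c) v w = [:c:]"
  by (rule line_poly_eqI) simp

lemma line_poly_linear:
  "Vector_Spaces.linear smul (*) l \<Longrightarrow> line_poly smul l v w = [:l v, l w:]"
  by (rule line_poly_eqI) (simp add: linear_line)

lemma line_poly_add:
  "f \<in> polys \<Longrightarrow> h \<in> polys \<Longrightarrow> line_poly smul (f + h) v w = line_poly smul f v w + line_poly smul h v w"
  by (rule line_poly_eqI) (simp add: poly_line_poly fun_apply)

lemma line_poly_mult:
  "f \<in> polys \<Longrightarrow> h \<in> polys \<Longrightarrow> line_poly smul (f * h) v w = line_poly smul f v w * line_poly smul h v w"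
  by (rule line_poly_eqI) (simp add: poly_line_poly fun_apply)

lemma coeff_0_line_poly: "f \<in> polys \<Longrightarrow> coeff (line_poly smul f v w) 0 = f v"
  using poly_line_poly[of f v w 0] by (simp add: poly_0_coeff_0)

abbreviation "hc \<equiv> hcomp smul"

lemma hcomp_const: "hc d (\<lambda>_. c) = (if d = 0 then (\<lambda>_. c) else 0)"
  by (auto simp: hcomp_def line_poly_const fun_eq_iff fun_apply coeff_pCons split: nat.splits)

lemma hcomp_linear: "Vector_Spaces.linear smul (*) l \<Longrightarrow> hc d l = (if d = 1 then l else 0)"
  by (auto simp: linear_at_0 hcomp_def line_poly_linear fun_eq_iff fun_apply coeff_pCons split: nat.splits)

lemma hcomp_add: "f \<in> polys \<Longrightarrow> h \<in> polys \<Longrightarrow> hc d (f + h) = hc d f + hc d h"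
  by (auto simp: hcomp_def line_poly_add fun_eq_iff fun_apply)

lemma hcomp_mult:
  "f \<in> polys \<Longrightarrow> h \<in> polys \<Longrightarrow> hc d (f * h) = (\<Sum>i\<le>d. hc i f * hc (d - i) h)"
  by (auto simp: hcomp_def line_poly_mult fun_eq_iff fun_apply sum_fun_apply coeff_mult)

lemma hcomp_zero [simp]: "hc d 0 = 0"
  using hcomp_const[of d 0] by (auto simp: zero_fun_def split: if_splits)

lemma hcomp_scale: "f \<in> polys \<Longrightarrow> hc d ((\<lambda>_. c) * f) = (\<lambda>_. c) * hc d f"
  by (auto simp: hcomp_def line_poly_mult polys.const_mem line_poly_const fun_eq_iff fun_apply)

lemma hcomp_sum:
  "(\<And>i. i \<in> I \<Longrightarrow> f i \<in> polys) \<Longrightarrow> hc d (\<Sum>i\<in>I. f i) = (\<Sum>i\<in>I. hc d (f i))"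
  by (induction I rule: infinite_finite_induct) (auto simp: hcomp_add polys.sum_mem)

lemma hcomp_uminus: "f \<in> polys \<Longrightarrow> hc d (- f) = - hc d f"
  using hcomp_add[of f "- f" d] polys.uminus_mem[of f] by (simp add: eq_neg_iff_add_eq_0 add.commute)

lemma hcomp_diff: "f \<in> polys \<Longrightarrow> h \<in> polys \<Longrightarrow> hc d (f - h) = hc d f - hc d h"
  using hcomp_add[of f "- h" d] hcomp_uminus[of h] polys.uminus_mem[of h] by simp

lemma hcomp_mem: "f \<in> polys \<Longrightarrow> hc d f \<in> polys"
proof (induction arbitrary: d rule: polynomials_induct)
  case (mult f h)
  then show ?case by (auto simp: hcomp_mult intro!: polys.sum_mem polys.mult_mem)
qed (auto simp: hcomp_const hcomp_linear hcomp_add polys.const_mem polys.zero_mem polys.add_mem linear_mem)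

lemma hcomp_eventually_0: "f \<in> polys \<Longrightarrow> \<exists>D. \<forall>d>D. hc d f = 0"
proof (induction rule: polynomials_induct)
  case (add f h)
  then obtain D E where "\<forall>d>D. hc d f = 0" "\<forall>d>E. hc d h = 0" by auto
  then show ?case using add by (intro exI[of _ "max D E"]) (auto simp: hcomp_add)
next
  case (mult f h)
  then obtain D E where D: "\<forall>d>D. hc d f = 0" "\<forall>d>E. hc d h = 0" by auto
  have "hc i f * hc (d - i) h = 0" if "d > D + E" for i d
    using that D by (cases "i > D") auto
  then show ?case using mult by (intro exI[of _ "D + E"]) (auto simp: hcomp_mult)
qed (auto simp: hcomp_const hcomp_linear intro!: exI[of _ 1])

lemma hcomp_at_0: "f \<in> polys \<Longrightarrow> hc d f 0 = (if d = 0 then f 0 else 0)"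
proof -
  assume "f \<in> polys"
  have "line_poly smul f 0 0 = [:f 0:]" by (rule line_poly_eqI) simp
  then show ?thesis by (auto simp: hcomp_def coeff_pCons split: nat.splits)
qed

lemma hcomp_0: "f \<in> polys \<Longrightarrow> hc 0 f = (\<lambda>_. f 0)"
  by (auto simp: hcomp_def coeff_0_line_poly)

lemma poly_line_poly_degree_le:
  assumes "f \<in> polys" "\<And>d. d > D \<Longrightarrow> hc d f = 0"
  shows "f (smul s v) = (\<Sum>d\<le>D. s ^ d * hc d f v)"
proof -
  have "coeff (line_poly smul f 0 v) d = 0" if "d > D" for d
    using assms(2)[OF that] by (auto simp: hcomp_def fun_eq_iff fun_apply)
  then have "degree (line_poly smul f 0 v) \<le> D" by (auto intro: degree_le)
  then have "(\<Sum>d\<le>degree (line_poly smul f 0 v). coeff (line_poly smul f 0 v) d * s ^ d)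
      = (\<Sum>d\<le>D. coeff (line_poly smul f 0 v) d * s ^ d)"
    by (intro sum.mono_neutral_left) (auto simp: not_le coeff_eq_0)
  then show ?thesis using poly_line_poly[OF assms(1), of 0 v s]
    by (simp add: poly_altdef hcomp_def mult.commute)
qed

lemma sum_hcomp:
  assumes "f \<in> polys" "\<And>d. d > D \<Longrightarrow> hc d f = 0"
  shows "(\<Sum>d\<le>D. hc d f) = f"
  using poly_line_poly_degree_le[OF assms, where s = 1] by (auto simp: fun_eq_iff sum_fun_apply)

lemma hcomp_homogeneous: "f \<in> polys \<Longrightarrow> hc d f (smul c v) = c ^ d * hc d f v"
proof -
  assume f: "f \<in> polys"
  have "line_poly smul f 0 (smul c v) = pcompose (line_poly smul f 0 v) [:0, c:]"
    by (rule line_poly_eqI) (simp add: poly_pcompose poly_line_poly f mult.commute)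
  then show ?thesis by (simp add: hcomp_def coeff_pcompose_linear)
qed

lemma hcomp_of_homogeneous:
  assumes "f \<in> polys" "\<And>c v. f (smul c v) = c ^ d * f v"
  shows "hc k f = (if k = d then f else 0)"
proof -
  have "line_poly smul f 0 v = monom (f v) d" for v
    by (rule line_poly_eqI) (simp add: assms poly_monom mult.commute)
  then show ?thesis by (auto simp: hcomp_def fun_eq_iff fun_apply)
qed

lemma hcomp_hcomp: "f \<in> polys \<Longrightarrow> hc k (hc d f) = (if k = d then hc d f else 0)"
  by (rule hcomp_of_homogeneous) (auto intro: hcomp_mem hcomp_homogeneous)

text \<open>A linear function has degree one and vanishes at the origin, and both the degree and the ideal
  power add up in products.\<close>

lemma max_ideal_power_hcomp: "f \<in> polys \<Longrightarrow> max_ideal_power polys 0 d (hc d f)"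
proof (induction arbitrary: d rule: polynomials_induct)
  case (const c)
  then show ?case
    by (auto simp: hcomp_const intro: max_ideal_power.intros polys.const_mem polys.max_ideal_power_zero)
next
  case (linear l)
  have "max_ideal_power polys 0 1 (l * 1)"
    using max_ideal_power.mult[of l polys 0 0 1] max_ideal_power.base[OF polys.one_mem]
    by (simp add: linear linear_at_0 linear_mem)
  then show ?case by (auto simp: hcomp_linear[OF linear] polys.max_ideal_power_zero)
next
  case (add f h)
  then show ?case by (auto simp: hcomp_add intro: max_ideal_power.intros)
next
  case (mult f h)
  have "max_ideal_power polys 0 d (hc i f * hc (d - i) h)" if "i \<le> d" for i
    using polys.max_ideal_power_mult_mult[OF mult.IH, of i "d - i"] that by simp
  then show ?case using mult by (auto simp: hcomp_mult intro!: polys.max_ideal_power_sum)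
qed

end

text \<open>A subalgebra of the polynomial functions that contains the homogeneous components of its
  elements. Below this is the algebra of invariants.\<close>

locale graded_algebra = complex_space smul + function_algebra A
  for smul :: "complex \<Rightarrow> 'v::ab_group_add \<Rightarrow> 'v" and A :: "('v \<Rightarrow> complex) set" +
  assumes subset: "A \<subseteq> polys"
    and hcomp_closed: "f \<in> A \<Longrightarrow> hc d f \<in> A"
begin

definition homog :: "nat \<Rightarrow> ('v \<Rightarrow> complex) set" where
  "homog d = {f \<in> A. \<forall>c v. f (smul c v) = c ^ d * f v}"

lemma mem_polys: "f \<in> A \<Longrightarrow> f \<in> polys"
  using subset by auto

lemma homog_mem: "f \<in> homog d \<Longrightarrow> f \<in> A"
  by (simp add: homog_def)

lemma hcomp_mem_homog: "f \<in> A \<Longrightarrow> hc d f \<in> homog d"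
  unfolding homog_def using hcomp_closed hcomp_homogeneous mem_polys by auto

lemma hcomp_homog: "f \<in> homog d \<Longrightarrow> hc k f = (if k = d then f else 0)"
  by (rule hcomp_of_homogeneous) (auto simp: homog_def mem_polys)

lemma homog_mult: "f \<in> homog d \<Longrightarrow> h \<in> homog e \<Longrightarrow> f * h \<in> homog (d + e)"
  unfolding homog_def by (auto simp: fun_apply power_add intro: mult_mem)

text \<open>Ideal powers are homogeneous ideals, because the maximal ideal at the origin is.\<close>

lemma max_ideal_power_hcomp_closed:
  "max_ideal_power A 0 n f \<Longrightarrow> max_ideal_power A 0 n (hc k f)"
proof (induction arbitrary: k rule: max_ideal_power.induct)
  case (base f)
  then show ?case by (auto intro: max_ideal_power.intros hcomp_closed)
next
  case (mult a n f)
  have "max_ideal_power A 0 (Suc n) (hc i a * hc (k - i) f)" for i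
    using mult hcomp_at_0[OF mem_polys, of a i]
    by (intro max_ideal_power.intros) (auto intro: hcomp_closed)
  then show ?case
    using mult max_ideal_power_mem mem_polys by (auto simp: hcomp_mult intro!: max_ideal_power_sum)
next
  case (add n f h)
  then show ?case
    using max_ideal_power_mem mem_polys by (auto simp: hcomp_add intro: max_ideal_power.intros)
qed

lemma hcomp_max_ideal_power:
  "max_ideal_power A 0 n f \<Longrightarrow> k < n \<Longrightarrow> hc k f = 0"
proof (induction arbitrary: k rule: max_ideal_power.induct)
  case (mult a n f)
  have "hc i a * hc (k - i) f = 0" if "i \<le> k" for i
    using mult mult.IH[of "k - i"] that hcomp_0[OF mem_polys, of a]
    by (cases "i = 0") (auto simp: fun_eq_iff fun_apply)
  then show ?case
    using mult max_ideal_power_mem mem_polys by (auto simp: hcomp_mult)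
next
  case (add n f h)
  then show ?case
    using max_ideal_power_mem mem_polys by (auto simp: hcomp_add)
qed simp

end

section \<open>Interpolation in finite-dimensional spaces of functions\<close>

abbreviation fun_span :: "('x \<Rightarrow> complex) set \<Rightarrow> ('x \<Rightarrow> complex) set" where
  "fun_span \<equiv> module.span (\<lambda>c f. (\<lambda>_. c) * f)"

lemma fun_vector_space: "vector_space (\<lambda>(c::complex) (f::'x \<Rightarrow> complex). (\<lambda>_. c) * f)"
  by unfold_locales (auto simp: fun_eq_iff fun_apply algebra_simps)

text \<open>A function outside the span of the basis found so far can be changed to vanish at the points
  found so far; a point where it does not vanish is the next one. The coordinates with respect to such
  a basis are values at points. Hence the matrix coefficients of a group that acts on the functions
  are again values of functions, which makes their regularity evident.\<close>

lemma interpolation_basis: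
  fixes F :: "('x \<Rightarrow> complex) set"
  assumes "finite S" "F \<subseteq> fun_span S"
    and "0 \<in> F" "\<And>f h. f \<in> F \<Longrightarrow> h \<in> F \<Longrightarrow> f + h \<in> F" "\<And>c f. f \<in> F \<Longrightarrow> (\<lambda>_. c) * f \<in> F"
  shows "\<exists>n (x :: nat \<Rightarrow> 'x) b. (\<forall>i<n. b i \<in> F) \<and>
    (\<forall>i<n. \<forall>k<n. b i (x k) = (if i = k then 1 else 0)) \<and>
    (\<forall>f\<in>F. \<forall>v. f v = (\<Sum>i<n. f (x i) * b i v))"
  using assms
proof (induction S arbitrary: F rule: finite_induct)
  case empty
  interpret fs: vector_space "\<lambda>(c::complex) (f::'x \<Rightarrow> complex). (\<lambda>_. c) * f" by (rule fun_vector_space)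
  have "F \<subseteq> {0}" using empty by simp
  then show ?case by (intro exI[of _ 0]) (auto simp: fun_apply)
next
  case (insert m S)
  interpret fs: vector_space "\<lambda>(c::complex) (f::'x \<Rightarrow> complex). (\<lambda>_. c) * f" by (rule fun_vector_space)
  have Fdiff: "f - h \<in> F" if "f \<in> F" "h \<in> F" for f h
  proof -
    have "f + (\<lambda>_. -1) * h \<in> F" using insert.prems that by blast
    also have "f + (\<lambda>_. -1) * h = f - h" by (auto simp: fun_eq_iff fun_apply)
    finally show ?thesis .
  qed
  have Fsum: "(\<Sum>i\<in>I. f i) \<in> F" if "\<And>i. i \<in> I \<Longrightarrow> f i \<in> F" for f and I :: "nat set"
    using that by (induction I rule: infinite_finite_induct) (auto intro: insert.prems)
  define F' where "F' = F \<inter> fs.span S"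
  have "\<exists>n (x :: nat \<Rightarrow> 'x) b. (\<forall>i<n. b i \<in> F') \<and>
    (\<forall>i<n. \<forall>k<n. b i (x k) = (if i = k then 1 else 0)) \<and>
    (\<forall>f\<in>F'. \<forall>v. f v = (\<Sum>i<n. f (x i) * b i v))"
    unfolding F'_def
    by (rule insert.IH) (auto intro: insert.prems fs.span_add fs.span_scale fs.span_zero)
  then obtain n and x :: "nat \<Rightarrow> 'x" and b where b: "\<And>i. i < n \<Longrightarrow> b i \<in> F'"
    "\<And>i k. i < n \<Longrightarrow> k < n \<Longrightarrow> b i (x k) = (if i = k then 1 else 0)"
    "\<And>f v. f \<in> F' \<Longrightarrow> f v = (\<Sum>i<n. f (x i) * b i v)"
    by blast
  show ?case
  proof (cases "F \<subseteq> fs.span S")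
    case True
    then have "F' = F" by (auto simp: F'_def)
    then show ?thesis using b by blast
  next
    case False
    then obtain f0 where f0: "f0 \<in> F" "f0 \<notin> fs.span S" by auto
    obtain c0 where c0: "f0 - (\<lambda>_. c0) * m \<in> fs.span S"
      using insert.prems(1) f0 unfolding fs.span_insert by blast
    have "c0 \<noteq> 0"
    proof
      assume "c0 = 0"
      then have "f0 - (\<lambda>_. c0) * m = f0" by (auto simp: fun_eq_iff fun_apply)
      with c0 have "f0 \<in> fs.span S" by (simp only:)
      with f0(2) show False ..
    qed
    define g where "g = f0 - (\<Sum>i<n. (\<lambda>_. f0 (x i)) * b i)"
    have bF: "b i \<in> F" "b i \<in> fs.span S" if "i < n" for i using b(1)[OF that] by (auto simp: F'_def)
    have "g \<in> F" unfolding g_def using bF f0 insert.prems by (intro Fdiff Fsum) auto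
    have gx: "g (x k) = 0" if "k < n" for k
    proof -
      have "(\<Sum>i<n. f0 (x i) * b i (x k)) = (\<Sum>i<n. if i = k then f0 (x k) else 0)"
        by (rule sum.cong) (use b(2) that in auto)
      then show ?thesis using that by (simp add: g_def fun_apply sum_fun_apply)
    qed
    have "g \<noteq> 0"
    proof
      assume "g = 0"
      then have "f0 = (\<Sum>i<n. (\<lambda>_. f0 (x i)) * b i)" by (simp add: g_def)
      also have "\<dots> \<in> fs.span S" using bF by (intro fs.span_sum fs.span_scale) auto
      finally show False using f0 by simp
    qed
    then obtain y where y: "g y \<noteq> 0" by (auto simp: fun_eq_iff fun_apply)
    define e where "e = (\<lambda>_. inverse (g y)) * g"
    define b' where "b' i = (if i < n then b i - (\<lambda>_. b i y) * e else e)" for i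
    define x' where "x' i = (if i < n then x i else y)" for i
    have eF: "e \<in> F" using \<open>g \<in> F\<close> insert.prems by (simp add: e_def)
    have ex: "e (x k) = 0" if "k < n" for k using gx[OF that] by (simp add: e_def fun_apply)
    have ey: "e y = 1" using y by (simp add: e_def fun_apply)
    have expand: "f v = (\<Sum>i<Suc n. f (x' i) * b' i v)" if fF: "f \<in> F" for f v
    proof -
      obtain c where c: "f - (\<lambda>_. c) * m \<in> fs.span S"
        using insert.prems(1) fF unfolding fs.span_insert by blast
      define k where "k = c / c0"
      define f' where "f' = f - (\<lambda>_. k) * f0"
      have "f' = (f - (\<lambda>_. c) * m) - (\<lambda>_. k) * (f0 - (\<lambda>_. c0) * m)"
        using \<open>c0 \<noteq> 0\<close> by (auto simp: f'_def k_def fun_eq_iff fun_apply algebra_simps)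
      then have "f' \<in> fs.span S" using c c0 by (auto intro: fs.span_diff fs.span_scale)
      moreover have "f' \<in> F" unfolding f'_def using Fdiff insert.prems f0 that by auto
      ultimately have f': "f' u = (\<Sum>i<n. f' (x i) * b i u)" for u by (intro b(3)) (simp add: F'_def)
      have kg: "k * g u = f u - (\<Sum>i<n. f (x i) * b i u)" for u
        using f'[of u]
        by (simp add: f'_def g_def fun_apply sum_fun_apply algebra_simps sum_subtractf sum_distrib_left)
      have "k * g v = k * g y * e v" using y by (simp add: e_def fun_apply)
      then have "f v = (\<Sum>i<n. f (x i) * b i v) + (f y - (\<Sum>i<n. f (x i) * b i y)) * e v"
        using kg[of v] kg[of y] by (simp add: algebra_simps)
      also have "\<dots> = (\<Sum>i<n. f (x i) * (b i v - b i y * e v)) + f y * e v"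
        by (simp add: algebra_simps sum_subtractf sum_distrib_left)
      also have "(\<Sum>i<n. f (x i) * (b i v - b i y * e v)) = (\<Sum>i<n. f (x' i) * b' i v)"
        by (rule sum.cong) (auto simp: x'_def b'_def fun_apply)
      finally show ?thesis by (simp add: x'_def b'_def)
    qed
    have "b' i \<in> F" for i
      using bF eF insert.prems by (auto simp: b'_def intro!: Fdiff)
    moreover have "b' i (x' k) = (if i = k then 1 else 0)" if "i < Suc n" "k < Suc n" for i k
      using that b(2) ex ey by (auto simp: b'_def x'_def fun_apply)
    ultimately show ?thesis using expand by (intro exI[of _ "Suc n"] exI[of _ x'] exI[of _ b']) auto
  qed
qed

context complex_space
begin

primrec monomials :: "('v \<Rightarrow> complex) set \<Rightarrow> nat \<Rightarrow> ('v \<Rightarrow> complex) set" where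
  "monomials L 0 = {1}"
| "monomials L (Suc d) = (\<lambda>(l, m). l * m) ` (L \<times> monomials L d)"

lemma finite_monomials: "finite L \<Longrightarrow> finite (monomials L d)"
  by (induction d) auto

text \<open>The coordinate functions of a basis span the dual space.\<close>

lemma linear_functionals_span:
  assumes "finite B" "UNIV = span B"
  obtains L where "finite L" "\<And>l. Vector_Spaces.linear smul (*) l \<Longrightarrow> l \<in> fun_span L"
proof -
  interpret fs: vector_space "\<lambda>(c::complex) (f::'v \<Rightarrow> complex). (\<lambda>_. c) * f" by (rule fun_vector_space)
  obtain B' where B': "B' \<subseteq> B" "independent B'" "B \<subseteq> span B'"
    using maximal_independent_subset[of B] by auto
  have sp: "v \<in> span B'" for v
    using span_mono[OF B'(3)] assms by (auto simp: span_span)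
  have fin: "finite B'" by (rule finite_subset[OF B'(1) assms(1)])
  define L where "L = (\<lambda>b v. representation B' v b) ` B'"
  have "l \<in> fs.span L" if l: "Vector_Spaces.linear smul (*) l" for l
  proof -
    interpret l: Vector_Spaces.linear smul "(*)" l by fact
    have lv: "l v = (\<Sum>b\<in>B'. l b * representation B' v b)" for v
    proof -
      have "l v = l (\<Sum>b\<in>B'. smul (representation B' v b) b)"
        using sum_representation_eq[OF B'(2) sp fin] by simp
      also have "\<dots> = (\<Sum>b\<in>B'. l b * representation B' v b)"
        by (simp add: l.sum l.scale mult.commute)
      finally show ?thesis .
    qed
    have "l = (\<Sum>b\<in>B'. (\<lambda>_. l b) * (\<lambda>v. representation B' v b))"
      by (intro ext) (simp only: sum_fun_apply times_fun_apply, rule lv)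
    also have "\<dots> \<in> fs.span L"
      by (intro fs.span_sum fs.span_scale fs.span_base) (auto simp: L_def)
    finally show ?thesis .
  qed
  with fin show ?thesis by (intro that[of L]) (auto simp: L_def)
qed

lemma monomials_span_mult:
  assumes "f \<in> fun_span (monomials L i)" "h \<in> fun_span (monomials L j)"
  shows "f * h \<in> fun_span (monomials L (i + j))"
proof -
  interpret fs: vector_space "\<lambda>(c::complex) (f::'v \<Rightarrow> complex). (\<lambda>_. c) * f" by (rule fun_vector_space)
  have linear: "l * f \<in> fs.span (monomials L (Suc k))" if "l \<in> L" "f \<in> fs.span (monomials L k)" for l f k
    using that(2)
  proof (induction rule: fs.span_induct_alt)
    case base
    then show ?case using fs.span_zero by simp
  next
    case (step c x y)
    have lx: "l * x \<in> monomials L (Suc k)" using step \<open>l \<in> L\<close> by auto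
    have "(\<lambda>_. c) * (l * x) + l * y \<in> fs.span (monomials L (Suc k))"
      using step fs.span_base[OF lx] by (intro fs.span_add fs.span_scale) (simp_all del: monomials.simps)
    then show ?case by (simp add: algebra_simps)
  qed
  have monomial: "m * h \<in> fs.span (monomials L (i + j))" if "m \<in> monomials L i" for m
    using that
  proof (induction i arbitrary: m)
    case 0
    then show ?case using assms by simp
  next
    case (Suc i)
    then obtain l m' where "l \<in> L" "m' \<in> monomials L i" "m = l * m'" by auto
    then show ?case using linear[of l "m' * h"] Suc.IH[of m'] by (simp add: mult.assoc)
  qed
  show ?thesis using assms(1)
  proof (induction rule: fs.span_induct_alt)
    case base
    then show ?case using fs.span_zero by simp
  next
    case (step c x y)
    have "(\<lambda>_. c) * (x * h) + y * h \<in> fs.span (monomials L (i + j))"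
      using step monomial by (intro fs.span_add fs.span_scale) auto
    then show ?case by (simp add: algebra_simps)
  qed
qed

lemma homogeneous_span_monomials:
  assumes L: "\<And>l. Vector_Spaces.linear smul (*) l \<Longrightarrow> l \<in> fun_span L" and "f \<in> polys"
  shows "hc d f \<in> fun_span (monomials L d)"
proof -
  interpret fs: vector_space "\<lambda>(c::complex) (f::'v \<Rightarrow> complex). (\<lambda>_. c) * f" by (rule fun_vector_space)
  show ?thesis using assms(2)
  proof (induction arbitrary: d rule: polynomials_induct)
    case (const c)
    have "(\<lambda>_. c) * 1 \<in> fs.span (monomials L 0)" by (intro fs.span_scale fs.span_base) simp
    then show ?case by (auto simp: hcomp_const fs.span_zero)
  next
    case (linear l)
    have "monomials L 1 = L" by (auto simp: image_def)
    then show ?case using L[OF linear] by (simp add: hcomp_linear[OF linear] fs.span_zero)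
  next
    case (add f h)
    then show ?case by (simp add: hcomp_add fs.span_add)
  next
    case (mult f h)
    have "hc i f * hc (d - i) h \<in> fs.span (monomials L d)" if "i \<le> d" for i
      using monomials_span_mult[OF mult.IH, of i "d - i"] that by simp
    then have "(\<Sum>i\<le>d. hc i f * hc (d - i) h) \<in> fs.span (monomials L d)"
      by (intro fs.span_sum) simp
    then show ?case using mult by (simp add: hcomp_mult)
  qed
qed

end

section \<open>Invariant functionals and invariant differential operators\<close>

locale reductive_module = complex_space smul
  for smul :: "complex \<Rightarrow> 'v::ab_group_add \<Rightarrow> 'v" +
  fixes G :: "(complex^'n^'n) set" and \<rho> :: "complex^'n^'n \<Rightarrow> 'v \<Rightarrow> 'v"
  assumes reductive: "reductive_group G"
    and rational: "rational_module G smul UNIV \<rho>"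
begin

lemma group_inv: "g \<in> G \<Longrightarrow> matrix_inv g \<in> G"
  using reductive unfolding reductive_group_def linear_algebraic_group_def by auto

lemma act_add: "g \<in> G \<Longrightarrow> \<rho> g (v + w) = \<rho> g v + \<rho> g w"
  and act_scale: "g \<in> G \<Longrightarrow> \<rho> g (smul c v) = smul c (\<rho> g v)"
  and act_one: "\<rho> (mat 1) v = v"
  and act_mult: "g \<in> G \<Longrightarrow> h \<in> G \<Longrightarrow> \<rho> (g ** h) v = \<rho> g (\<rho> h v)"
  and act_regular: "Vector_Spaces.linear smul (*) l \<Longrightarrow> \<exists>f\<in>GL_regular. \<forall>g\<in>G. l (\<rho> g v) = f g"
  and finite_dim: "\<exists>B. finite B \<and> UNIV = span B"
  using rational unfolding rational_module_def by auto

sublocale GL: function_algebra "GL_regular :: (complex^'n^'n \<Rightarrow> complex) set"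
  unfolding GL_regular_def by (rule function_algebra_generated)

lemma linear_act:
  assumes "g \<in> G" "Vector_Spaces.linear smul (*) l"
  shows "Vector_Spaces.linear smul (*) (\<lambda>v. l (\<rho> g v))"
proof -
  interpret l: Vector_Spaces.linear smul "(*)" l by fact
  show ?thesis
    by unfold_locales (auto simp: act_add act_scale assms(1) l.add l.scale)
qed

lemma polys_act:
  assumes "g \<in> G"
  shows "f \<in> polys \<Longrightarrow> (\<lambda>v. f (\<rho> g v)) \<in> polys"
proof (induction rule: polynomials_induct)
  case (const c)
  then show ?case by (rule polys.const_mem)
next
  case (linear l)
  then show ?case using linear_act assms linear_mem by blast
next
  case (add f h)
  have "(\<lambda>v. (f + h) (\<rho> g v)) = (\<lambda>v. f (\<rho> g v)) + (\<lambda>v. h (\<rho> g v))" by (auto simp: fun_apply)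
  then show ?case using add polys.add_mem by simp
next
  case (mult f h)
  have "(\<lambda>v. (f * h) (\<rho> g v)) = (\<lambda>v. f (\<rho> g v)) * (\<lambda>v. h (\<rho> g v))" by (auto simp: fun_apply)
  then show ?case using mult polys.mult_mem by simp
qed

text \<open>The matrix coefficients of linear functionals are regular by the definition of a rational module,
  and regular functions form an algebra.\<close>

lemma polys_act_regular: "f \<in> polys \<Longrightarrow> \<exists>r\<in>GL_regular. \<forall>g\<in>G. f (\<rho> g v) = r g"
proof (induction rule: polynomials_induct)
  case (const c)
  then show ?case by (intro bexI[of _ "\<lambda>_. c"] GL.const_mem) simp
next
  case (linear l)
  then show ?case by (rule act_regular)
next
  case (add f h)
  then obtain p q where "p \<in> GL_regular" "q \<in> GL_regular"
    "\<forall>g\<in>G. f (\<rho> g v) = p g" "\<forall>g\<in>G. h (\<rho> g v) = q g" by auto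
  then show ?case by (intro bexI[of _ "p + q"] GL.add_mem) (auto simp: fun_apply)
next
  case (mult f h)
  then obtain p q where "p \<in> GL_regular" "q \<in> GL_regular"
    "\<forall>g\<in>G. f (\<rho> g v) = p g" "\<forall>g\<in>G. h (\<rho> g v) = q g" by auto
  then show ?case by (intro bexI[of _ "p * q"] GL.mult_mem) (auto simp: fun_apply)
qed

abbreviation invs :: "('v \<Rightarrow> complex) set" where
  "invs \<equiv> invariants G smul \<rho>"

sublocale graded_algebra smul "invariants G smul \<rho>"
proof unfold_locales
  fix f d assume f: "f \<in> invs"
  have "line_poly smul f 0 (\<rho> g v) = line_poly smul f 0 v" if "g \<in> G" for g v
  proof (rule line_poly_eqI)
    fix s
    have "f (\<rho> g (smul s v)) = f (smul s v)" using f that by (auto simp: invariants_def)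
    then show "f (0 + smul s (\<rho> g v)) = poly (line_poly smul f 0 v) s"
      using f that by (simp add: poly_line_poly invariants_def act_scale)
  qed
  then have "\<forall>g\<in>G. \<forall>v. hc d f (\<rho> g v) = hc d f v" by (simp add: hcomp_def)
  then show "hc d f \<in> invs" using f by (simp add: invariants_def hcomp_mem)
qed (auto simp: invariants_def fun_apply intro: polys.const_mem polys.add_mem polys.mult_mem)

text \<open>The functional is a combination of evaluations at the points of an interpolation basis. Written
  in the coordinates given by these evaluations, the dual of the space of homogeneous polynomials is
  a rational module \<open>W\<close>, and its vectors that annihilate \<open>f\<close> form a submodule of codimension one.
  A complement is an invariant line, on which \<open>G\<close> acts trivially because \<open>f\<close> is invariant.\<close>

lemma invariant_functional:
  assumes f: "f \<in> homog d" "f \<noteq> 0"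
  shows "\<exists>(n :: nat) x y. (\<Sum>k<n. y k * f (x k)) = 1 \<and>
    (\<forall>g\<in>G. \<forall>h\<in>polys. (\<Sum>k<n. y k * hc d h (\<rho> g (x k))) = (\<Sum>k<n. y k * hc d h (x k)))"
proof -
  obtain B where B: "finite B" "UNIV = span B" using finite_dim by auto
  obtain L where L: "finite L" "\<And>l. Vector_Spaces.linear smul (*) l \<Longrightarrow> l \<in> fun_span L"
    using linear_functionals_span[OF B] by auto
  define F where "F = hc d ` polys"
  have "\<exists>n (x :: nat \<Rightarrow> 'v) b. (\<forall>i<n. b i \<in> F) \<and>
    (\<forall>i<n. \<forall>k<n. b i (x k) = (if i = k then 1 else 0)) \<and>
    (\<forall>f\<in>F. \<forall>v. f v = (\<Sum>i<n. f (x i) * b i v))"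
  proof (rule interpolation_basis[OF finite_monomials[OF L(1)]])
    show "F \<subseteq> fun_span (monomials L d)"
      unfolding F_def using homogeneous_span_monomials[OF L(2)] by auto
    show "0 \<in> F" unfolding F_def using polys.zero_mem by (intro image_eqI[of _ _ 0]) auto
    show "f + h \<in> F" if "f \<in> F" "h \<in> F" for f h
      using that unfolding F_def by (auto simp flip: hcomp_add intro: polys.add_mem)
    show "(\<lambda>_. c) * f \<in> F" if "f \<in> F" for c f
      using that polys.mult_mem[OF polys.const_mem] unfolding F_def by (auto simp flip: hcomp_scale)
  qed
  then obtain n and x :: "nat \<Rightarrow> 'v" and b where b: "\<And>i. i < n \<Longrightarrow> b i \<in> F"
    "\<And>i k. i < n \<Longrightarrow> k < n \<Longrightarrow> b i (x k) = (if i = k then 1 else 0)"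
    "\<And>f v. f \<in> F \<Longrightarrow> f v = (\<Sum>i<n. f (x i) * b i v)"
    by blast
  have fF: "f \<in> F" unfolding F_def using f hcomp_homog[OF f(1), of d] homog_mem mem_polys
    by (intro image_eqI[of _ _ f]) auto
  have FD: "hc d h = h \<and> h \<in> polys" if "h \<in> F" for h
    using that by (auto simp: F_def hcomp_hcomp hcomp_mem)
  have actF: "(\<lambda>v. h (\<rho> g v)) \<in> F" if "h \<in> F" "g \<in> G" for h g
  proof -
    have "hc d (\<lambda>v. h (\<rho> g v)) = (\<lambda>v. h (\<rho> g v))"
    proof (subst hcomp_of_homogeneous[where d = d])
      show "h (\<rho> g (smul c v)) = c ^ d * h (\<rho> g v)" for c v
        using hcomp_homogeneous[of h d c "\<rho> g v"] FD[OF that(1)] act_scale[OF that(2)] by simp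
    qed (use FD that polys_act in auto)
    then show ?thesis unfolding F_def using FD that polys_act by (metis image_eqI)
  qed
  \<comment> \<open>\<open>y \<in> W\<close> stands for the functional \<open>ev y\<close> on \<open>F\<close>; \<open>\<sigma> g y\<close> stands for
    \<open>h \<mapsto> ev y (\<lambda>v. h (\<rho> g v))\<close>, see \<open>ev_act\<close>.\<close>
  define W :: "(nat \<Rightarrow> complex) set" where "W = {y. \<forall>i\<ge>n. y i = 0}"
  define \<sigma> :: "complex^'n^'n \<Rightarrow> (nat \<Rightarrow> complex) \<Rightarrow> (nat \<Rightarrow> complex)"
    where "\<sigma> g y = (\<lambda>i. if i < n then \<Sum>k<n. y k * b i (\<rho> g (x k)) else 0)" for g y
  define sc :: "complex \<Rightarrow> (nat \<Rightarrow> complex) \<Rightarrow> nat \<Rightarrow> complex" where "sc = (\<lambda>c y i. c * y i)"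
  define u :: "nat \<Rightarrow> nat \<Rightarrow> complex" where "u i = (\<lambda>k. if k = i then 1 else 0)" for i
  define ev where "ev y h = (\<Sum>i<n. y i * h (x i))" for y :: "nat \<Rightarrow> complex" and h :: "'v \<Rightarrow> complex"
  interpret W: vector_space sc
    by unfold_locales (auto simp: sc_def fun_eq_iff fun_apply algebra_simps)
  have W_eq: "y = (\<Sum>i<n. sc (y i) (u i))" if "y \<in> W" for y
  proof
    fix k
    have "(\<Sum>i<n. sc (y i) (u i) k) = (\<Sum>i<n. if i = k then y k else 0)"
      by (rule sum.cong) (auto simp: sc_def u_def)
    then show "y k = (\<Sum>i<n. sc (y i) (u i)) k"
      using that by (auto simp: sum_fun_apply W_def)
  qed
  have uW: "u i \<in> W" if "i < n" for i using that by (auto simp: u_def W_def)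
  have W_sub: "W.subspace W"
    unfolding W.subspace_def by (auto simp: W_def sc_def fun_apply)
  have W_span: "W = W.span (u ` {..<n})"
  proof
    show "W \<subseteq> W.span (u ` {..<n})"
    proof
      fix y assume "y \<in> W"
      then have "y = (\<Sum>i<n. sc (y i) (u i))" by (rule W_eq)
      also have "\<dots> \<in> W.span (u ` {..<n})" by (intro W.span_sum W.span_scale W.span_base) auto
      finally show "y \<in> W.span (u ` {..<n})" .
    qed
    show "W.span (u ` {..<n}) \<subseteq> W"
      by (rule W.span_minimal) (use uW W_sub in auto)
  qed
  have \<sigma>W: "\<sigma> g y \<in> W" for g y by (auto simp: \<sigma>_def W_def)
  have ev_act: "ev (\<sigma> g y) h = ev y (\<lambda>v. h (\<rho> g v))" if "h \<in> F" for g y h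
  proof -
    have "ev (\<sigma> g y) h = (\<Sum>i<n. \<Sum>k<n. y k * b i (\<rho> g (x k)) * h (x i))"
      by (simp add: ev_def \<sigma>_def sum_distrib_right)
    also have "\<dots> = (\<Sum>k<n. y k * (\<Sum>i<n. h (x i) * b i (\<rho> g (x k))))"
      by (subst sum.swap) (simp add: sum_distrib_left mult_ac)
    also have "\<dots> = ev y (\<lambda>v. h (\<rho> g v))" unfolding b(3)[OF that, symmetric] ev_def ..
    finally show ?thesis .
  qed
  have \<sigma>_ev: "\<sigma> g y i = (if i < n then ev y (\<lambda>v. b i (\<rho> g v)) else 0)" for g y i
    by (simp add: \<sigma>_def ev_def)
  have ev_b: "ev y (b i) = y i" if "i < n" for y i
  proof -
    have "ev y (b i) = (\<Sum>k<n. if k = i then y i else 0)"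
      unfolding ev_def by (rule sum.cong) (use b(2) that in auto)
    then show ?thesis using that by simp
  qed
  have W_eqI: "y = z" if "y \<in> W" "z \<in> W" "\<And>i. i < n \<Longrightarrow> y i = z i" for y z
    using that unfolding W_def by (intro ext) (metis (mono_tags, lifting) mem_Collect_eq not_le)
  have mod: "rational_module G sc W \<sigma>"
    unfolding rational_module_def
  proof (intro conjI ballI allI impI)
    show "vector_space sc" by unfold_locales
    show "\<exists>B. finite B \<and> W = W.span B" using W_span by (intro exI[of _ "u ` {..<n}"]) auto
    show "\<sigma> g (v + w) = \<sigma> g v + \<sigma> g w" for g v w
      by (auto simp: \<sigma>_def fun_eq_iff fun_apply algebra_simps sum.distrib)
    show "\<sigma> g (sc c v) = sc c (\<sigma> g v)" for g c v
      by (auto simp: \<sigma>_def sc_def fun_eq_iff sum_distrib_left mult.assoc)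
    show "\<sigma> (mat 1) v = v" if "v \<in> W" for v
      by (rule W_eqI[OF \<sigma>W that]) (simp add: \<sigma>_ev act_one ev_b)
    show "\<sigma> (g ** h) v = \<sigma> g (\<sigma> h v)" if "g \<in> G" "h \<in> G" "v \<in> W" for g h v
    proof (rule W_eqI[OF \<sigma>W \<sigma>W])
      fix i assume "i < n"
      then show "\<sigma> (g ** h) v i = \<sigma> g (\<sigma> h v) i"
        using ev_act[OF actF[OF b(1) that(1)], of i h v] that by (simp add: \<sigma>_ev act_mult)
    qed
    show "\<exists>r\<in>GL_regular. \<forall>g\<in>G. l (\<sigma> g v) = r g"
      if l: "Vector_Spaces.linear sc (*) l" for l v
    proof -
      interpret l: Vector_Spaces.linear sc "(*)" l by fact
      have "\<exists>r. i < n \<longrightarrow> r \<in> GL_regular \<and> (\<forall>g\<in>G. b i (\<rho> g (x k)) = r g)" for i k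
        using polys_act_regular[of "b i" "x k"] FD[OF b(1)] by metis
      then obtain r where r: "\<And>i k. i < n \<Longrightarrow> r i k \<in> GL_regular"
        "\<And>i k g. i < n \<Longrightarrow> g \<in> G \<Longrightarrow> b i (\<rho> g (x k)) = r i k g" by metis
      have eq: "l (\<sigma> g v) = (\<Sum>i<n. \<Sum>k<n. (\<lambda>_. v k * l (u i)) * r i k) g" if "g \<in> G" for g
      proof -
        have "l (\<sigma> g v) = (\<Sum>i<n. \<sigma> g v i * l (u i))"
          by (subst W_eq[OF \<sigma>W]) (simp add: l.sum l.scale)
        also have "\<dots> = (\<Sum>i<n. \<Sum>k<n. (\<lambda>_. v k * l (u i)) * r i k) g"
          by (auto simp: \<sigma>_def r(2) that sum_fun_apply fun_apply sum_distrib_right sum_distrib_left mult_ac intro!: sum.cong)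
        finally show ?thesis .
      qed
      show ?thesis
        by (rule bexI[where x = "\<Sum>i<n. \<Sum>k<n. (\<lambda>_. v k * l (u i)) * r i k"])
          (use eq r(1) in \<open>auto intro!: GL.sum_mem GL.mult_mem GL.const_mem\<close>)
    qed
  qed (rule \<sigma>W)
  then have cr: "completely_reducible G sc W \<sigma>"
    using reductive unfolding reductive_group_def sc_def by blast
  define U where "U = {y \<in> W. ev y f = 0}"
  have f_act: "(\<lambda>v. f (\<rho> g v)) = f" if "g \<in> G" for g
    using homog_mem[OF f(1)] that by (auto simp: invariants_def)
  have ev_add: "ev (y + z) h = ev y h + ev z h" and ev_sc: "ev (sc c y) h = c * ev y h" for y z c h
    by (auto simp: ev_def fun_apply sc_def sum.distrib sum_distrib_left algebra_simps)
  have sub: "submodule G sc W \<sigma> U"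
    unfolding submodule_def W.subspace_def
    using \<sigma>W W_sub ev_act[OF fF] f_act
    by (auto simp: U_def ev_add ev_sc W.subspace_def) (auto simp: ev_def fun_apply)
  obtain U' where U': "submodule G sc W \<sigma> U'" "U \<inter> U' = {0}" "W = {u + u' | u u'. u \<in> U \<and> u' \<in> U'}"
    using cr[unfolded completely_reducible_def, rule_format, OF sub] by (elim exE conjE) (rule that)
  have U'_sub: "W.subspace U'" "U' \<subseteq> W" "\<And>g y. g \<in> G \<Longrightarrow> y \<in> U' \<Longrightarrow> \<sigma> g y \<in> U'"
    using U'(1) unfolding submodule_def by auto
  have "\<exists>i<n. f (x i) \<noteq> 0"
  proof (rule ccontr)
    assume "\<not> (\<exists>i<n. f (x i) \<noteq> 0)"
    then have "f v = 0" for v by (subst b(3)[OF fF]) simp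
    then show False using f(2) by (auto simp: fun_eq_iff fun_apply)
  qed
  then obtain i where i: "i < n" "f (x i) \<noteq> 0" by blast
  have "ev (u i) f = (\<Sum>k<n. if k = i then f (x i) else 0)"
    unfolding ev_def by (rule sum.cong) (auto simp: u_def)
  then have "ev (u i) f \<noteq> 0" using i by simp
  moreover obtain y1 y2 where y12: "u i = y1 + y2" "y1 \<in> U" "y2 \<in> U'" using U'(3) uW[OF i(1)] by blast
  ultimately have y2: "ev y2 f \<noteq> 0" by (simp add: ev_add U_def)
  define y where "y = sc (inverse (ev y2 f)) y2"
  have y: "ev y f = 1" "y \<in> U'"
    using y2 y12 U'_sub(1) by (auto simp: y_def ev_sc W.subspace_def)
  have inv: "\<sigma> g y = y" if "g \<in> G" for g
  proof -
    have "\<sigma> g y - y \<in> U'" using W.subspace_diff[OF U'_sub(1)] U'_sub(3) y that by auto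
    moreover have "ev (\<sigma> g y - y) f = 0"
      using ev_act[OF fF, of g y] f_act[OF that] ev_add[of "\<sigma> g y - y" y f] by simp
    ultimately have "\<sigma> g y - y \<in> U \<inter> U'" using U'_sub by (auto simp: U_def)
    then show ?thesis using U'(2) by simp
  qed
  show ?thesis
  proof (rule exI[of _ n], rule exI[of _ x], rule exI[of _ y], intro conjI ballI)
    show "(\<Sum>k<n. y k * f (x k)) = 1" using y by (simp add: ev_def)
    show "(\<Sum>k<n. y k * hc d h (\<rho> g (x k))) = (\<Sum>k<n. y k * hc d h (x k))"
      if g: "g \<in> G" and h: "h \<in> polys" for g h
    proof -
      have "hc d h \<in> F" unfolding F_def using h by (rule imageI)
      from ev_act[OF this, of g y] show ?thesis unfolding inv[OF g] ev_def by (rule sym)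
    qed
  qed
qed

lemma line_poly_translate_coeff:
  assumes "f \<in> polys"
  shows "(\<lambda>v. coeff (line_poly smul f v w) j) \<in> polys"
  using assms
proof (induction arbitrary: j rule: polynomials_induct)
  case (const c)
  then show ?case by (simp add: line_poly_const polys.const_mem)
next
  case (linear l)
  then show ?case
    by (cases j; cases "j - 1") (auto simp: line_poly_linear linear_mem polys.const_mem)
next
  case (add f h)
  then have "(\<lambda>v. coeff (line_poly smul (f + h) v w) j) =
    (\<lambda>v. coeff (line_poly smul f v w) j) + (\<lambda>v. coeff (line_poly smul h v w) j)"
    by (simp add: line_poly_add fun_eq_iff fun_apply)
  then show ?case using polys.add_mem[OF add.IH] by simp
next
  case (mult f h)
  have "(\<lambda>v. coeff (line_poly smul (f * h) v w) j) =
    (\<Sum>i\<le>j. (\<lambda>v. coeff (line_poly smul f v w) i) * (\<lambda>v. coeff (line_poly smul h v w) (j - i)))"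
    using mult by (simp add: line_poly_mult coeff_mult fun_eq_iff sum_fun_apply fun_apply)
  then show ?case using mult.IH by (auto intro!: polys.sum_mem polys.mult_mem)
qed

lemma translate_mem: "f \<in> polys \<Longrightarrow> (\<lambda>w. f (v + w)) \<in> polys"
proof (induction rule: polynomials_induct)
  case (const c)
  then show ?case by (rule polys.const_mem)
next
  case (linear l)
  have "(\<lambda>w. l (v + w)) = (\<lambda>_. l v) + l"
    using linear_line[OF linear, of v 1] by (auto simp: fun_apply)
  then show ?case using linear linear_mem polys.add_mem polys.const_mem by simp
next
  case (add f h)
  then show ?case using polys.add_mem[OF add.IH] by (simp add: plus_fun_def)
next
  case (mult f h)
  then show ?case using polys.mult_mem[OF mult.IH] by (simp add: times_fun_def)
qed

lemma coeff_line_poly_translate: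
  "f \<in> polys \<Longrightarrow> coeff (line_poly smul f v w) j = hc j (\<lambda>u. f (v + u)) w"
proof -
  assume "f \<in> polys"
  then have "line_poly smul (\<lambda>u. f (v + u)) 0 w = line_poly smul f v w"
    by (intro line_poly_eqI) (simp add: poly_line_poly)
  then show ?thesis by (simp add: hcomp_def)
qed

text \<open>The operator with constant coefficients that corresponds to the functional
  \<open>h \<mapsto> \<Sum>k<n. y k * h (x k)\<close> on homogeneous polynomials of degree \<open>j\<close>: it is applied to the part
  of degree \<open>j\<close> of the Taylor expansion at \<open>v\<close>.\<close>

definition taylor_op :: "nat \<Rightarrow> nat \<Rightarrow> (nat \<Rightarrow> 'v) \<Rightarrow> (nat \<Rightarrow> complex) \<Rightarrow> ('v \<Rightarrow> complex) \<Rightarrow> 'v \<Rightarrow> complex" where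
  "taylor_op j n x y f v = (\<Sum>k<n. y k * coeff (line_poly smul f v (x k)) j)"

lemma taylor_op_mem: "f \<in> polys \<Longrightarrow> taylor_op j n x y f \<in> polys"
proof -
  assume "f \<in> polys"
  then have "(\<Sum>k<n. (\<lambda>_. y k) * (\<lambda>v. coeff (line_poly smul f v (x k)) j)) \<in> polys"
    by (intro polys.sum_mem polys.mult_mem polys.const_mem line_poly_translate_coeff)
  also have "(\<Sum>k<n. (\<lambda>_. y k) * (\<lambda>v. coeff (line_poly smul f v (x k)) j)) = taylor_op j n x y f"
    by (auto simp: fun_eq_iff fun_apply sum_fun_apply taylor_op_def)
  finally show ?thesis .
qed

lemma linear_operator_taylor_op: "linear_operator polys (taylor_op j n x y)"
  unfolding linear_operator_def
  by (auto simp: taylor_op_mem taylor_op_def fun_eq_iff fun_apply line_poly_add line_poly_mult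
      line_poly_const polys.const_mem sum.distrib sum_distrib_left algebra_simps)

text \<open>Along a line through \<open>v\<close>, a commutator replaces the factor \<open>a\<close> by \<open>a - a v\<close>, which is
  divisible by the parameter of the line.\<close>

lemma iterated_commutator_taylor_op:
  assumes "set as \<subseteq> polys" "f \<in> polys"
  shows "iterated_commutator (taylor_op j n x y) as f v =
    (\<Sum>k<n. y k * coeff ((\<Prod>a\<leftarrow>as. line_poly smul a v (x k) - [:a v:]) * line_poly smul f v (x k)) j)"
  using assms
proof (induction as arbitrary: f)
  case Nil
  then show ?case by (simp add: taylor_op_def)
next
  case (Cons a as)
  then have "a \<in> polys" by simp
  then show ?case
    using Cons unfolding iterated_commutator_Cons
    by (simp add: fun_apply polys.mult_mem line_poly_mult sum_distrib_left algebra_simps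
        flip: sum_subtractf)
qed

lemma has_order_taylor_op: "has_order_at_most j polys (taylor_op j n x y)"
proof (rule polys.has_order_at_mostI[OF order_refl])
  show "\<exists>(n::nat) F. (\<forall>i<n. F i \<in> polys) \<and> f = (\<Sum>i<n. F i)" if "f \<in> polys" for f
    by (rule exI[of _ 1], rule exI[of _ "\<lambda>_. f"]) (use that in simp)
  show "iterated_commutator (taylor_op j n x y) as f = 0"
    if as: "length as = Suc j" "set as \<subseteq> polys" "f \<in> polys" for as f
  proof
    fix v
    have "coeff ((\<Prod>a\<leftarrow>as. line_poly smul a v w - [:a v:]) * line_poly smul f v w) j = 0" for w
    proof -
      have dvd: "[:0, 1:] dvd line_poly smul a v w - [:a v:]" if "a \<in> polys" for a
        using coeff_0_line_poly[OF that, of v w] poly_eq_0_iff_dvd[of "line_poly smul a v w - [:a v:]" 0]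
        by (simp add: poly_0_coeff_0)
      then have "[:0, 1:] ^ length as dvd (\<Prod>a\<leftarrow>as. line_poly smul a v w - [:a v:])"
        using as(2)
      proof (induction as)
        case (Cons a as)
        then show ?case
          using mult_dvd_mono[OF dvd[of a], of "[:0, 1:] ^ length as"]
          by (simp only: length_Cons power_Suc list.map prod_list.Cons set_simps insert_subset)
      qed simp
      then have "monom 1 (Suc j) dvd (\<Prod>a\<leftarrow>as. line_poly smul a v w - [:a v:]) * line_poly smul f v w"
        using as(1) by (simp add: monom_altdef)
      then show ?thesis by (simp add: monom_1_dvd_iff')
    qed
    then show "iterated_commutator (taylor_op j n x y) as f v = 0 v"
      by (simp add: iterated_commutator_taylor_op[OF as(2,3)] fun_apply)
  qed
qed (rule linear_operator_taylor_op)

lemma taylor_op_at_0: "taylor_op j n x y f 0 = (\<Sum>k<n. y k * hc j f (x k))"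
  by (simp add: taylor_op_def hcomp_def)

text \<open>As \<open>g\<close> acts linearly, it maps the Taylor expansion at \<open>v\<close> to the one at \<open>\<rho> g v\<close>, and the
  functional does not notice its action on the directions.\<close>

lemma taylor_op_invariant:
  assumes inv: "\<And>g h. g \<in> G \<Longrightarrow> h \<in> polys \<Longrightarrow>
      (\<Sum>k<n. y k * hc j h (\<rho> g (x k))) = (\<Sum>k<n. y k * hc j h (x k))"
    and g: "g \<in> G" and f: "f \<in> polys"
  shows "taylor_op j n x y (\<lambda>v. f (\<rho> g v)) v = taylor_op j n x y f (\<rho> g v)"
proof -
  have "line_poly smul (\<lambda>v. f (\<rho> g v)) v w = line_poly smul f (\<rho> g v) (\<rho> g w)" for w
    by (rule line_poly_eqI) (simp add: poly_line_poly f act_add act_scale g)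
  then show ?thesis
    using inv[OF g translate_mem[OF f]] by (simp add: taylor_op_def coeff_line_poly_translate f)
qed

text \<open>The operator with constant coefficients that belongs to an invariant functional with value \<open>1\<close>
  at \<open>f\<close>. At the origin it sees only the component of degree \<open>j\<close>, to which it applies this
  functional \<open>\<mu>\<close>.\<close>

lemma invariant_op_detects:
  assumes f: "f \<in> homog j" "f \<noteq> 0"
  obtains P \<mu> where "P \<in> invariant_diff_ops j G smul \<rho>"
    and "\<And>h. h \<in> polys \<Longrightarrow> P h 0 = \<mu> (hc j h)" and "\<mu> f = 1"
proof -
  obtain n :: nat and x :: "nat \<Rightarrow> 'v" and y :: "nat \<Rightarrow> complex"
  where 1: "(\<Sum>k<n. y k * f (x k)) = 1"
    and inv: "\<forall>g\<in>G. \<forall>h\<in>polys.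
      (\<Sum>k<n. y k * hc j h (\<rho> g (x k))) = (\<Sum>k<n. y k * hc j h (x k))"
    using invariant_functional[OF f] by (elim exE conjE) (rule that)
  define P where "P = restrict (taylor_op j n x y) polys"
  have "has_order_at_most j polys P"
    by (rule polys.has_order_at_most_cong[OF has_order_taylor_op]) (simp add: P_def)
  moreover have "P (\<lambda>v. h (\<rho> g v)) = (\<lambda>v. P h (\<rho> g v))" if "g \<in> G" "h \<in> polys" for g h
    using taylor_op_invariant[OF inv[rule_format] that] polys_act[OF that] that(2) by (auto simp: P_def)
  ultimately have "P \<in> invariant_diff_ops j G smul \<rho>"
    by (simp add: invariant_diff_ops_def diff_ops_def P_def group_inv)
  then show thesis
    by (rule that[of P "\<lambda>h. \<Sum>k<n. y k * h (x k)"]) (use 1 in \<open>auto simp: P_def taylor_op_at_0\<close>)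
qed

end

section \<open>Formal automorphisms respect the filtration by degree\<close>

context graded_algebra
begin

text \<open>The formal series with homogeneous components \<open>F i\<close> agrees with \<open>q\<close> modulo the \<open>N\<close>-th ideal power,
  component by component. Congruence modulo an ideal power is finer than agreement up to a degree, and
  it is respected by differential operators up to their order, whatever they do to degrees.\<close>

definition approximates :: "nat \<Rightarrow> (nat \<Rightarrow> 'v \<Rightarrow> complex) \<Rightarrow> ('v \<Rightarrow> complex) \<Rightarrow> bool" where
  "approximates N F q \<longleftrightarrow> q \<in> A \<and> (\<forall>i. max_ideal_power A 0 N (F i - hc i q))"

lemma approximates_antimono: "M \<le> N \<Longrightarrow> approximates N F q \<Longrightarrow> approximates M F q"
  unfolding approximates_def using max_ideal_power_antimono by blast

lemma approximates_unique:
  assumes "approximates N F q" "approximates N F q'"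
  shows "max_ideal_power A 0 N (q - q')"
proof -
  have A: "q \<in> A" "q' \<in> A" using assms by (auto simp: approximates_def)
  have "max_ideal_power A 0 N (hc d (q - q'))" for d
    using max_ideal_power_diff[of 0 N "F d - hc d q'" "F d - hc d q"] assms A
    by (simp add: approximates_def hcomp_diff mem_polys)
  moreover obtain D where "\<forall>d>D. hc d (q - q') = 0"
    using hcomp_eventually_0[of "q - q'"] A diff_mem mem_polys by blast
  ultimately show ?thesis
    using max_ideal_power_sum[of "{..D}" 0 N "\<lambda>d. hc d (q - q')"] A diff_mem mem_polys
    by (simp add: sum_hcomp)
qed

lemma approximates_hcomp:
  assumes "approximates N F q" "F k \<in> homog k" "k < N"
  shows "hc k q = F k"
proof -
  have q: "q \<in> A" "max_ideal_power A 0 N (F k - hc k q)"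
    using assms by (auto simp: approximates_def)
  have "F k \<in> A" "hc k q \<in> A" using assms(2) q hcomp_closed homog_mem by auto
  then have "hc k (F k - hc k q) = F k - hc k q"
    using assms q by (simp add: hcomp_diff mem_polys hcomp_hcomp hcomp_homog)
  then show ?thesis using hcomp_max_ideal_power[OF q(2) assms(3)] by simp
qed

lemma approximates_mult:
  assumes "approximates N F q" "approximates N F' q'"
    and "\<And>i. F i \<in> A" "\<And>k. F'' k = (\<Sum>i\<le>k. F i * F' (k - i))"
  shows "approximates N F'' (q * q')"
proof -
  have q: "q \<in> A" "q' \<in> A" "\<And>i. max_ideal_power A 0 N (F i - hc i q)" "\<And>i. max_ideal_power A 0 N (F' i - hc i q')"
    using assms(1,2) by (auto simp: approximates_def)
  have "max_ideal_power A 0 N (F'' k - hc k (q * q'))" for k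
  proof -
    have "F'' k - hc k (q * q') =
        (\<Sum>i\<le>k. F i * (F' (k - i) - hc (k - i) q') + hc (k - i) q' * (F i - hc i q))"
      using q by (simp add: assms(4) hcomp_mult mem_polys algebra_simps flip: sum_subtractf)
    moreover have "max_ideal_power A 0 N
        (F i * (F' (k - i) - hc (k - i) q') + hc (k - i) q' * (F i - hc i q))" for i
      using q assms(3) hcomp_closed by (intro max_ideal_power.add max_ideal_power_mult) auto
    ultimately show ?thesis by (simp add: max_ideal_power_sum)
  qed
  then show ?thesis using q mult_mem by (simp add: approximates_def)
qed

end

text \<open>Algebra homomorphisms from \<open>A\<close> to its completion with respect to the grading, which preserve
  the value at the origin. The component of degree \<open>k\<close> of the image of \<open>f\<close> is \<open>T f k\<close>.\<close>

locale jet_map = graded_algebra smul A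
  for smul :: "complex \<Rightarrow> 'v::ab_group_add \<Rightarrow> 'v" and A +
  fixes T :: "('v \<Rightarrow> complex) \<Rightarrow> nat \<Rightarrow> 'v \<Rightarrow> complex"
  assumes jet_homog: "f \<in> A \<Longrightarrow> T f k \<in> homog k"
    and jet_add: "f \<in> A \<Longrightarrow> h \<in> A \<Longrightarrow> T (f + h) k = T f k + T h k"
    and jet_mult: "f \<in> A \<Longrightarrow> h \<in> A \<Longrightarrow> T (f * h) k = (\<Sum>i\<le>k. T f i * T h (k - i))"
    and jet_const: "T (\<lambda>_. c) k = (if k = 0 then (\<lambda>_. c) else 0)"
    and jet_0: "f \<in> A \<Longrightarrow> T f 0 = (\<lambda>_. f 0)"
begin

lemma jet_mem: "f \<in> A \<Longrightarrow> T f k \<in> A"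
  using jet_homog homog_mem by blast

lemma jet_zero: "T 0 k = 0"
  using jet_const[of 0 k] by (auto simp: zero_fun_def split: if_splits)

lemma jet_sum: "(\<And>i. i \<in> I \<Longrightarrow> f i \<in> A) \<Longrightarrow> T (\<Sum>i\<in>I. f i) k = (\<Sum>i\<in>I. T (f i) k)"
  by (induction I rule: infinite_finite_induct) (auto simp: jet_zero jet_add sum_mem)

lemma jet_scale: "f \<in> A \<Longrightarrow> T ((\<lambda>_. c) * f) k = (\<lambda>_. c) * T f k"
proof -
  assume f: "f \<in> A"
  have "(\<Sum>i\<le>k. T (\<lambda>_. c) i * T f (k - i)) = (\<Sum>i\<le>k. if i = 0 then (\<lambda>_. c) * T f k else 0)"
    by (rule sum.cong) (auto simp: jet_const)
  then show ?thesis using f by (simp add: jet_mult const_mem)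
qed

lemma jet_diff: "f \<in> A \<Longrightarrow> h \<in> A \<Longrightarrow> T (f - h) k = T f k - T h k"
  using jet_add[of "f - h" h k] diff_mem[of f h] by simp

lemma jet_max_ideal_power: "max_ideal_power A 0 n f \<Longrightarrow> k < n \<Longrightarrow> T f k = 0"
proof (induction arbitrary: k rule: max_ideal_power.induct)
  case (mult a n f)
  have "T a i * T f (k - i) = 0" if "i \<le> k" for i
    using mult that jet_0[of a] by (cases "i = 0") (auto simp: fun_eq_iff fun_apply)
  then show ?case using mult max_ideal_power_mem by (auto simp: jet_mult)
next
  case (add n f h)
  then show ?case using max_ideal_power_mem by (auto simp: jet_add)
qed simp

end

text \<open>\<open>S\<close> is inverse to the continuous extension of \<open>T\<close> to the completion. Instead of extending the
  maps, the images under \<open>T\<close> are approximated in the topology given by the ideal powers.\<close>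

locale inverse_jet_maps = T: jet_map smul A T + S: jet_map smul A S
  for smul :: "complex \<Rightarrow> 'v::ab_group_add \<Rightarrow> 'v" and A T S +
  assumes inverse: "f \<in> A \<Longrightarrow> \<exists>q. T.approximates N (T f) q \<and> (\<forall>k<N. S q k = hcomp smul k f)"
begin

lemma obtain_approximation:
  assumes "h \<in> A"
  obtains q where "q \<in> A" "T.approximates N (T h) q" "\<And>k. k < N \<Longrightarrow> S q k = hcomp smul k h"
  using inverse[OF assms, of N] that by (auto simp: T.approximates_def)

text \<open>The conjugate of \<open>P\<close> by the pair, to be read as \<open>S \<circ> P \<circ> T\<close>. An operator of order at most \<open>j\<close>
  loses at most \<open>j\<close> ideal powers, so the component of degree \<open>n\<close> of the result is determined by an
  approximation of order \<open>n + j + 1\<close>.\<close>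

definition conjugate_op :: "nat \<Rightarrow> (('v \<Rightarrow> complex) \<Rightarrow> 'v \<Rightarrow> complex) \<Rightarrow> ('v \<Rightarrow> complex) \<Rightarrow> nat \<Rightarrow> 'v \<Rightarrow> complex" where
  "conjugate_op j P h n = S (P (SOME q. T.approximates (n + j + 1) (T h) q)) n"

context
  fixes j P
  assumes P: "has_order_at_most j A P"
begin

lemma P_linear: "linear_operator A P"
  using P by (rule T.has_order_linear)

lemma P_mem: "f \<in> A \<Longrightarrow> P f \<in> A"
  using P_linear by (auto simp: linear_operator_def)

lemma P_add: "f \<in> A \<Longrightarrow> h \<in> A \<Longrightarrow> P (f + h) = P f + P h"
  using P_linear by (auto simp: linear_operator_def)

lemma P_scale: "f \<in> A \<Longrightarrow> P ((\<lambda>_. c) * f) = (\<lambda>_. c) * P f"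
  using P_linear by (auto simp: linear_operator_def)

lemma conjugate_op_eq:
  assumes "T.approximates N (T h) q" "n + j < N"
  shows "conjugate_op j P h n = S (P q) n"
proof -
  define q0 where "q0 = (SOME q. T.approximates (n + j + 1) (T h) q)"
  have a: "T.approximates (n + j + 1) (T h) q"
    using assms T.approximates_antimono[of "n + j + 1" N] by simp
  have q0: "T.approximates (n + j + 1) (T h) q0"
    unfolding q0_def by (rule someI[of "T.approximates (n + j + 1) (T h)", OF a])
  have A: "q \<in> A" "q0 \<in> A" "q0 - q \<in> A"
    using a q0 T.diff_mem by (auto simp: T.approximates_def)
  have "max_ideal_power A 0 (Suc n + j) (q0 - q)"
    using T.approximates_unique[OF q0 a] by simp
  then have "max_ideal_power A 0 (Suc n) (P (q0 - q))"
    by (rule T.has_order_max_ideal_power[OF P])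
  then have "S (P (q0 - q)) n = 0" by (rule S.jet_max_ideal_power) simp
  moreover have "P q0 = P (q0 - q) + P q" using P_add[OF A(3,1)] by simp
  ultimately show ?thesis
    using S.jet_add[of "P (q0 - q)" "P q" n] A P_mem by (simp add: conjugate_op_def q0_def[symmetric, simplified])
qed

lemma conjugate_op_homog: "h \<in> A \<Longrightarrow> conjugate_op j P h n \<in> T.homog n"
  using conjugate_op_eq[of "n + j + 1" h] P_mem S.jet_homog
  by (metis add.right_neutral add_Suc_right lessI One_nat_def obtain_approximation)

lemma conjugate_op_mem: "h \<in> A \<Longrightarrow> conjugate_op j P h n \<in> A"
  using conjugate_op_homog T.homog_mem by blast

lemma conjugate_op_add:
  assumes "f \<in> A" "h \<in> A"
  shows "conjugate_op j P (f + h) n = conjugate_op j P f n + conjugate_op j P h n"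
proof -
  obtain p where p: "p \<in> A" "T.approximates (n + j + 1) (T f) p" using obtain_approximation assms(1) by blast
  obtain q where q: "q \<in> A" "T.approximates (n + j + 1) (T h) q" using obtain_approximation assms(2) by blast
  have "max_ideal_power A 0 (n + j + 1) (T (f + h) i - hcomp smul i (p + q))" for i
    using max_ideal_power.add[of A 0 "n + j + 1" "T f i - hcomp smul i p" "T h i - hcomp smul i q"] p q assms
    by (simp add: T.approximates_def T.jet_add T.hcomp_add T.mem_polys algebra_simps)
  then have "T.approximates (n + j + 1) (T (f + h)) (p + q)"
    using p q T.add_mem by (simp add: T.approximates_def)
  then show ?thesis
    using p q by (simp add: conjugate_op_eq P_add S.jet_add P_mem)
qed

lemma conjugate_op_scale:
  assumes "f \<in> A"
  shows "conjugate_op j P ((\<lambda>_. c) * f) n = (\<lambda>_. c) * conjugate_op j P f n"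
proof -
  obtain p where p: "p \<in> A" "T.approximates (n + j + 1) (T f) p" using obtain_approximation assms(1) by blast
  have "max_ideal_power A 0 (n + j + 1) (T ((\<lambda>_. c) * f) i - hcomp smul i ((\<lambda>_. c) * p))" for i
    using T.max_ideal_power_mult[of 0 "n + j + 1" "T f i - hcomp smul i p" "\<lambda>_. c"] p assms T.const_mem
    by (simp add: T.approximates_def T.jet_scale T.hcomp_scale T.mem_polys right_diff_distrib)
  then have "T.approximates (n + j + 1) (T ((\<lambda>_. c) * f)) ((\<lambda>_. c) * p)"
    using p T.mult_mem T.const_mem by (simp add: T.approximates_def)
  then show ?thesis
    using p by (simp add: conjugate_op_eq P_scale S.jet_scale P_mem)
qed

lemma conjugate_op_zero: "conjugate_op j P 0 n = 0"
  using conjugate_op_add[OF T.zero_mem T.zero_mem, of n] by simp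

text \<open>The part of the conjugate that lowers degrees by \<open>d\<close>. Unlike the conjugate itself, it maps
  \<open>A\<close> to \<open>A\<close>.\<close>

definition conjugate_part :: "nat \<Rightarrow> ('v \<Rightarrow> complex) \<Rightarrow> 'v \<Rightarrow> complex" where
  "conjugate_part d h = (\<Sum>e \<in> {d..LEAST D. \<forall>e>D. hcomp smul e h = 0}. conjugate_op j P (hcomp smul e h) (e - d))"

lemma conjugate_part_eq:
  assumes "\<And>e. e > D \<Longrightarrow> hcomp smul e h = 0"
  shows "conjugate_part d h = (\<Sum>e = d..D. conjugate_op j P (hcomp smul e h) (e - d))"
proof -
  let ?P = "\<lambda>D. \<forall>e>D. hcomp smul e h = 0"
  have D: "?P D" using assms by simp
  define D0 where "D0 = (LEAST D. ?P D)"
  have zero: "conjugate_op j P (hcomp smul e h) (e - d) = 0" if "e > D0" for e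
    using LeastI[of ?P, OF D] that conjugate_op_zero unfolding D0_def[symmetric] by simp
  have "D0 \<le> D" unfolding D0_def using D by (rule Least_le)
  then show ?thesis
    unfolding conjugate_part_def D0_def[symmetric]
    by (intro sum.mono_neutral_left) (use zero in \<open>auto simp: not_le\<close>)
qed

lemma conjugate_part_homog:
  assumes "h \<in> T.homog e"
  shows "conjugate_part d h = (if d \<le> e then conjugate_op j P h (e - d) else 0)"
proof -
  have "conjugate_part d h = (\<Sum>i = d..e. conjugate_op j P (hcomp smul i h) (i - d))"
    by (rule conjugate_part_eq) (simp add: T.hcomp_homog[OF assms])
  also have "\<dots> = (\<Sum>i = d..e. if i = e then conjugate_op j P h (e - d) else 0)"
    by (rule sum.cong) (auto simp: T.hcomp_homog[OF assms] conjugate_op_zero)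
  finally show ?thesis by simp
qed

lemma linear_operator_conjugate_part: "linear_operator A (conjugate_part d)"
  unfolding linear_operator_def
proof (intro conjI ballI allI Pi_I)
  fix f assume f: "f \<in> A"
  obtain D where D: "\<And>e. e > D \<Longrightarrow> hcomp smul e f = 0"
    using T.hcomp_eventually_0 T.mem_polys f by metis
  show "conjugate_part d f \<in> A"
    using f by (auto simp: conjugate_part_eq[OF D] intro!: T.sum_mem conjugate_op_mem T.hcomp_closed)
  show "conjugate_part d ((\<lambda>_. c) * f) = (\<lambda>_. c) * conjugate_part d f" for c
  proof -
    have "hcomp smul e ((\<lambda>_. c) * f) = 0" if "e > D" for e
      using D[OF that] f by (simp add: T.hcomp_scale T.mem_polys)
    then show ?thesis
      using f by (simp add: conjugate_part_eq[OF D] conjugate_part_eq[of D "(\<lambda>_. c) * f"] T.hcomp_scale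
          T.mem_polys conjugate_op_scale T.hcomp_closed sum_distrib_left)
  qed
  fix h assume h: "h \<in> A"
  obtain E where E: "\<And>e. e > E \<Longrightarrow> hcomp smul e h = 0"
    using T.hcomp_eventually_0 T.mem_polys h by metis
  have "\<And>e. e > max D E \<Longrightarrow> hcomp smul e f = 0" "\<And>e. e > max D E \<Longrightarrow> hcomp smul e h = 0"
    using D E by auto
  moreover from this have "\<And>e. e > max D E \<Longrightarrow> hcomp smul e (f + h) = 0"
    using f h by (simp add: T.hcomp_add T.mem_polys)
  ultimately show "conjugate_part d (f + h) = conjugate_part d f + conjugate_part d h"
    using f h
    by (simp add: conjugate_part_eq[of "max D E"] T.hcomp_add T.mem_polys conjugate_op_add
        T.hcomp_closed sum.distrib del: max_less_iff_conj)
qed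

text \<open>Conjugation commutes with commutators: replace the functions \<open>a\<close> by approximations \<open>q a\<close> of
  their images, whose images under \<open>S\<close> agree with \<open>a\<close> in the relevant degrees.\<close>

lemma iterated_commutator_conjugate_part:
  fixes q :: "('v \<Rightarrow> complex) \<Rightarrow> ('v \<Rightarrow> complex)" and deg :: "('v \<Rightarrow> complex) \<Rightarrow> nat"
  assumes q: "\<And>a. a \<in> set as \<Longrightarrow> T.approximates N (T a) (q a)"
      "\<And>a k. a \<in> set as \<Longrightarrow> k < N \<Longrightarrow> S (q a) k = hcomp smul k a"
    and deg: "\<And>a. a \<in> set as \<Longrightarrow> a \<in> T.homog (deg a)"
    and h: "h \<in> T.homog e" "T.approximates N (T h) p" "e + sum_list (map deg as) + j < N"
  shows "iterated_commutator (conjugate_part d) as h =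
    (if d \<le> e + sum_list (map deg as)
     then S (iterated_commutator P (map q as) p) (e + sum_list (map deg as) - d) else 0)"
  using assms
proof (induction as arbitrary: h e p)
  case Nil
  then show ?case by (simp add: conjugate_part_homog conjugate_op_eq)
next
  case (Cons a as)
  let ?D = "sum_list (map deg as)" and ?C = "iterated_commutator P (map q as)"
  have a: "a \<in> T.homog (deg a)" "T.approximates N (T a) (q a)" "\<And>k. k < N \<Longrightarrow> S (q a) k = hcomp smul k a"
    using Cons.prems by auto
  have mem: "a \<in> A" "h \<in> A" "q a \<in> A" "p \<in> A"
    using a(2) Cons.prems(5) T.homog_mem[OF a(1)] T.homog_mem[OF Cons.prems(4)]
    by (auto simp: T.approximates_def)
  have "linear_operator A ?C"
    using Cons.prems by (intro T.iterated_commutator_linear P_linear) (auto simp: T.approximates_def)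
  then have C: "?C f \<in> A" if "f \<in> A" for f using that by (auto simp: linear_operator_def)
  have "T.approximates N (T (a * h)) (q a * p)"
    by (rule T.approximates_mult[OF a(2) Cons.prems(5)]) (use mem T.jet_mem T.jet_mult in auto)
  then have 1: "iterated_commutator (conjugate_part d) as (a * h) =
    (if d \<le> deg a + e + ?D then S (?C (q a * p)) (deg a + e + ?D - d) else 0)"
    by (intro Cons.IH) (use Cons.prems a T.homog_mult in auto)
  have 2: "iterated_commutator (conjugate_part d) as h = (if d \<le> e + ?D then S (?C p) (e + ?D - d) else 0)"
    by (rule Cons.IH) (use Cons.prems in auto)
  have 3: "S (q a * ?C p) (deg a + e + ?D - d) = (if d \<le> e + ?D then a * S (?C p) (e + ?D - d) else 0)"
    if d: "d \<le> deg a + e + ?D"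
  proof -
    let ?n = "deg a + e + ?D - d"
    have "S (q a * ?C p) ?n = (\<Sum>i\<le>?n. S (q a) i * S (?C p) (?n - i))"
      using mem C by (intro S.jet_mult) auto
    also have "\<dots> = (\<Sum>i\<le>?n. if i = deg a then a * S (?C p) (?n - deg a) else 0)"
      by (rule sum.cong) (use Cons.prems(6) a(3) in \<open>auto simp: T.hcomp_homog[OF a(1)]\<close>)
    also have "\<dots> = (if d \<le> e + ?D then a * S (?C p) (e + ?D - d) else 0)"
      using d by auto
    finally show ?thesis .
  qed
  have 4: "S (?C (q a * p) - q a * ?C p) k = S (?C (q a * p)) k - S (q a * ?C p) k" for k
    using mem C T.mult_mem by (intro S.jet_diff) auto
  show ?case
    unfolding list.map iterated_commutator_Cons[of P] iterated_commutator_Cons[of "conjugate_part d"] 1 2 4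
    using 3 by (auto simp: algebra_simps)
qed

lemma has_order_conjugate_part: "has_order_at_most j A (conjugate_part d)"
proof (rule T.has_order_at_mostI[where H = "\<Union>e. T.homog e"])
  show "\<exists>(n::nat) F. (\<forall>i<n. F i \<in> (\<Union>e. T.homog e)) \<and> f = (\<Sum>i<n. F i)"
    if f: "f \<in> A" for f
  proof -
    obtain D where D: "\<And>e. e > D \<Longrightarrow> hcomp smul e f = 0"
      using T.hcomp_eventually_0[OF T.mem_polys[OF f]] by blast
    then have "f = (\<Sum>i<Suc D. hcomp smul i f)"
      using T.sum_hcomp[OF T.mem_polys[OF f] D] by (simp add: lessThan_Suc_atMost)
    with T.hcomp_mem_homog[OF f] show ?thesis
      by (intro exI[of _ "Suc D"] exI[of _ "\<lambda>i. hcomp smul i f"]) blast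
  qed
  show "iterated_commutator (conjugate_part d) as h = 0"
    if as: "length as = Suc j" "set as \<subseteq> (\<Union>e. T.homog e)" "h \<in> (\<Union>e. T.homog e)" for as h
  proof -
    have "\<forall>a. \<exists>e. a \<in> (\<Union>e. T.homog e) \<longrightarrow> a \<in> T.homog e" by blast
    then obtain deg where deg: "\<And>a. a \<in> (\<Union>e. T.homog e) \<Longrightarrow> a \<in> T.homog (deg a)" by metis
    define N where "N = deg h + sum_list (map deg as) + j + 1"
    have "\<forall>a. \<exists>q. a \<in> A \<longrightarrow> T.approximates N (T a) q \<and> (\<forall>k<N. S q k = hcomp smul k a)"
      using inverse by blast
    then obtain q where q: "\<And>a. a \<in> A \<Longrightarrow> T.approximates N (T a) (q a) \<and> (\<forall>k<N. S (q a) k = hcomp smul k a)"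
      by metis
    have A: "a \<in> A" if "a \<in> set as" for a using as(2) that T.homog_mem by blast
    have deg_as: "a \<in> T.homog (deg a)" if "a \<in> set as" for a using deg as(2) that by blast
    have h: "h \<in> A" using as(3) T.homog_mem by blast
    have "iterated_commutator P (map q as) (q h) = 0"
      by (rule T.iterated_commutator_eq_0[OF P]) (use q A h as in \<open>auto simp: T.approximates_def\<close>)
    moreover have "iterated_commutator (conjugate_part d) as h =
      (if d \<le> deg h + sum_list (map deg as)
       then S (iterated_commutator P (map q as) (q h)) (deg h + sum_list (map deg as) - d) else 0)"
      by (rule iterated_commutator_conjugate_part[where N = N])
        (use q A h deg_as deg[OF as(3)] in \<open>auto simp: N_def\<close>)
    ultimately show ?thesis by (simp add: S.jet_zero)
  qed
qed (auto simp: T.homog_def linear_operator_conjugate_part)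

end

text \<open>If the component \<open>T f k\<close> were not zero, an operator of order at most \<open>k\<close> would detect it at the
  origin. The conjugate of this operator has order at most \<open>k\<close> and does not kill \<open>f\<close> at the origin,
  although \<open>f\<close> has degree \<open>d > k\<close>.\<close>

lemma jet_low_degree_vanishes:
  assumes detect: "\<And>k g. g \<in> T.homog k \<Longrightarrow> g \<noteq> 0 \<Longrightarrow>
      \<exists>P \<mu>. has_order_at_most k A P \<and> (\<forall>h\<in>A. P h 0 = \<mu> (hcomp smul k h)) \<and> \<mu> g = (1::complex)"
    and kill: "\<And>k P d f. has_order_at_most k A P \<Longrightarrow> f \<in> T.homog d \<Longrightarrow> k < d \<Longrightarrow> P f 0 = 0"
    and f: "f \<in> T.homog d" "k < d"
  shows "T f k = 0"
proof (rule ccontr)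
  assume "T f k \<noteq> 0"
  have fA: "f \<in> A" using f T.homog_mem by blast
  obtain P \<mu> where P: "has_order_at_most k A P" "\<And>h. h \<in> A \<Longrightarrow> P h 0 = \<mu> (hcomp smul k h)" "\<mu> (T f k) = 1"
    using detect[OF T.jet_homog[OF fA] \<open>T f k \<noteq> 0\<close>] by blast
  obtain q where q: "q \<in> A" "T.approximates (k + 1) (T f) q" using obtain_approximation[OF fA] by blast
  have "conjugate_part k P d f = conjugate_op k P f 0"
    using conjugate_part_homog[OF P(1) f(1)] by simp
  also have "\<dots> = S (P q) 0" using conjugate_op_eq[OF P(1) q(2)] by simp
  also have "\<dots> = (\<lambda>_. P q 0)" using S.jet_0 P_mem[OF P(1)] q by simp
  also have "\<dots> = (\<lambda>_. 1)"
    using P(2)[OF q(1)] P(3) T.approximates_hcomp[OF q(2) T.jet_homog[OF fA]] by simp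
  finally have "conjugate_part k P d f 0 = 1" by (rule fun_cong)
  with kill[OF has_order_conjugate_part[OF P(1)] f] show False by simp
qed

text \<open>Let \<open>q\<close> approximate the image of \<open>f\<close> to order \<open>d + 1\<close>, so that \<open>f\<close> is the component of degree \<open>d\<close>
  of \<open>S q\<close>. The components of \<open>q\<close> below degree \<open>d\<close> vanish and those above degree \<open>d\<close> contribute only
  to higher degrees, so only \<open>S (T f d)\<close> remains.\<close>

lemma leading_jet_inverse:
  assumes low_T: "\<And>f d k. f \<in> T.homog d \<Longrightarrow> k < d \<Longrightarrow> T f k = 0"
    and low_S: "\<And>f d k. f \<in> T.homog d \<Longrightarrow> k < d \<Longrightarrow> S f k = 0"
    and f: "f \<in> T.homog d"
  shows "S (T f d) d = f"
proof -
  have fA: "f \<in> A" using f T.homog_mem by blast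
  obtain q where q: "q \<in> A" "T.approximates (d + 1) (T f) q" "S q d = hcomp smul d f"
    using obtain_approximation[OF fA, of "d + 1"] by (metis less_add_one)
  obtain D where D: "\<And>e. e > D \<Longrightarrow> hcomp smul e q = 0"
    using T.hcomp_eventually_0 T.mem_polys q(1) by metis
  let ?D = "max d D"
  have "S (hcomp smul i q) d = (if i = d then S (T f d) d else 0)" for i
  proof (cases "i \<le> d")
    case True
    then have "hcomp smul i q = T f i"
      using T.approximates_hcomp[OF q(2) T.jet_homog[OF fA]] by simp
    then show ?thesis using True low_T[OF f] by (auto simp: S.jet_zero)
  next
    case False
    then show ?thesis using low_S[OF T.hcomp_mem_homog[OF q(1)]] by simp
  qed
  then have "(\<Sum>i\<le>?D. S (hcomp smul i q) d) = S (T f d) d" by simp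
  moreover have "(\<Sum>i\<le>?D. S (hcomp smul i q) d) = S (\<Sum>i\<le>?D. hcomp smul i q) d"
    using T.hcomp_closed[OF q(1)] by (simp add: S.jet_sum)
  moreover have "(\<Sum>i\<le>?D. hcomp smul i q) = q"
    by (rule T.sum_hcomp) (use D q T.mem_polys in auto)
  ultimately show ?thesis using q(3) T.hcomp_homog[OF f, of d] by simp
qed

end

section \<open>Power series on polydiscs\<close>

definition multi_indices :: "nat \<Rightarrow> (nat \<Rightarrow> nat) set" where
  "multi_indices n = {\<alpha>. \<forall>i\<ge>n. \<alpha> i = 0}"

definition mdegree :: "nat \<Rightarrow> (nat \<Rightarrow> nat) \<Rightarrow> nat" where
  "mdegree n \<alpha> = (\<Sum>i<n. \<alpha> i)"

definition mpower :: "nat \<Rightarrow> (nat \<Rightarrow> complex) \<Rightarrow> (nat \<Rightarrow> complex) \<Rightarrow> (nat \<Rightarrow> nat) \<Rightarrow> complex" where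
  "mpower n a w \<alpha> = (\<Prod>i<n. (w i - a i) ^ \<alpha> i)"

definition polydisc :: "nat \<Rightarrow> (nat \<Rightarrow> complex) \<Rightarrow> real \<Rightarrow> (nat \<Rightarrow> complex) set" where
  "polydisc n a r = {w. \<forall>i<n. norm (w i - a i) < r}"

text \<open>\<open>F\<close> is on the polydisc the sum of a power series whose weighted \<open>\<ell>\<^sup>1\<close> norm is at most \<open>B\<close>. This
  norm is submultiplicative, and it dominates the supremum norm.\<close>

definition power_series_bound ::
  "nat \<Rightarrow> (nat \<Rightarrow> complex) \<Rightarrow> real \<Rightarrow> real \<Rightarrow> ((nat \<Rightarrow> complex) \<Rightarrow> complex) \<Rightarrow> bool" where
  "power_series_bound n a r B F \<longleftrightarrow> 0 < r \<and> (\<exists>c B'.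
     ((\<lambda>\<alpha>. norm (c \<alpha>) * r ^ mdegree n \<alpha>) has_sum B') (multi_indices n) \<and> B' \<le> B \<and>
     (\<forall>w\<in>polydisc n a r. ((\<lambda>\<alpha>. c \<alpha> * mpower n a w \<alpha>) has_sum F w) (multi_indices n)))"

lemma holomorphic_near_iff: "holomorphic_near n a F \<longleftrightarrow> (\<exists>r B. power_series_bound n a r B F)"
  unfolding holomorphic_near_def power_series_bound_def Let_def summable_on_def multi_indices_def
    mdegree_def mpower_def polydisc_def
  by (auto; blast)

lemma mdegree_add: "mdegree n (\<alpha> + \<beta>) = mdegree n \<alpha> + mdegree n \<beta>"
  by (simp add: mdegree_def fun_apply sum.distrib)

lemma mpower_add: "mpower n a w (\<alpha> + \<beta>) = mpower n a w \<alpha> * mpower n a w \<beta>"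
  by (simp add: mpower_def fun_apply power_add prod.distrib)

lemma multi_indices_add: "\<alpha> \<in> multi_indices n \<Longrightarrow> \<beta> \<in> multi_indices n \<Longrightarrow> \<alpha> + \<beta> \<in> multi_indices n"
  by (simp add: multi_indices_def fun_apply)

lemma norm_mpower_le:
  assumes "w \<in> polydisc n a r"
  shows "norm (mpower n a w \<alpha>) \<le> r ^ mdegree n \<alpha>"
proof -
  have "norm (mpower n a w \<alpha>) = (\<Prod>i<n. norm (w i - a i) ^ \<alpha> i)"
    by (simp add: mpower_def prod_norm[symmetric] norm_power)
  also have "\<dots> \<le> (\<Prod>i<n. r ^ \<alpha> i)"
    using assms by (intro prod_mono) (auto simp: polydisc_def less_imp_le intro!: power_mono)
  finally show ?thesis by (simp add: mdegree_def power_sum)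
qed

lemma power_series_bound_norm_le:
  assumes "power_series_bound n a r B F" "w \<in> polydisc n a r"
  shows "norm (F w) \<le> B"
proof -
  obtain c B' where c: "((\<lambda>\<alpha>. norm (c \<alpha>) * r ^ mdegree n \<alpha>) has_sum B') (multi_indices n)" "B' \<le> B"
    "((\<lambda>\<alpha>. c \<alpha> * mpower n a w \<alpha>) has_sum F w) (multi_indices n)"
    using assms unfolding power_series_bound_def by blast
  have "norm (F w) \<le> B'"
    by (rule norm_infsum_le[OF c(3,1)])
      (auto simp: norm_mult intro!: mult_left_mono norm_mpower_le assms)
  with c show ?thesis by simp
qed

text \<open>A series of monomials indexed by an arbitrary set, possibly with repetitions, can be brought to
  the standard form by collecting the terms with equal exponents.\<close>

lemma power_series_boundI:
  fixes I :: "'i set" and e :: "'i \<Rightarrow> nat \<Rightarrow> nat" and k :: "'i \<Rightarrow> complex"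
  assumes r: "0 < r" and e: "\<And>i. i \<in> I \<Longrightarrow> e i \<in> multi_indices n"
    and norm: "((\<lambda>i. norm (k i) * r ^ mdegree n (e i)) has_sum B') I" "B' \<le> B"
    and F: "\<And>w. w \<in> polydisc n a r \<Longrightarrow> ((\<lambda>i. k i * mpower n a w (e i)) has_sum F w) I"
  shows "power_series_bound n a r B F"
proof -
  let ?M = "multi_indices n"
  define K where "K \<gamma> = {i\<in>I. e i = \<gamma>}" for \<gamma>
  have bij: "bij_betw snd (Sigma ?M K) I"
    by (rule bij_betwI[where g = "\<lambda>i. (e i, i)"]) (auto simp: K_def e)
  have abs: "(\<lambda>i. norm (k i)) summable_on K \<gamma>" for \<gamma>
  proof -
    have "(\<lambda>i. norm (k i) * r ^ mdegree n (e i)) summable_on K \<gamma>"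
      by (rule summable_on_subset_banach[OF has_sum_imp_summable[OF norm(1)]]) (auto simp: K_def)
    also have "(\<lambda>i. norm (k i) * r ^ mdegree n (e i)) summable_on K \<gamma> \<longleftrightarrow>
        (\<lambda>i. norm (k i) * r ^ mdegree n \<gamma>) summable_on K \<gamma>"
      by (rule summable_on_cong) (auto simp: K_def)
    finally show ?thesis using r by (simp add: summable_on_cmult_left')
  qed
  define c where "c \<gamma> = infsum k (K \<gamma>)" for \<gamma>
  define d where "d \<gamma> = infsum (\<lambda>i. norm (k i)) (K \<gamma>)" for \<gamma>
  have c: "(k has_sum c \<gamma>) (K \<gamma>)" and d: "((\<lambda>i. norm (k i)) has_sum d \<gamma>) (K \<gamma>)" for \<gamma>
    using abs_summable_summable[OF abs[of \<gamma>]] abs[of \<gamma>] unfolding c_def d_def by auto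
  have cd: "norm (c \<gamma>) \<le> d \<gamma>" for \<gamma> using norm_infsum_bound[OF abs] by (simp add: c_def d_def)
  have "((\<lambda>p. norm (k (snd p)) * r ^ mdegree n (e (snd p))) has_sum B') (Sigma ?M K)"
    using norm(1) by (subst has_sum_reindex_bij_betw[OF bij])
  then have D: "((\<lambda>\<gamma>. d \<gamma> * r ^ mdegree n \<gamma>) has_sum B') ?M"
  proof (rule has_sum_SigmaD)
    fix \<gamma>
    have "((\<lambda>i. norm (k i) * r ^ mdegree n \<gamma>) has_sum d \<gamma> * r ^ mdegree n \<gamma>) (K \<gamma>)"
      by (rule has_sum_cmult_left[OF d])
    also have "?this \<longleftrightarrow> ((\<lambda>i. norm (k i) * r ^ mdegree n (e i)) has_sum d \<gamma> * r ^ mdegree n \<gamma>) (K \<gamma>)"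
      by (rule has_sum_cong) (auto simp: K_def)
    finally show "((\<lambda>i. norm (k (snd (\<gamma>, i))) * r ^ mdegree n (e (snd (\<gamma>, i)))) has_sum
        d \<gamma> * r ^ mdegree n \<gamma>) (K \<gamma>)" by simp
  qed
  have le: "norm (c \<gamma>) * r ^ mdegree n \<gamma> \<le> d \<gamma> * r ^ mdegree n \<gamma>" for \<gamma>
    using cd r by (intro mult_right_mono) auto
  have "(\<lambda>\<gamma>. norm (c \<gamma>) * r ^ mdegree n \<gamma>) summable_on ?M"
    by (rule summable_on_comparison_test[OF has_sum_imp_summable[OF D]]) (use le r in auto)
  then obtain B'' where B'': "((\<lambda>\<gamma>. norm (c \<gamma>) * r ^ mdegree n \<gamma>) has_sum B'') ?M"
    by (auto simp: summable_on_def)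
  have "B'' \<le> B'" by (rule has_sum_mono[OF B'' D]) (rule le)
  moreover have "((\<lambda>\<gamma>. c \<gamma> * mpower n a w \<gamma>) has_sum F w) ?M" if "w \<in> polydisc n a r" for w
  proof -
    have "((\<lambda>p. k (snd p) * mpower n a w (e (snd p))) has_sum F w) (Sigma ?M K)"
      using F[OF that] by (subst has_sum_reindex_bij_betw[OF bij])
    then show ?thesis
    proof (rule has_sum_SigmaD)
      fix \<gamma>
      have "((\<lambda>i. k i * mpower n a w \<gamma>) has_sum c \<gamma> * mpower n a w \<gamma>) (K \<gamma>)"
        by (rule has_sum_cmult_left[OF c])
      also have "?this \<longleftrightarrow> ((\<lambda>i. k i * mpower n a w (e i)) has_sum c \<gamma> * mpower n a w \<gamma>) (K \<gamma>)"
        by (rule has_sum_cong) (auto simp: K_def)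
      finally show "((\<lambda>i. k (snd (\<gamma>, i)) * mpower n a w (e (snd (\<gamma>, i)))) has_sum
          c \<gamma> * mpower n a w \<gamma>) (K \<gamma>)" by simp
    qed
  qed
  ultimately show ?thesis
    unfolding power_series_bound_def using r B'' norm(2) by (intro conjI exI[of _ c] exI[of _ B'']) auto
qed

lemma power_series_bound_mono:
  "power_series_bound n a r B F \<Longrightarrow> B \<le> C \<Longrightarrow> power_series_bound n a r C F"
  unfolding power_series_bound_def by (meson order_trans)

lemma power_series_bound_nonneg: "power_series_bound n a r B F \<Longrightarrow> 0 \<le> B"
  using power_series_bound_norm_le[of n a r B F a] order_trans[OF norm_ge_zero, of "F a" B]
  by (simp add: polydisc_def power_series_bound_def)

lemma power_series_bound_single:
  assumes "0 < r" "\<alpha> \<in> multi_indices n"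
  shows "power_series_bound n a r (norm k * r ^ mdegree n \<alpha>) (\<lambda>w. k * mpower n a w \<alpha>)"
  by (rule power_series_boundI[where I = "{()}" and e = "\<lambda>_. \<alpha>" and k = "\<lambda>_. k"])
    (use assms in \<open>auto intro: has_sum_finiteI\<close>)

lemma power_series_bound_const: "0 < r \<Longrightarrow> power_series_bound n a r (norm k) (\<lambda>_. k)"
  using power_series_bound_single[of r 0 n a k]
  by (simp add: multi_indices_def mdegree_def mpower_def fun_apply)

lemma power_series_bound_coordinate:
  assumes "0 < r" "i < n"
  shows "power_series_bound n a r r (\<lambda>w. w i - a i)"
proof -
  let ?e = "\<lambda>j. if j = i then 1 else (0::nat)"
  have "mpower n a w ?e = w i - a i" for w
  proof -
    have "mpower n a w ?e = (\<Prod>j<n. if j = i then w i - a i else 1)"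
      unfolding mpower_def by (rule prod.cong) auto
    then show ?thesis using assms by simp
  qed
  moreover have "mdegree n ?e = 1" using assms by (simp add: mdegree_def)
  ultimately show ?thesis
    using power_series_bound_single[of r ?e n a 1] assms by (auto simp: multi_indices_def)
qed

text \<open>By absolute convergence, the double series may be rearranged.\<close>

lemma power_series_bound_has_sum:
  fixes J :: "'j set"
  assumes r: "0 < r" and F: "\<And>j. j \<in> J \<Longrightarrow> power_series_bound n a r (B j) (F j)"
    and B: "(B has_sum B') J"
    and G: "\<And>w. w \<in> polydisc n a r \<Longrightarrow> ((\<lambda>j. F j w) has_sum G w) J"
  shows "power_series_bound n a r B' G"
proof -
  let ?M = "multi_indices n"
  have "\<forall>j\<in>J. \<exists>c B'. ((\<lambda>\<alpha>. norm (c \<alpha>) * r ^ mdegree n \<alpha>) has_sum B') ?M \<and> B' \<le> B j \<and>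
     (\<forall>w\<in>polydisc n a r. ((\<lambda>\<alpha>. c \<alpha> * mpower n a w \<alpha>) has_sum F j w) ?M)"
    using F unfolding power_series_bound_def by blast
  from bchoice[OF this] obtain c where "\<forall>j\<in>J. \<exists>B'. ((\<lambda>\<alpha>. norm (c j \<alpha>) * r ^ mdegree n \<alpha>) has_sum B') ?M
      \<and> B' \<le> B j \<and> (\<forall>w\<in>polydisc n a r. ((\<lambda>\<alpha>. c j \<alpha> * mpower n a w \<alpha>) has_sum F j w) ?M)" ..
  from bchoice[OF this] obtain D where "\<forall>j\<in>J. ((\<lambda>\<alpha>. norm (c j \<alpha>) * r ^ mdegree n \<alpha>) has_sum D j) ?M
      \<and> D j \<le> B j \<and> (\<forall>w\<in>polydisc n a r. ((\<lambda>\<alpha>. c j \<alpha> * mpower n a w \<alpha>) has_sum F j w) ?M)" ..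
  then have c: "\<And>j. j \<in> J \<Longrightarrow> ((\<lambda>\<alpha>. norm (c j \<alpha>) * r ^ mdegree n \<alpha>) has_sum D j) ?M"
    "\<And>j. j \<in> J \<Longrightarrow> D j \<le> B j"
    "\<And>j w. j \<in> J \<Longrightarrow> w \<in> polydisc n a r \<Longrightarrow> ((\<lambda>\<alpha>. c j \<alpha> * mpower n a w \<alpha>) has_sum F j w) ?M"
    by simp_all
  have D0: "0 \<le> D j" if "j \<in> J" for j
    using has_sum_nonneg[OF c(1)[OF that]] r by simp
  have "D summable_on J"
    by (rule summable_on_comparison_test[OF has_sum_imp_summable[OF B]]) (use c D0 in auto)
  then obtain D' where D': "(D has_sum D') J" by (auto simp: summable_on_def)
  have "D' \<le> B'" by (rule has_sum_mono[OF D' B]) (rule c)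
  let ?f = "\<lambda>p. norm (c (fst p) (snd p)) * r ^ mdegree n (snd p)"
  have sm: "?f summable_on J \<times> ?M"
  proof (rule summable_on_SigmaI[where g = D])
    show "((\<lambda>\<alpha>. ?f (j, \<alpha>)) has_sum D j) ?M" if "j \<in> J" for j using c(1)[OF that] by simp
  qed (use \<open>D summable_on J\<close> r in auto)
  have "(?f has_sum D') (J \<times> ?M)"
  proof (rule has_sum_SigmaI[where g = D])
    show "((\<lambda>\<alpha>. ?f (j, \<alpha>)) has_sum D j) ?M" if "j \<in> J" for j using c(1)[OF that] by simp
  qed (use D' sm in auto)
  then show ?thesis
  proof (rule power_series_boundI[where I = "J \<times> ?M" and e = snd and k = "\<lambda>p. c (fst p) (snd p)", OF r, rotated])
    fix w assume w: "w \<in> polydisc n a r"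
    show "((\<lambda>p. c (fst p) (snd p) * mpower n a w (snd p)) has_sum G w) (J \<times> ?M)"
    proof (rule has_sum_SigmaI[where g = "\<lambda>j. F j w"])
      show "(\<lambda>p. c (fst p) (snd p) * mpower n a w (snd p)) summable_on J \<times> ?M"
      proof (rule abs_summable_summable, rule summable_on_comparison_test[OF sm])
        show "norm (c (fst p) (snd p) * mpower n a w (snd p)) \<le> ?f p" for p
          unfolding norm_mult by (intro mult_left_mono norm_mpower_le w) auto
      qed auto
    qed (use c G w in auto)
  qed (use \<open>D' \<le> B'\<close> in auto)
qed

lemma power_series_bound_add:
  assumes "power_series_bound n a r B F" "power_series_bound n a r C G"
  shows "power_series_bound n a r (B + C) (\<lambda>w. F w + G w)"
  by (rule power_series_bound_has_sum[where J = UNIV and F = "\<lambda>b. if b then F else G"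
        and B = "\<lambda>b. if b then B else C"])
    (use assms in \<open>auto simp: UNIV_bool power_series_bound_def[of n a r B F] intro!: has_sum_finiteI\<close>)

lemma power_series_bound_monomial_mult:
  assumes "power_series_bound n a r B F" "\<alpha> \<in> multi_indices n"
  shows "power_series_bound n a r (norm k * r ^ mdegree n \<alpha> * B) (\<lambda>w. k * mpower n a w \<alpha> * F w)"
proof -
  let ?M = "multi_indices n"
  obtain c B' where c: "((\<lambda>\<beta>. norm (c \<beta>) * r ^ mdegree n \<beta>) has_sum B') ?M" "B' \<le> B"
    "\<And>w. w \<in> polydisc n a r \<Longrightarrow> ((\<lambda>\<beta>. c \<beta> * mpower n a w \<beta>) has_sum F w) ?M" and r: "0 < r"
    using assms(1) unfolding power_series_bound_def by blast
  show ?thesis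
  proof (rule power_series_boundI[where I = ?M and e = "\<lambda>\<beta>. \<alpha> + \<beta>" and k = "\<lambda>\<beta>. k * c \<beta>"])
    show "((\<lambda>\<beta>. norm (k * c \<beta>) * r ^ mdegree n (\<alpha> + \<beta>)) has_sum norm k * r ^ mdegree n \<alpha> * B') ?M"
      using has_sum_cmult_right[OF c(1), of "norm k * r ^ mdegree n \<alpha>"]
      by (simp add: norm_mult mdegree_add power_add mult_ac)
    show "((\<lambda>\<beta>. k * c \<beta> * mpower n a w (\<alpha> + \<beta>)) has_sum k * mpower n a w \<alpha> * F w) ?M"
      if "w \<in> polydisc n a r" for w
      using has_sum_cmult_right[OF c(3)[OF that], of "k * mpower n a w \<alpha>"]
      by (simp add: mpower_add mult_ac)
  qed (use c r assms(2) in \<open>auto intro: multi_indices_add mult_left_mono\<close>)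
qed

lemma power_series_bound_mult:
  assumes "power_series_bound n a r B F" "power_series_bound n a r C G"
  shows "power_series_bound n a r (B * C) (\<lambda>w. F w * G w)"
proof -
  let ?M = "multi_indices n"
  obtain c B' where c: "((\<lambda>\<beta>. norm (c \<beta>) * r ^ mdegree n \<beta>) has_sum B') ?M" "B' \<le> B"
    "\<And>w. w \<in> polydisc n a r \<Longrightarrow> ((\<lambda>\<beta>. c \<beta> * mpower n a w \<beta>) has_sum F w) ?M" and r: "0 < r"
    using assms(1) unfolding power_series_bound_def by blast
  have "power_series_bound n a r (B' * C) (\<lambda>w. F w * G w)"
    by (rule power_series_bound_has_sum[where J = ?M and F = "\<lambda>\<alpha> w. c \<alpha> * mpower n a w \<alpha> * G w"
          and B = "\<lambda>\<alpha>. norm (c \<alpha>) * r ^ mdegree n \<alpha> * C"])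
      (use r c in \<open>auto intro: power_series_bound_monomial_mult assms has_sum_cmult_left\<close>)
  then show ?thesis
    by (rule power_series_bound_mono)
      (use c power_series_bound_nonneg[OF assms(2)] in \<open>auto intro: mult_right_mono\<close>)
qed

lemma power_series_bound_power:
  "power_series_bound n a r B F \<Longrightarrow> power_series_bound n a r (B ^ k) (\<lambda>w. F w ^ k)"
proof (induction k)
  case 0
  then show ?case using power_series_bound_const[of r n a 1] by (simp add: power_series_bound_def)
next
  case (Suc k)
  then show ?case using power_series_bound_mult[of n a r B F "B ^ k"] by simp
qed

lemma power_series_bound_prod:
  fixes m :: nat
  assumes "0 < r" "\<And>i. i < m \<Longrightarrow> power_series_bound n a r (B i) (F i)"
  shows "power_series_bound n a r (\<Prod>i<m. B i) (\<lambda>w. \<Prod>i<m. F i w)"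
  using assms(2)
proof (induction m)
  case 0
  then show ?case using power_series_bound_const[of r n a 1] assms by simp
next
  case (Suc m)
  then show ?case using power_series_bound_mult[of n a r _ "\<lambda>w. \<Prod>i<m. F i w"] by simp
qed

lemma power_series_bound_radius:
  assumes "power_series_bound n a r B F" "0 < \<rho>" "\<rho> \<le> r"
  shows "power_series_bound n a \<rho> B F"
proof -
  let ?M = "multi_indices n"
  obtain c B' where c: "((\<lambda>\<beta>. norm (c \<beta>) * r ^ mdegree n \<beta>) has_sum B') ?M" "B' \<le> B"
    "\<And>w. w \<in> polydisc n a r \<Longrightarrow> ((\<lambda>\<beta>. c \<beta> * mpower n a w \<beta>) has_sum F w) ?M"
    using assms(1) unfolding power_series_bound_def by blast
  have le: "norm (c \<beta>) * \<rho> ^ mdegree n \<beta> \<le> norm (c \<beta>) * r ^ mdegree n \<beta>" for \<beta>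
    using assms by (intro mult_left_mono power_mono) auto
  have "(\<lambda>\<beta>. norm (c \<beta>) * \<rho> ^ mdegree n \<beta>) summable_on ?M"
    by (rule summable_on_comparison_test[OF has_sum_imp_summable[OF c(1)]]) (use le assms in auto)
  then obtain C where C: "((\<lambda>\<beta>. norm (c \<beta>) * \<rho> ^ mdegree n \<beta>) has_sum C) ?M"
    by (auto simp: summable_on_def)
  have "C \<le> B'" by (rule has_sum_mono[OF C c(1)]) (rule le)
  moreover have "w \<in> polydisc n a r" if "w \<in> polydisc n a \<rho>" for w
    using that assms by (force simp: polydisc_def)
  ultimately show ?thesis
    unfolding power_series_bound_def using assms c C by (intro conjI exI[of _ c] exI[of _ C]) auto
qed

text \<open>Every term other than the constant one has positive degree, so it gains at least one factor
  \<open>\<rho> / r\<close> when the radius shrinks. This is the quantitative form of continuity at the centre.\<close>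

lemma power_series_bound_minus_const:
  assumes "power_series_bound n a r B F" "0 < \<rho>" "\<rho> \<le> r"
  shows "power_series_bound n a \<rho> (\<rho> / r * B) (\<lambda>w. F w - F a)"
proof -
  let ?M = "multi_indices n"
  obtain c B' where c: "((\<lambda>\<beta>. norm (c \<beta>) * r ^ mdegree n \<beta>) has_sum B') ?M" "B' \<le> B"
    "\<And>w. w \<in> polydisc n a r \<Longrightarrow> ((\<lambda>\<beta>. c \<beta> * mpower n a w \<beta>) has_sum F w) ?M" and r: "0 < r"
    using assms(1) unfolding power_series_bound_def by blast
  have M0: "0 \<in> ?M" by (simp add: multi_indices_def fun_apply)
  have pos: "mdegree n \<beta> > 0" if "\<beta> \<in> ?M - {0}" for \<beta>
  proof -
    have "\<exists>i. \<beta> i \<noteq> 0"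
      using that by (metis Diff_iff ext singletonI zero_fun_apply)
    then obtain i where "\<beta> i \<noteq> 0" ..
    moreover have "\<beta> i = 0" if "i \<ge> n" using \<open>\<beta> \<in> ?M - {0}\<close> that unfolding multi_indices_def by blast
    ultimately have "i < n" using not_le by blast
    then have "\<beta> i \<le> mdegree n \<beta>" unfolding mdegree_def by (intro member_le_sum) auto
    then show ?thesis using \<open>\<beta> i \<noteq> 0\<close> by linarith
  qed
  have m0: "mpower n a w 0 = 1" for w by (simp add: mpower_def fun_apply)
  have a0: "mpower n a a \<beta> = 0" if "\<beta> \<in> ?M - {0}" for \<beta>
  proof -
    have "\<exists>i\<in>{..<n}. \<beta> i \<noteq> 0"
    proof (rule ccontr)
      assume "\<not> ?thesis"
      then have "mdegree n \<beta> = 0" by (simp add: mdegree_def)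
      with pos[OF that] show False by simp
    qed
    then have "\<exists>i\<in>{..<n}. (a i - a i) ^ \<beta> i = 0" by simp
    then show ?thesis unfolding mpower_def by (rule prod_zero[OF finite_lessThan])
  qed
  have "((\<lambda>\<beta>. c \<beta> * mpower n a a \<beta>) has_sum F a) ?M" using c(3)[of a] r by (simp add: polydisc_def)
  moreover have "((\<lambda>\<beta>. c \<beta> * mpower n a a \<beta>) has_sum c 0) ?M"
    by (rule has_sum_finite_neutralI[of "{0}"]) (use M0 a0 m0 in auto)
  ultimately have c0: "c 0 = F a" by (rule has_sum_unique[symmetric])
  have rest: "((\<lambda>\<beta>. c \<beta> * mpower n a w \<beta>) has_sum (F w - F a)) (?M - {0})" if "w \<in> polydisc n a \<rho>" for w
  proof -
    have "w \<in> polydisc n a r" using that assms by (force simp: polydisc_def)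
    moreover have "((\<lambda>\<beta>. c \<beta> * mpower n a w \<beta>) has_sum F a) {0}"
      by (rule has_sum_finiteI) (simp_all add: m0 c0)
    ultimately show ?thesis using M0 by (intro has_sum_Diff[OF c(3)]) auto
  qed
  have le: "norm (c \<beta>) * \<rho> ^ mdegree n \<beta> \<le> \<rho> / r * (norm (c \<beta>) * r ^ mdegree n \<beta>)" if "\<beta> \<in> ?M - {0}" for \<beta>
  proof -
    have "\<exists>d. mdegree n \<beta> = Suc d" using pos[OF that] by (cases "mdegree n \<beta>") auto
    then obtain d where d: "mdegree n \<beta> = Suc d" ..
    have "norm (c \<beta>) * (\<rho> * \<rho> ^ d) \<le> norm (c \<beta>) * (\<rho> * r ^ d)"
      using assms by (intro mult_left_mono power_mono) auto
    then show ?thesis using r by (simp add: d mult_ac)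
  qed
  have sr: "(\<lambda>\<beta>. \<rho> / r * (norm (c \<beta>) * r ^ mdegree n \<beta>)) summable_on ?M"
    using has_sum_cmult_right[OF c(1)] has_sum_imp_summable by blast
  then have sr': "(\<lambda>\<beta>. \<rho> / r * (norm (c \<beta>) * r ^ mdegree n \<beta>)) summable_on ?M - {0}"
    by (rule summable_on_subset_banach) auto
  have "(\<lambda>\<beta>. norm (c \<beta>) * \<rho> ^ mdegree n \<beta>) summable_on ?M - {0}"
    by (rule summable_on_comparison_test[OF sr']) (use le assms in auto)
  then obtain C where C: "((\<lambda>\<beta>. norm (c \<beta>) * \<rho> ^ mdegree n \<beta>) has_sum C) (?M - {0})"
    by (auto simp: summable_on_def)
  have "C \<le> infsum (\<lambda>\<beta>. \<rho> / r * (norm (c \<beta>) * r ^ mdegree n \<beta>)) (?M - {0})"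
    by (rule has_sum_mono[OF C has_sum_infsum[OF sr']]) (rule le)
  also have "\<dots> \<le> infsum (\<lambda>\<beta>. \<rho> / r * (norm (c \<beta>) * r ^ mdegree n \<beta>)) ?M"
    by (rule infsum_mono2[OF sr' sr]) (use assms r in auto)
  also have "\<dots> = \<rho> / r * B'" using has_sum_cmult_right[OF c(1), of "\<rho> / r"] by (rule infsumI)
  also have "\<dots> \<le> \<rho> / r * B" using c(2) assms r by (intro mult_left_mono) auto
  finally have "C \<le> \<rho> / r * B" .
  then show ?thesis
    by (intro power_series_boundI[where I = "?M - {0}" and e = "\<lambda>\<beta>. \<beta>" and k = c])
      (use assms C rest in auto)
qed

text \<open>By submultiplicativity, a monomial in the functions \<open>G i - a i\<close> has at most the norm of the same
  monomial on the polydisc of radius \<open>r\<close>.\<close>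

lemma power_series_bound_compose:
  assumes F: "power_series_bound n a r B F" and \<rho>: "0 < \<rho>"
    and G: "\<And>i. i < n \<Longrightarrow> power_series_bound m b \<rho> s (\<lambda>w. G i w - a i)" and s: "s < r"
  shows "power_series_bound m b \<rho> B (\<lambda>w. F (\<lambda>i. G i w))"
proof -
  let ?M = "multi_indices n"
  obtain c B' where c: "((\<lambda>\<beta>. norm (c \<beta>) * r ^ mdegree n \<beta>) has_sum B') ?M" "B' \<le> B"
    "\<And>w. w \<in> polydisc n a r \<Longrightarrow> ((\<lambda>\<beta>. c \<beta> * mpower n a w \<beta>) has_sum F w) ?M" and r: "0 < r"
    using F unfolding power_series_bound_def by blast
  have disc: "(\<lambda>i. G i w) \<in> polydisc n a r" if "w \<in> polydisc m b \<rho>" for w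
    using power_series_bound_norm_le[OF G that] s by (auto simp: polydisc_def intro: le_less_trans)
  have "power_series_bound m b \<rho> (norm (c \<beta>) * r ^ mdegree n \<beta>) (\<lambda>w. c \<beta> * mpower n a (\<lambda>i. G i w) \<beta>)" for \<beta>
  proof -
    have "power_series_bound m b \<rho> (\<Prod>i<n. r ^ \<beta> i) (\<lambda>w. \<Prod>i<n. (G i w - a i) ^ \<beta> i)"
      using s by (intro power_series_bound_prod power_series_bound_power \<rho>)
        (auto intro: power_series_bound_mono[OF G])
    from power_series_bound_mult[OF power_series_bound_const[OF \<rho>] this, of "c \<beta>"]
    show ?thesis by (simp add: mpower_def mdegree_def power_sum)
  qed
  then have "power_series_bound m b \<rho> B' (\<lambda>w. F (\<lambda>i. G i w))"
    by (intro power_series_bound_has_sum[OF \<rho> _ c(1)]) (use c(3) disc in auto)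
  then show ?thesis using c(2) power_series_bound_mono by blast
qed

subsection \<open>Closure properties of holomorphic functions\<close>

lemma holomorphic_near_continuous:
  assumes "holomorphic_near n a F" "0 < \<epsilon>"
  shows "\<exists>\<rho>>0. \<forall>w\<in>polydisc n a \<rho>. norm (F w - F a) < \<epsilon>"
    and "\<exists>\<rho>0>0. \<forall>\<rho>. 0 < \<rho> \<and> \<rho> \<le> \<rho>0 \<longrightarrow> power_series_bound n a \<rho> \<epsilon> (\<lambda>w. F w - F a)"
proof -
  have *: "\<exists>\<rho>0>0. \<forall>\<rho>. 0 < \<rho> \<and> \<rho> \<le> \<rho>0 \<longrightarrow> power_series_bound n a \<rho> \<epsilon> (\<lambda>w. F w - F a)"
    if "0 < \<epsilon>" for \<epsilon>
  proof -
    obtain r B where F: "power_series_bound n a r B F" using assms(1) by (auto simp: holomorphic_near_iff)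
    have r: "0 < r" using F by (simp add: power_series_bound_def)
    have B: "0 \<le> B" using F by (rule power_series_bound_nonneg)
    define \<rho>0 where "\<rho>0 = min r (r * \<epsilon> / (B + 1))"
    have "power_series_bound n a \<rho> \<epsilon> (\<lambda>w. F w - F a)" if \<rho>: "0 < \<rho>" "\<rho> \<le> \<rho>0" for \<rho>
    proof (rule power_series_bound_mono[OF power_series_bound_minus_const[OF F]])
      have "\<rho> * (B + 1) \<le> r * \<epsilon>" using \<rho> B by (simp add: \<rho>0_def field_simps)
      then have "\<rho> * B \<le> r * \<epsilon>" using \<rho> by (simp add: algebra_simps)
      then show "\<rho> / r * B \<le> \<epsilon>" using r by (simp add: field_simps)
    qed (use \<rho> in \<open>auto simp: \<rho>0_def\<close>)
    moreover have "\<rho>0 > 0" using r B that by (simp add: \<rho>0_def)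
    ultimately show ?thesis by auto
  qed
  from *[OF assms(2)] show "\<exists>\<rho>0>0. \<forall>\<rho>. 0 < \<rho> \<and> \<rho> \<le> \<rho>0 \<longrightarrow> power_series_bound n a \<rho> \<epsilon> (\<lambda>w. F w - F a)" .
  from *[of "\<epsilon> / 2"] assms(2) obtain \<rho> where "\<rho> > 0" "power_series_bound n a \<rho> (\<epsilon> / 2) (\<lambda>w. F w - F a)" by auto
  then show "\<exists>\<rho>>0. \<forall>w\<in>polydisc n a \<rho>. norm (F w - F a) < \<epsilon>"
    using power_series_bound_norm_le assms(2) by (intro exI[of _ \<rho>]) force
qed

lemma holomorphic_near_compose:
  assumes F: "holomorphic_near n (\<lambda>i. G i b) F" and G: "\<And>i. i < n \<Longrightarrow> holomorphic_near m b (G i)"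
  shows "holomorphic_near m b (\<lambda>w. F (\<lambda>i. G i w))"
proof -
  obtain r B where r: "power_series_bound n (\<lambda>i. G i b) r B F" using F by (auto simp: holomorphic_near_iff)
  have "0 < r" using r by (simp add: power_series_bound_def)
  then have "\<forall>i. \<exists>\<rho>0. i < n \<longrightarrow> \<rho>0 > 0 \<and> (\<forall>\<rho>. 0 < \<rho> \<and> \<rho> \<le> \<rho>0 \<longrightarrow> power_series_bound m b \<rho> (r / 2) (\<lambda>w. G i w - G i b))"
    using holomorphic_near_continuous(2)[OF G, of _ "r / 2"] by (meson half_gt_zero)
  then obtain \<rho>0 where \<rho>0: "\<And>i. i < n \<Longrightarrow> \<rho>0 i > 0"
    "\<And>i \<rho>. i < n \<Longrightarrow> 0 < \<rho> \<Longrightarrow> \<rho> \<le> \<rho>0 i \<Longrightarrow> power_series_bound m b \<rho> (r / 2) (\<lambda>w. G i w - G i b)"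
    by metis
  define \<rho> where "\<rho> = Min (insert 1 (\<rho>0 ` {..<n}))"
  have "\<rho> > 0" "\<And>i. i < n \<Longrightarrow> \<rho> \<le> \<rho>0 i" using \<rho>0(1) by (auto simp: \<rho>_def)
  then have "power_series_bound m b \<rho> B (\<lambda>w. F (\<lambda>i. G i w))"
    using \<open>0 < r\<close> by (intro power_series_bound_compose[OF r, of \<rho> m b "r / 2"] \<rho>0(2)) auto
  then show ?thesis by (auto simp: holomorphic_near_iff)
qed

lemma holomorphic_near_const: "holomorphic_near n a (\<lambda>_. c)"
  using power_series_bound_const[of 1 n a c] by (auto simp: holomorphic_near_iff)

lemma holomorphic_near_coordinate:
  assumes "i < n"
  shows "holomorphic_near n a (\<lambda>w. w i)"
  using power_series_bound_add[OF power_series_bound_coordinate[OF zero_less_one assms]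
      power_series_bound_const[OF zero_less_one], of a "a i"]
  by (auto simp: holomorphic_near_iff)

lemma holomorphic_near_common_radius:
  assumes "holomorphic_near n a F" "holomorphic_near n a G"
  obtains r B C where "power_series_bound n a r B F" "power_series_bound n a r C G"
proof -
  obtain r B s C where r: "power_series_bound n a r B F" "power_series_bound n a s C G"
    using assms by (auto simp: holomorphic_near_iff)
  then have "0 < min r s" by (simp add: power_series_bound_def)
  then show thesis
    by (intro that[of "min r s" B C] power_series_bound_radius[OF r(1)] power_series_bound_radius[OF r(2)]) auto
qed

lemma holomorphic_near_add:
  "holomorphic_near n a F \<Longrightarrow> holomorphic_near n a G \<Longrightarrow> holomorphic_near n a (\<lambda>w. F w + G w)"
  by (erule (1) holomorphic_near_common_radius) (auto simp: holomorphic_near_iff dest: power_series_bound_add)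

lemma holomorphic_near_mult:
  "holomorphic_near n a F \<Longrightarrow> holomorphic_near n a G \<Longrightarrow> holomorphic_near n a (\<lambda>w. F w * G w)"
  by (erule (1) holomorphic_near_common_radius) (auto simp: holomorphic_near_iff dest: power_series_bound_mult)

text \<open>The geometric series, on the disc of half the distance to the pole.\<close>

lemma holomorphic_near_inverse:
  assumes "a 0 \<noteq> 0"
  shows "holomorphic_near 1 a (\<lambda>w. inverse (w 0))"
proof -
  define r where "r = norm (a 0) / 2"
  have r: "0 < r" using assms by (simp add: r_def)
  let ?F = "\<lambda>k w. inverse (a 0) * (- inverse (a 0) * (w 0 - a 0)) ^ k"
  have F: "power_series_bound 1 a r (norm (inverse (a 0)) * (norm (- inverse (a 0)) * r) ^ k) (?F k)" for k
    by (intro power_series_bound_mult power_series_bound_power power_series_bound_const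
        power_series_bound_coordinate r) simp
  have half: "norm (- inverse (a 0)) * r = 1 / 2" using assms by (simp add: r_def norm_inverse)
  have B: "((\<lambda>k. norm (inverse (a 0)) * (1 / 2) ^ k) has_sum norm (inverse (a 0)) * 2) UNIV"
    by (intro has_sum_cmult_right norm_summable_imp_has_sum) (use geometric_sums[of "1/2::real"] in \<open>auto simp: summable_geometric_iff norm_power\<close>)
  have G: "((\<lambda>k. ?F k w) has_sum inverse (w 0)) UNIV" if "w \<in> polydisc 1 a r" for w
  proof -
    let ?q = "- inverse (a 0) * (w 0 - a 0)"
    have "norm (w 0 - a 0) < r" using that by (simp add: polydisc_def)
    then have "norm (inverse (a 0)) * norm (w 0 - a 0) < norm (inverse (a 0)) * r"
      using assms by (intro mult_strict_left_mono) auto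
    then have q: "norm ?q < 1" using half by (simp add: norm_mult)
    then have "((\<lambda>k. ?q ^ k) has_sum (1 / (1 - ?q))) UNIV"
      by (intro norm_summable_imp_has_sum geometric_sums) (auto simp: norm_power summable_geometric_iff simp del: norm_minus_cancel mult_minus_left)
    then have "((\<lambda>k. ?F k w) has_sum inverse (a 0) * (1 / (1 - ?q))) UNIV"
      by (rule has_sum_cmult_right)
    moreover have "1 - ?q = inverse (a 0) * w 0" using assms by (simp add: field_simps)
    ultimately show ?thesis using assms by (simp add: inverse_eq_divide)
  qed
  have "power_series_bound 1 a r (norm (inverse (a 0)) * 2) (\<lambda>w. inverse (w 0))"
    by (rule power_series_bound_has_sum[OF r, where J = UNIV and F = ?F]) (use F[unfolded half] B G in simp_all)
  then show ?thesis by (auto simp: holomorphic_near_iff)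
qed

text \<open>Sorting the power series by whether the first variable occurs gives the division with remainder
  by this variable.\<close>

lemma power_series_bound_divide:
  assumes "power_series_bound (Suc n) a r B F" "a 0 = 0"
  obtains H where "power_series_bound (Suc n) a r (B / r) H"
    and "\<And>w. w \<in> polydisc (Suc n) a r \<Longrightarrow> F w = F (w(0 := 0)) + w 0 * H w"
proof -
  let ?M = "multi_indices (Suc n)"
  let ?e = "\<lambda>\<alpha>::nat \<Rightarrow> nat. \<alpha>(0 := \<alpha> 0 + 1)"
  obtain c B' where c: "((\<lambda>\<beta>. norm (c \<beta>) * r ^ mdegree (Suc n) \<beta>) has_sum B') ?M" "B' \<le> B"
    "\<And>w. w \<in> polydisc (Suc n) a r \<Longrightarrow> ((\<lambda>\<beta>. c \<beta> * mpower (Suc n) a w \<beta>) has_sum F w) ?M" and r: "0 < r"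
    using assms(1) unfolding power_series_bound_def by blast
  define M0 where "M0 = {\<alpha>\<in>?M. \<alpha> 0 = 0}"
  have M_split: "?M = M0 \<union> ?e ` ?M" "M0 \<inter> ?e ` ?M = {}"
  proof -
    have "\<alpha> \<in> ?e ` ?M" if "\<alpha> \<in> ?M" "\<alpha> 0 \<noteq> 0" for \<alpha>
      using that by (intro image_eqI[of _ _ "\<alpha>(0 := \<alpha> 0 - 1)"]) (auto simp: multi_indices_def)
    then show "?M = M0 \<union> ?e ` ?M" by (auto simp: M0_def multi_indices_def)
    show "M0 \<inter> ?e ` ?M = {}" by (auto simp: M0_def)
  qed
  have inj: "inj_on ?e ?M"
  proof (rule inj_onI)
    fix \<alpha> \<beta> assume *: "?e \<alpha> = ?e \<beta>"
    show "\<alpha> = \<beta>"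
    proof
      fix i show "\<alpha> i = \<beta> i" using fun_cong[OF *, of i] by (cases "i = 0") auto
    qed
  qed
  have deg: "mdegree (Suc n) (?e \<alpha>) = Suc (mdegree (Suc n) \<alpha>)" for \<alpha>
    by (simp add: mdegree_def sum.lessThan_Suc_shift del: sum.lessThan_Suc)
  have pow: "mpower (Suc n) a w (?e \<alpha>) = w 0 * mpower (Suc n) a w \<alpha>" for \<alpha> w
    by (simp add: mpower_def prod.lessThan_Suc_shift assms(2) del: prod.lessThan_Suc)
  define H where "H w = infsum (\<lambda>\<alpha>. c (?e \<alpha>) * mpower (Suc n) a w \<alpha>) ?M" for w
  have sub: "(\<lambda>\<beta>. norm (c \<beta>) * r ^ mdegree (Suc n) \<beta>) summable_on ?e ` ?M"
    by (rule summable_on_subset_banach[OF has_sum_imp_summable[OF c(1)]]) (use M_split in auto)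
  have sub': "(\<lambda>\<alpha>. norm (c (?e \<alpha>)) * r ^ mdegree (Suc n) (?e \<alpha>)) summable_on ?M"
    using sub inj by (simp add: summable_on_reindex o_def)
  have "infsum (\<lambda>\<alpha>. norm (c (?e \<alpha>)) * r ^ mdegree (Suc n) (?e \<alpha>)) ?M =
      infsum (\<lambda>\<beta>. norm (c \<beta>) * r ^ mdegree (Suc n) \<beta>) (?e ` ?M)"
    using inj by (simp add: infsum_reindex o_def)
  also have "\<dots> \<le> infsum (\<lambda>\<beta>. norm (c \<beta>) * r ^ mdegree (Suc n) \<beta>) ?M"
    by (rule infsum_mono2[OF sub has_sum_imp_summable[OF c(1)]]) (use M_split r in auto)
  also have "\<dots> = B'" using c(1) by (rule infsumI)
  finally have C_le: "infsum (\<lambda>\<alpha>. norm (c (?e \<alpha>)) * r ^ mdegree (Suc n) (?e \<alpha>)) ?M \<le> B'" .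
  define C where "C = infsum (\<lambda>\<alpha>. norm (c (?e \<alpha>)) * r ^ mdegree (Suc n) (?e \<alpha>)) ?M / r"
  have "((\<lambda>\<alpha>. norm (c (?e \<alpha>)) * r ^ mdegree (Suc n) (?e \<alpha>) * inverse r) has_sum C) ?M"
    unfolding C_def divide_inverse by (rule has_sum_cmult_left[OF has_sum_infsum[OF sub']])
  moreover have "norm (c (?e \<alpha>)) * r ^ mdegree (Suc n) (?e \<alpha>) * inverse r =
      norm (c (?e \<alpha>)) * r ^ mdegree (Suc n) \<alpha>" for \<alpha>
    using r unfolding deg by simp
  ultimately have norm_H: "((\<lambda>\<alpha>. norm (c (?e \<alpha>)) * r ^ mdegree (Suc n) \<alpha>) has_sum C) ?M"
    by (simp only:)
  have C: "C \<le> B / r" unfolding C_def using C_le c(2) r by (intro divide_right_mono) auto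
  have H: "((\<lambda>\<alpha>. c (?e \<alpha>) * mpower (Suc n) a w \<alpha>) has_sum H w) ?M" if "w \<in> polydisc (Suc n) a r" for w
  proof -
    have le: "norm (c (?e \<alpha>) * mpower (Suc n) a w \<alpha>) \<le> norm (c (?e \<alpha>)) * r ^ mdegree (Suc n) \<alpha>" for \<alpha>
      unfolding norm_mult by (intro mult_left_mono norm_mpower_le that) auto
    have "(\<lambda>\<alpha>. norm (c (?e \<alpha>) * mpower (Suc n) a w \<alpha>)) summable_on ?M"
      by (rule summable_on_comparison_test[OF has_sum_imp_summable[OF norm_H]]) (rule le, rule norm_ge_zero)
    then have "(\<lambda>\<alpha>. c (?e \<alpha>) * mpower (Suc n) a w \<alpha>) summable_on ?M"
      by (rule abs_summable_summable)
    then show ?thesis unfolding H_def by (rule has_sum_infsum)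
  qed
  show thesis
  proof (rule that[of H])
    show "power_series_bound (Suc n) a r (B / r) H"
      unfolding power_series_bound_def using r norm_H C H
      by (intro conjI exI[of _ "\<lambda>\<alpha>. c (?e \<alpha>)"] exI[of _ C]) auto
    fix w assume w: "w \<in> polydisc (Suc n) a r"
    have w0: "w(0 := 0) \<in> polydisc (Suc n) a r" using w r by (auto simp: polydisc_def assms(2))
    have eq0: "mpower (Suc n) a (w(0 := 0)) \<alpha> = (if \<alpha> 0 = 0 then mpower (Suc n) a w \<alpha> else 0)" for \<alpha>
      by (auto simp: mpower_def prod.lessThan_Suc_shift assms(2) simp del: prod.lessThan_Suc)
    have "((\<lambda>\<alpha>. c \<alpha> * mpower (Suc n) a (w(0 := 0)) \<alpha>) has_sum F (w(0 := 0))) ?M" by (rule c(3)[OF w0])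
    also have "?this \<longleftrightarrow> ((\<lambda>\<alpha>. c \<alpha> * mpower (Suc n) a w \<alpha>) has_sum F (w(0 := 0))) M0"
      by (rule has_sum_cong_neutral) (auto simp: M0_def eq0)
    finally have 1: "((\<lambda>\<alpha>. c \<alpha> * mpower (Suc n) a w \<alpha>) has_sum F (w(0 := 0))) M0" .
    have "((\<lambda>\<alpha>. w 0 * (c (?e \<alpha>) * mpower (Suc n) a w \<alpha>)) has_sum w 0 * H w) ?M"
      by (rule has_sum_cmult_right[OF H[OF w]])
    moreover have "w 0 * (c (?e \<alpha>) * mpower (Suc n) a w \<alpha>) = c (?e \<alpha>) * mpower (Suc n) a w (?e \<alpha>)" for \<alpha>
      unfolding pow by (simp only: mult_ac)
    ultimately have "((\<lambda>\<alpha>. c (?e \<alpha>) * mpower (Suc n) a w (?e \<alpha>)) has_sum w 0 * H w) ?M"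
      by (simp only:)
    then have 2: "((\<lambda>\<alpha>. c \<alpha> * mpower (Suc n) a w \<alpha>) has_sum w 0 * H w) (?e ` ?M)"
      unfolding has_sum_reindex[OF inj] o_def .
    have "((\<lambda>\<alpha>. c \<alpha> * mpower (Suc n) a w \<alpha>) has_sum F (w(0 := 0)) + w 0 * H w) ?M"
      using has_sum_Un_disjoint[OF 1 2] M_split by simp
    with c(3)[OF w] show "F w = F (w(0 := 0)) + w 0 * H w" by (rule has_sum_unique)
  qed
qed

text \<open>The estimate for \<open>H\<close>, which comes from dividing a second time, says that \<open>H\<close> is continuous in the
  first variable at all points of the polydisc where this variable is \<open>0\<close>, and not only at the centre.\<close>

lemma holomorphic_near_divide:
  assumes "holomorphic_near (Suc n) a F" "a 0 = 0"
  shows "\<exists>H C r. holomorphic_near (Suc n) a H \<and> 0 < r \<and> (\<forall>w\<in>polydisc (Suc n) a r.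
    F w = F (w(0 := 0)) + w 0 * H w \<and> norm (H w - H (w(0 := 0))) \<le> C * norm (w 0))"
proof -
  obtain r B where F: "power_series_bound (Suc n) a r B F" using assms(1) by (auto simp: holomorphic_near_iff)
  obtain H where H: "power_series_bound (Suc n) a r (B / r) H"
    "\<And>w. w \<in> polydisc (Suc n) a r \<Longrightarrow> F w = F (w(0 := 0)) + w 0 * H w"
    using power_series_bound_divide[OF F assms(2)] by blast
  obtain K where K: "power_series_bound (Suc n) a r (B / r / r) K"
    "\<And>w. w \<in> polydisc (Suc n) a r \<Longrightarrow> H w = H (w(0 := 0)) + w 0 * K w"
    using power_series_bound_divide[OF H(1) assms(2)] by blast
  have "norm (H w - H (w(0 := 0))) \<le> B / r / r * norm (w 0)" if w: "w \<in> polydisc (Suc n) a r" for w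
  proof -
    have "norm (H w - H (w(0 := 0))) = norm (K w) * norm (w 0)"
      using K(2)[OF w] by (simp add: norm_mult mult.commute)
    also have "\<dots> \<le> B / r / r * norm (w 0)"
      by (intro mult_right_mono power_series_bound_norm_le[OF K(1) w]) auto
    finally show ?thesis .
  qed
  moreover have "holomorphic_near (Suc n) a H" using H(1) holomorphic_near_iff by blast
  moreover have "0 < r" using F by (simp add: power_series_bound_def)
  ultimately show ?thesis
    by (intro exI[of _ H] exI[of _ "B / r / r"] exI[of _ r]) (simp add: H(2))
qed

section \<open>Holomorphic functions on affine varieties\<close>

text \<open>The neighbourhoods of \<open>x\<close> in the coarsest topology on \<open>X\<close> that makes the functions in \<open>R\<close>
  continuous.\<close>

definition nbhd :: "'x set \<Rightarrow> ('x \<Rightarrow> complex) set \<Rightarrow> 'x \<Rightarrow> 'x set \<Rightarrow> bool" where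
  "nbhd X R x U \<longleftrightarrow> (\<exists>n p. \<exists>r>0. (\<forall>i<(n::nat). p i \<in> R) \<and>
     (\<forall>y\<in>X. (\<forall>i<n. norm (p i y - p i x) < r) \<longrightarrow> y \<in> U))"

lemma nbhd_mem: "nbhd X R x U \<Longrightarrow> x \<in> X \<Longrightarrow> x \<in> U"
  unfolding nbhd_def by auto

lemma nbhdI:
  fixes n :: nat
  assumes "0 < r" "\<And>i. i < n \<Longrightarrow> p i \<in> R"
    "\<And>y. y \<in> X \<Longrightarrow> \<forall>i<n. norm (p i y - p i x) < r \<Longrightarrow> y \<in> U"
  shows "nbhd X R x U"
  unfolding nbhd_def by (rule exI[of _ n], rule exI[of _ p], rule exI[of _ r]) (use assms in blast)

lemma nbhdE:
  assumes "nbhd X R x U"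
  obtains n :: nat and p r where "0 < r" "\<forall>i<n. p i \<in> R"
    "\<forall>y\<in>X. (\<forall>i<n. norm (p i y - p i x) < r) \<longrightarrow> y \<in> U"
  using assms unfolding nbhd_def by (elim exE conjE) (rule that)

lemma nbhd_mono:
  assumes "nbhd X R x U" "\<And>y. y \<in> X \<Longrightarrow> y \<in> U \<Longrightarrow> y \<in> V"
  shows "nbhd X R x V"
proof -
  obtain n :: nat and p r where "0 < r" "\<forall>i<n. p i \<in> R"
    "\<forall>y\<in>X. (\<forall>i<n. norm (p i y - p i x) < r) \<longrightarrow> y \<in> U"
    using assms(1) by (rule nbhdE) (rule that)
  then show ?thesis by (intro nbhdI[of r n p]) (use assms(2) in auto)
qed

lemma nbhd_UNIV: "(\<And>y. y \<in> X \<Longrightarrow> y \<in> U) \<Longrightarrow> nbhd X R x U"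
  by (rule nbhdI[of 1 0]) auto

definition append_fun :: "nat \<Rightarrow> (nat \<Rightarrow> 'b) \<Rightarrow> (nat \<Rightarrow> 'b) \<Rightarrow> nat \<Rightarrow> 'b" where
  "append_fun n p q i = (if i < n then p i else q (i - n))"

lemma append_fun_less: "i < n \<Longrightarrow> append_fun n p q i = p i"
  and append_fun_add: "append_fun n p q (n + i) = q i"
  by (auto simp: append_fun_def)

lemma append_fun_in:
  "(\<And>i. i < n \<Longrightarrow> p i \<in> R) \<Longrightarrow> (\<And>i. i < m \<Longrightarrow> q i \<in> R) \<Longrightarrow> i < n + m \<Longrightarrow> append_fun n p q i \<in> R"
  by (auto simp: append_fun_def)

lemma nbhd_Int:
  assumes "nbhd X R x U" "nbhd X R x V"
  shows "nbhd X R x (U \<inter> V)"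
proof -
  obtain n :: nat and p r where n: "0 < r" "\<forall>i<n. p i \<in> R"
      "\<forall>y\<in>X. (\<forall>i<n. norm (p i y - p i x) < r) \<longrightarrow> y \<in> U"
    using assms(1) by (rule nbhdE) (rule that)
  obtain m :: nat and q s where m: "0 < s" "\<forall>i<m. q i \<in> R"
      "\<forall>y\<in>X. (\<forall>i<m. norm (q i y - q i x) < s) \<longrightarrow> y \<in> V"
    using assms(2) by (rule nbhdE) (rule that)
  let ?p = "append_fun n p q"
  have "y \<in> U \<inter> V" if y: "y \<in> X" "\<forall>i<n+m. norm (?p i y - ?p i x) < min r s" for y
  proof
    have "norm (p i y - p i x) < r" if "i < n" for i
      using y(2)[rule_format, of i] that by (simp add: append_fun_less)
    then show "y \<in> U" using n(3) y by blast
    have "norm (q i y - q i x) < s" if "i < m" for i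
      using y(2)[rule_format, of "n + i"] that by (simp add: append_fun_add)
    then show "y \<in> V" using m(3) y by blast
  qed
  then show ?thesis
    using n m by (intro nbhdI[of "min r s" "n + m" ?p] append_fun_in) auto
qed

lemma nbhd_ball:
  fixes k :: nat
  assumes "\<And>i. i < k \<Longrightarrow> nbhd X R x (U i)"
  shows "nbhd X R x {y. \<forall>i<k. y \<in> U i}"
  using assms
proof (induction k)
  case (Suc k)
  then have "nbhd X R x ({y. \<forall>i<k. y \<in> U i} \<inter> U k)" by (intro nbhd_Int) auto
  then show ?case by (rule nbhd_mono) (auto simp: less_Suc_eq)
qed (auto intro: nbhd_UNIV)

lemma nbhd_generator:
  assumes "q \<in> R" "0 < e"
  shows "nbhd X R x {y. norm (q y - q x) < e}"
  by (rule nbhdI[of e 1 "\<lambda>_. q"]) (use assms in auto)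

text \<open>The entries with indices from \<open>n\<close> on are normalised to \<open>0\<close>: only the first \<open>n\<close> entries matter near
  a point of holomorphy.\<close>

definition tuple :: "nat \<Rightarrow> (nat \<Rightarrow> 'x \<Rightarrow> complex) \<Rightarrow> 'x \<Rightarrow> nat \<Rightarrow> complex" where
  "tuple n p y = (\<lambda>i. if i < n then p i y else 0)"

text \<open>The neighbourhood on which \<open>f\<close> is represented may be cut out by other functions than the variables
  of the representation. This makes the notion easy to localise.\<close>

definition holomorphic_at :: "'x set \<Rightarrow> ('x \<Rightarrow> complex) set \<Rightarrow> 'x \<Rightarrow> ('x \<Rightarrow> complex) \<Rightarrow> bool" where
  "holomorphic_at X R x f \<longleftrightarrow> (\<exists>n p F. (\<forall>i<n. p i \<in> R) \<and> holomorphic_near n (tuple n p x) F \<and>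
     nbhd X R x {y. f y = F (tuple n p y)})"

lemma holomorphic_atI:
  assumes "\<And>i. i < n \<Longrightarrow> p i \<in> R" "holomorphic_near n (tuple n p x) F"
    "nbhd X R x {y. f y = F (tuple n p y)}"
  shows "holomorphic_at X R x f"
  unfolding holomorphic_at_def
  by (rule exI[of _ n], rule exI[of _ p], rule exI[of _ F]) (use assms in blast)

lemma holomorphic_atE:
  assumes "holomorphic_at X R x f"
  obtains n p F where "\<forall>i<n. p i \<in> R" "holomorphic_near n (tuple n p x) F"
    "nbhd X R x {y. f y = F (tuple n p y)}"
  using assms unfolding holomorphic_at_def by (elim exE conjE) (rule that)

lemma holomorphic_near_center:
  assumes "holomorphic_near n a F" "\<And>i. i < n \<Longrightarrow> a i = b i"
  shows "holomorphic_near n b F"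
  using assms unfolding holomorphic_near_iff power_series_bound_def polydisc_def mpower_def
  by (simp cong: conj_cong)

lemma holomorphic_near_local:
  assumes "holomorphic_near n a F"
  obtains r where "0 < r" "\<And>w v. w \<in> polydisc n a r \<Longrightarrow> (\<And>i. i < n \<Longrightarrow> w i = v i) \<Longrightarrow> F w = F v"
proof -
  obtain r B where "power_series_bound n a r B F" using assms holomorphic_near_iff by blast
  then obtain c where c: "0 < r"
    "\<And>w. w \<in> polydisc n a r \<Longrightarrow> ((\<lambda>\<alpha>. c \<alpha> * mpower n a w \<alpha>) has_sum F w) (multi_indices n)"
    unfolding power_series_bound_def by blast
  show thesis
  proof (rule that[OF c(1)])
    fix w v assume w: "w \<in> polydisc n a r" and eq: "\<And>i. i < n \<Longrightarrow> w i = v i"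
    have "v \<in> polydisc n a r" "mpower n a v = mpower n a w"
      using w eq by (auto simp: polydisc_def mpower_def)
    then have "((\<lambda>\<alpha>. c \<alpha> * mpower n a w \<alpha>) has_sum F v) (multi_indices n)" using c(2)[of v] by simp
    with c(2)[OF w] show "F w = F v" by (rule has_sum_unique)
  qed
qed

lemma holomorphic_near_reindex:
  assumes "holomorphic_near n (\<lambda>j. if j < n then b (e j) else 0) F" "\<And>j. j < n \<Longrightarrow> e j < m"
  shows "holomorphic_near m b (\<lambda>w. F (\<lambda>j. if j < n then w (e j) else 0))"
  by (rule holomorphic_near_compose[where G = "\<lambda>j w. if j < n then w (e j) else 0" and n = n and F = F])
    (use assms in \<open>auto intro: holomorphic_near_coordinate\<close>)

text \<open>The functions that cut out the neighbourhood can be adjoined to the variables of the representation,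
  as variables on which it does not depend.\<close>

lemma holomorphic_fun_iff: "holomorphic_fun X R f \<longleftrightarrow> (\<forall>x\<in>X. holomorphic_at X R x f)"
proof
  assume f: "holomorphic_fun X R f"
  show "\<forall>x\<in>X. holomorphic_at X R x f"
  proof
    fix x assume "x \<in> X"
    obtain n p F r where n: "\<forall>i<n. p i \<in> R" "holomorphic_near n (\<lambda>i. p i x) F" "0 < r"
      "\<forall>y\<in>X. (\<forall>i<n. norm (p i y - p i x) < r) \<longrightarrow> f y = F (\<lambda>i. p i y)"
      using bspec[OF f[unfolded holomorphic_fun_def] \<open>x \<in> X\<close>] by (elim exE conjE) (rule that)
    obtain s where s: "0 < s" "\<And>w v. w \<in> polydisc n (\<lambda>i. p i x) s \<Longrightarrow> (\<And>i. i < n \<Longrightarrow> w i = v i) \<Longrightarrow> F w = F v"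
      using holomorphic_near_local[OF n(2)] by blast
    have "holomorphic_near n (tuple n p x) F"
      by (rule holomorphic_near_center[OF n(2)]) (simp add: tuple_def)
    moreover have "nbhd X R x {y. f y = F (tuple n p y)}"
    proof -
      have "f y = F (tuple n p y)" if "y \<in> X" "\<forall>i<n. norm (p i y - p i x) < min r s" for y
      proof -
        have "F (\<lambda>i. p i y) = F (tuple n p y)"
          by (rule s(2)) (use that in \<open>auto simp: polydisc_def tuple_def\<close>)
        then show ?thesis using n(4) that by simp
      qed
      then show ?thesis
        by (intro nbhdI[of "min r s" n p]) (use n s in auto)
    qed
    ultimately show "holomorphic_at X R x f"
      using n(1) by (intro holomorphic_atI[of n p]) auto
  qed
next
  assume f: "\<forall>x\<in>X. holomorphic_at X R x f"
  show "holomorphic_fun X R f"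
    unfolding holomorphic_fun_def
  proof
    fix x assume "x \<in> X"
    with f have "holomorphic_at X R x f" ..
    then obtain n p F where n: "\<forall>i<n. p i \<in> R" "holomorphic_near n (tuple n p x) F"
      "nbhd X R x {y. f y = F (tuple n p y)}"
      by (rule holomorphic_atE) (rule that)
    obtain m :: nat and q r where m: "0 < r" "\<forall>i<m. q i \<in> R"
        "\<forall>y\<in>X. (\<forall>i<m. norm (q i y - q i x) < r) \<longrightarrow> y \<in> {y. f y = F (tuple n p y)}"
      using n(3) by (rule nbhdE) (rule that)
    let ?p = "append_fun n p q" and ?F = "\<lambda>w. F (\<lambda>i. if i < n then w i else 0)"
    have tup: "(\<lambda>i. if i < n then ?p i y else 0) = tuple n p y" for y
      by (auto simp: tuple_def append_fun_less)
    have "holomorphic_near (n + m) (\<lambda>i. ?p i x) ?F"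
      by (rule holomorphic_near_reindex[where e = "\<lambda>j. j"], simp only: tup, rule n(2)) simp
    moreover have "f y = ?F (\<lambda>i. ?p i y)" if y: "y \<in> X" "\<forall>i<n+m. norm (?p i y - ?p i x) < r" for y
    proof -
      have "norm (q i y - q i x) < r" if "i < m" for i
        using y(2)[rule_format, of "n + i"] that by (simp add: append_fun_add)
      then show ?thesis using m(3) y(1) by (simp add: tup)
    qed
    ultimately show "\<exists>n p F. (\<forall>i<n. p i \<in> R) \<and> holomorphic_near n (\<lambda>i. p i x) F \<and>
        (\<exists>r>0. \<forall>y\<in>X. (\<forall>i<n. norm (p i y - p i x) < r) \<longrightarrow> f y = F (\<lambda>i. p i y))"
      using n(1) m(1,2) by (intro exI[of _ "n + m"] exI[of _ ?p] exI[of _ ?F] conjI allI impI append_fun_in exI[of _ r]) auto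
  qed
qed

text \<open>Representations in different variables are brought to the same variables by concatenation.\<close>

lemma holomorphic_at_common_variables:
  fixes k :: nat
  assumes "\<And>i. i < k \<Longrightarrow> holomorphic_at X R x (f i)"
  shows "\<exists>n p Fs. (\<forall>j<n. p j \<in> R) \<and> (\<forall>i<k. holomorphic_near n (tuple n p x) (Fs i) \<and>
    nbhd X R x {y. f i y = Fs i (tuple n p y)})"
  using assms
proof (induction k)
  case (Suc k)
  then obtain n p Fs where n: "\<And>j. j < n \<Longrightarrow> p j \<in> R"
    "\<And>i. i < k \<Longrightarrow> holomorphic_near n (tuple n p x) (Fs i)"
    "\<And>i. i < k \<Longrightarrow> nbhd X R x {y. f i y = Fs i (tuple n p y)}"
    by (metis less_Suc_eq)
  obtain m q F where m: "\<forall>j<m. q j \<in> R" "holomorphic_near m (tuple m q x) F"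
    "nbhd X R x {y. f k y = F (tuple m q y)}"
    using Suc.prems[OF lessI] by (rule holomorphic_atE) (rule that)
  let ?p = "append_fun n p q"
  define Fs' where "Fs' i = (if i < k then (\<lambda>w. Fs i (\<lambda>j. if j < n then w j else 0))
    else (\<lambda>w. F (\<lambda>j. if j < m then w (n + j) else 0)))" for i
  have t1: "(\<lambda>j. if j < n then tuple (n + m) ?p y j else 0) = tuple n p y" for y
    by (auto simp: tuple_def append_fun_less)
  have t2: "(\<lambda>j. if j < m then tuple (n + m) ?p y (n + j) else 0) = tuple m q y" for y
    by (auto simp: tuple_def append_fun_add)
  have "holomorphic_near (n + m) (tuple (n + m) ?p x) (Fs' i)" if "i < Suc k" for i
  proof (cases "i < k")
    case True
    have "holomorphic_near (n + m) (tuple (n + m) ?p x) (\<lambda>w. Fs i (\<lambda>j. if j < n then w j else 0))"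
      by (rule holomorphic_near_reindex[where e = "\<lambda>j. j"], simp only: t1, rule n(2)[OF True]) simp
    then show ?thesis using True by (simp add: Fs'_def)
  next
    case False
    have "holomorphic_near (n + m) (tuple (n + m) ?p x) (\<lambda>w. F (\<lambda>j. if j < m then w (n + j) else 0))"
      by (rule holomorphic_near_reindex[where e = "\<lambda>j. n + j"], simp only: t2, rule m(2)) simp
    then show ?thesis using False by (simp add: Fs'_def)
  qed
  moreover have "nbhd X R x {y. f i y = Fs' i (tuple (n + m) ?p y)}" if "i < Suc k" for i
    using n(3)[of i] m(3) that by (cases "i < k") (auto simp: Fs'_def t1 t2 less_Suc_eq)
  ultimately show ?case
    using n(1) m(1) by (intro exI[of _ "n + m"] exI[of _ ?p] exI[of _ Fs'] conjI allI impI append_fun_in) auto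
qed auto

lemma holomorphic_at_compose:
  assumes x: "x \<in> X" and F: "holomorphic_near k (tuple k f x) F"
    and f: "\<And>i. i < k \<Longrightarrow> holomorphic_at X R x (f i)"
    and g: "nbhd X R x {y. g y = F (tuple k f y)}"
  shows "holomorphic_at X R x g"
proof -
  obtain n p Fs where n: "\<forall>j<n. p j \<in> R"
    "\<And>i. i < k \<Longrightarrow> holomorphic_near n (tuple n p x) (Fs i)"
    "\<And>i. i < k \<Longrightarrow> nbhd X R x {y. f i y = Fs i (tuple n p y)}"
    using holomorphic_at_common_variables[of k X R x f, OF f] by blast
  define H where "H w = F (\<lambda>i. if i < k then Fs i w else 0)" for w
  have tx: "(\<lambda>i. if i < k then Fs i (tuple n p x) else 0) = tuple k f x"
    using nbhd_mem[OF n(3) x] by (auto simp: tuple_def)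
  have "holomorphic_near n (tuple n p x) H"
    unfolding H_def
  proof (rule holomorphic_near_compose[where G = "\<lambda>i w. if i < k then Fs i w else 0" and n = k and F = F])
    show "holomorphic_near k (\<lambda>i. if i < k then Fs i (tuple n p x) else 0) F"
      using F by (simp only: tx)
  qed (auto intro: n)
  moreover have "nbhd X R x ({y. g y = F (tuple k f y)} \<inter> {y. \<forall>i<k. y \<in> {y. f i y = Fs i (tuple n p y)}})"
    by (intro nbhd_Int g nbhd_ball n)
  then have "nbhd X R x {y. g y = H (tuple n p y)}"
  proof (rule nbhd_mono)
    fix y assume y: "y \<in> {y. g y = F (tuple k f y)} \<inter> {y. \<forall>i<k. y \<in> {y. f i y = Fs i (tuple n p y)}}"
    have "tuple k f y = (\<lambda>i. if i < k then Fs i (tuple n p y) else 0)" using y by (auto simp: tuple_def)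
    then show "y \<in> {y. g y = H (tuple n p y)}" using y by (simp add: H_def)
  qed
  ultimately show ?thesis using n(1) by (intro holomorphic_atI) auto
qed

lemma holomorphic_at_cong:
  assumes "x \<in> X" "holomorphic_at X R x f" "nbhd X R x {y. g y = f y}"
  shows "holomorphic_at X R x g"
  by (rule holomorphic_at_compose[where k = 1 and f = "\<lambda>_. f" and F = "\<lambda>w. w 0"])
    (use assms in \<open>auto simp: tuple_def intro: holomorphic_near_coordinate\<close>)

lemma holomorphic_at_cong_all:
  assumes "x \<in> X" "holomorphic_at X R x f" "\<And>y. y \<in> X \<Longrightarrow> g y = f y"
  shows "holomorphic_at X R x g"
  by (rule holomorphic_at_cong[OF assms(1,2)]) (rule nbhd_UNIV, simp add: assms(3))

lemma holomorphic_at_generator: "q \<in> R \<Longrightarrow> holomorphic_at X R x q"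
  by (rule holomorphic_atI[of 1 "\<lambda>_. q" _ _ "\<lambda>w. w 0"])
    (auto simp: tuple_def intro: holomorphic_near_coordinate nbhd_UNIV)

lemma holomorphic_at_const: "holomorphic_at X R x (\<lambda>_. c)"
  by (rule holomorphic_atI[of 0 _ _ _ "\<lambda>_. c"]) (auto intro: holomorphic_near_const nbhd_UNIV)

lemma holomorphic_at_add:
  assumes "x \<in> X" "holomorphic_at X R x f" "holomorphic_at X R x g"
  shows "holomorphic_at X R x (\<lambda>y. f y + g y)"
  by (rule holomorphic_at_compose[where k = 2 and f = "\<lambda>i. if i = 0 then f else g" and F = "\<lambda>w. w 0 + w 1"])
    (use assms in \<open>auto simp: tuple_def intro!: holomorphic_near_add holomorphic_near_coordinate nbhd_UNIV\<close>)

lemma holomorphic_at_mult: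
  assumes "x \<in> X" "holomorphic_at X R x f" "holomorphic_at X R x g"
  shows "holomorphic_at X R x (\<lambda>y. f y * g y)"
  by (rule holomorphic_at_compose[where k = 2 and f = "\<lambda>i. if i = 0 then f else g" and F = "\<lambda>w. w 0 * w 1"])
    (use assms in \<open>auto simp: tuple_def intro!: holomorphic_near_mult holomorphic_near_coordinate nbhd_UNIV\<close>)

lemma holomorphic_at_inverse:
  assumes "x \<in> X" "holomorphic_at X R x f" "f x \<noteq> 0"
  shows "holomorphic_at X R x (\<lambda>y. inverse (f y))"
  by (rule holomorphic_at_compose[where k = 1 and f = "\<lambda>_. f" and F = "\<lambda>w. inverse (w 0)"])
    (use assms in \<open>auto simp: tuple_def intro!: holomorphic_near_inverse[simplified] nbhd_UNIV\<close>)

lemma holomorphic_at_power: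
  assumes "x \<in> X" "holomorphic_at X R x f"
  shows "holomorphic_at X R x (\<lambda>y. f y ^ k)"
  by (induction k) (auto intro: holomorphic_at_const holomorphic_at_mult assms)

lemma holomorphic_at_sum:
  assumes "x \<in> X" "\<And>i. i \<in> I \<Longrightarrow> holomorphic_at X R x (f i)"
  shows "holomorphic_at X R x (\<lambda>y. \<Sum>i\<in>I. f i y)"
  using assms(2)
  by (induction I rule: infinite_finite_induct) (auto intro: holomorphic_at_const holomorphic_at_add assms(1))

lemma holomorphic_at_continuous:
  assumes x: "x \<in> X" and f: "holomorphic_at X R x f" and e: "0 < e"
  shows "nbhd X R x {y. norm (f y - f x) < e}"
proof -
  obtain n p F where n: "\<forall>i<n. p i \<in> R" "holomorphic_near n (tuple n p x) F"
      "nbhd X R x {y. f y = F (tuple n p y)}"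
    using f by (rule holomorphic_atE) (rule that)
  obtain \<rho> where \<rho>: "\<rho> > 0" "\<forall>w\<in>polydisc n (tuple n p x) \<rho>. norm (F w - F (tuple n p x)) < e"
    using holomorphic_near_continuous(1)[OF n(2) e] by blast
  have "nbhd X R x ({y. f y = F (tuple n p y)} \<inter> {y. \<forall>i<n. y \<in> {y. norm (p i y - p i x) < \<rho>}})"
    using n \<rho> by (intro nbhd_Int nbhd_ball nbhd_generator) auto
  then show ?thesis
  proof (rule nbhd_mono)
    fix y assume y: "y \<in> {y. f y = F (tuple n p y)} \<inter> {y. \<forall>i<n. y \<in> {y. norm (p i y - p i x) < \<rho>}}"
    then have "tuple n p y \<in> polydisc n (tuple n p x) \<rho>" by (auto simp: polydisc_def tuple_def)
    then show "y \<in> {y. norm (f y - f x) < e}" using y \<rho>(2) nbhd_mem[OF n(3) x] by auto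
  qed
qed

lemma holomorphic_at_pullback:
  assumes \<mu>: "\<mu> \<in> X \<rightarrow> Y" "x \<in> X" and f: "holomorphic_at Y S (\<mu> x) f"
    and S: "\<And>q. q \<in> S \<Longrightarrow> holomorphic_at X R x (\<lambda>y. q (\<mu> y))"
  shows "holomorphic_at X R x (\<lambda>y. f (\<mu> y))"
proof -
  obtain n p F where n: "\<forall>i<n. p i \<in> S" "holomorphic_near n (tuple n p (\<mu> x)) F"
      "nbhd Y S (\<mu> x) {y. f y = F (tuple n p y)}"
    using f by (rule holomorphic_atE) (rule that)
  have t: "tuple n (\<lambda>i y. p i (\<mu> y)) y = tuple n p (\<mu> y)" for y by (simp add: tuple_def)
  obtain m :: nat and q r where m: "0 < r" "\<forall>i<m. q i \<in> S"
      "\<forall>y\<in>Y. (\<forall>i<m. norm (q i y - q i (\<mu> x)) < r) \<longrightarrow> y \<in> {y. f y = F (tuple n p y)}"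
    using n(3) by (rule nbhdE) (rule that)
  have "nbhd X R x {y. \<forall>i<m. y \<in> {y. norm (q i (\<mu> y) - q i (\<mu> x)) < r}}"
    using m \<mu> S by (intro nbhd_ball holomorphic_at_continuous) auto
  then have nb: "nbhd X R x {y. f (\<mu> y) = F (tuple n p (\<mu> y))}"
    by (rule nbhd_mono) (use \<mu> m(3) in auto)
  show ?thesis
    by (rule holomorphic_at_compose[OF \<mu>(2), where k = n and f = "\<lambda>i y. p i (\<mu> y)" and F = F])
      (use n(1,2) S nb in \<open>simp_all add: t\<close>)
qed

section \<open>Asymptotic expansions at the origin\<close>

definition vanishes_to_order :: "nat \<Rightarrow> (complex \<Rightarrow> complex) \<Rightarrow> bool" where
  "vanishes_to_order N g \<longleftrightarrow> (\<exists>C d. 0 < d \<and> (\<forall>s. 0 < norm s \<and> norm s < d \<longrightarrow> norm (g s) \<le> C * norm s ^ N))"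

lemma vanishes_to_orderI:
  assumes "0 < d" "\<And>s. 0 < norm s \<Longrightarrow> norm s < d \<Longrightarrow> norm (g s) \<le> C * norm s ^ N"
  shows "vanishes_to_order N g"
  unfolding vanishes_to_order_def using assms by blast

lemma vanishes_to_orderE:
  assumes "vanishes_to_order N g"
  obtains C d where "0 \<le> C" "0 < d" "d \<le> 1"
    "\<And>s. 0 < norm s \<Longrightarrow> norm s < d \<Longrightarrow> norm (g s) \<le> C * norm s ^ N"
proof -
  obtain C d where C: "0 < d" "\<forall>s. 0 < norm s \<and> norm s < d \<longrightarrow> norm (g s) \<le> C * norm s ^ N"
    using assms unfolding vanishes_to_order_def by blast
  show thesis
  proof (rule that[of "\<bar>C\<bar>" "min d 1"])
    fix s :: complex assume "0 < norm s" "norm s < min d 1"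
    then have "norm (g s) \<le> C * norm s ^ N" using C(2) by auto
    also have "\<dots> \<le> \<bar>C\<bar> * norm s ^ N" by (intro mult_right_mono) auto
    finally show "norm (g s) \<le> \<bar>C\<bar> * norm s ^ N" .
  qed (use C in auto)
qed

lemma vanishes_to_order_add:
  assumes "vanishes_to_order N f" "vanishes_to_order N g"
  shows "vanishes_to_order N (\<lambda>s. f s + g s)"
proof -
  obtain C d where C: "0 < d" "\<And>s. 0 < norm s \<Longrightarrow> norm s < d \<Longrightarrow> norm (f s) \<le> C * norm s ^ N"
    using assms(1) by (rule vanishes_to_orderE) blast
  obtain D e where D: "0 < e" "\<And>s. 0 < norm s \<Longrightarrow> norm s < e \<Longrightarrow> norm (g s) \<le> D * norm s ^ N"
    using assms(2) by (rule vanishes_to_orderE) blast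
  show ?thesis
  proof (rule vanishes_to_orderI[of "min d e" _ "C + D"])
    fix s :: complex assume "0 < norm s" "norm s < min d e"
    then show "norm (f s + g s) \<le> (C + D) * norm s ^ N"
      using C(2)[of s] D(2)[of s] norm_triangle_ineq[of "f s" "g s"] by (simp add: distrib_right)
  qed (use C D in auto)
qed

lemma vanishes_to_order_uminus: "vanishes_to_order N g \<Longrightarrow> vanishes_to_order N (\<lambda>s. - g s)"
  by (simp add: vanishes_to_order_def)

lemma vanishes_to_order_diff:
  "vanishes_to_order N f \<Longrightarrow> vanishes_to_order N g \<Longrightarrow> vanishes_to_order N (\<lambda>s. f s - g s)"
  using vanishes_to_order_add[of N f "\<lambda>s. - g s"] vanishes_to_order_uminus[of N g] by simp

lemma vanishes_to_order_mult:
  assumes "vanishes_to_order N f" "vanishes_to_order M g"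
  shows "vanishes_to_order (N + M) (\<lambda>s. f s * g s)"
proof -
  obtain C d where C: "0 \<le> C" "0 < d" "\<And>s. 0 < norm s \<Longrightarrow> norm s < d \<Longrightarrow> norm (f s) \<le> C * norm s ^ N"
    using assms(1) by (rule vanishes_to_orderE) blast
  obtain D e where D: "0 \<le> D" "0 < e" "\<And>s. 0 < norm s \<Longrightarrow> norm s < e \<Longrightarrow> norm (g s) \<le> D * norm s ^ M"
    using assms(2) by (rule vanishes_to_orderE) blast
  show ?thesis
  proof (rule vanishes_to_orderI[of "min d e" _ "C * D"])
    fix s :: complex assume "0 < norm s" "norm s < min d e"
    then have "norm (f s) * norm (g s) \<le> (C * norm s ^ N) * (D * norm s ^ M)"
      using C D by (intro mult_mono) auto
    then show "norm (f s * g s) \<le> C * D * norm s ^ (N + M)"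
      by (simp add: norm_mult power_add mult_ac)
  qed (use C D in auto)
qed

lemma vanishes_to_order_mono:
  assumes "vanishes_to_order N g" "M \<le> N"
  shows "vanishes_to_order M g"
proof -
  obtain C d where C: "0 \<le> C" "0 < d" "d \<le> 1" "\<And>s. 0 < norm s \<Longrightarrow> norm s < d \<Longrightarrow> norm (g s) \<le> C * norm s ^ N"
    using assms(1) by (rule vanishes_to_orderE) blast
  show ?thesis
  proof (rule vanishes_to_orderI[OF C(2), of _ C])
    fix s :: complex assume s: "0 < norm s" "norm s < d"
    have "norm s ^ N \<le> norm s ^ M" using s C(3) assms(2) by (intro power_decreasing) auto
    then show "norm (g s) \<le> C * norm s ^ M"
      using C(4)[OF s] mult_left_mono[of "norm s ^ N" "norm s ^ M" C] C(1) by linarith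
  qed
qed

lemma vanishes_to_order_tendsto:
  assumes "vanishes_to_order (Suc N) g"
  shows "((\<lambda>s. g s / s ^ N) \<longlongrightarrow> 0) (at 0)"
proof -
  obtain C d where C: "0 < d" "\<And>s. 0 < norm s \<Longrightarrow> norm s < d \<Longrightarrow> norm (g s) \<le> C * norm s ^ Suc N"
    using assms by (rule vanishes_to_orderE) blast
  have "((\<lambda>s::complex. C * norm s) \<longlongrightarrow> C * norm (0::complex)) (at 0)" by (intro tendsto_intros)
  then have "((\<lambda>s::complex. C * norm s) \<longlongrightarrow> 0) (at 0)" by simp
  then show ?thesis
  proof (rule Lim_null_comparison[rotated])
    show "\<forall>\<^sub>F s in at 0. norm (g s / s ^ N) \<le> C * norm s"
      unfolding eventually_at
    proof (intro exI[of _ d] conjI ballI impI C(1))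
      fix s :: complex assume "s \<noteq> 0 \<and> dist s 0 < d"
      then show "norm (g s / s ^ N) \<le> C * norm s"
        using C(2)[of s] by (simp add: norm_divide norm_power divide_le_eq mult_ac)
    qed
  qed
qed

lemma vanishes_to_order_const: "vanishes_to_order 1 (\<lambda>_. c) \<Longrightarrow> c = 0"
  using vanishes_to_order_tendsto[of 0 "\<lambda>_. c"] tendsto_unique[OF _ tendsto_const, of "at (0::complex)" c 0]
  by simp

lemma vanishes_to_order_poly_bounded: "vanishes_to_order 0 (poly p)"
proof -
  have "continuous_on (cball 0 1) (poly p)" by (intro continuous_intros)
  then have "bounded (poly p ` cball 0 1)"
    using compact_continuous_image compact_imp_bounded compact_cball by blast
  then obtain C where C: "\<forall>x\<in>cball 0 1. norm (poly p x) \<le> C" unfolding bounded_iff by auto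
  show ?thesis by (rule vanishes_to_orderI[of 1 _ C]) (use C in auto)
qed

lemma vanishes_to_order_monom: "vanishes_to_order N (\<lambda>s. s ^ N)"
  by (rule vanishes_to_orderI[of 1 _ 1]) (auto simp: norm_power)

lemma vanishes_to_order_poly_iff: "vanishes_to_order N (poly p) \<longleftrightarrow> (\<forall>k<N. coeff p k = 0)"
proof
  assume "\<forall>k<N. coeff p k = 0"
  then have "monom 1 N dvd p" by (simp add: monom_1_dvd_iff')
  then obtain q where "p = monom 1 N * q" by (elim dvdE)
  then have "poly p = (\<lambda>s. s ^ N * poly q s)" by (auto simp: poly_monom)
  then show "vanishes_to_order N (poly p)"
    using vanishes_to_order_mult[OF vanishes_to_order_monom[of N] vanishes_to_order_poly_bounded[of q]] by simp
next
  assume van: "vanishes_to_order N (poly p)"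
  show "\<forall>k<N. coeff p k = 0"
  proof (intro allI impI)
    fix k assume "k < N"
    then show "coeff p k = 0"
    proof (induction k rule: less_induct)
      case (less k)
      then have "monom 1 k dvd p" by (simp add: monom_1_dvd_iff')
      then obtain q where q: "p = monom 1 k * q" by (elim dvdE)
      have "((\<lambda>s. poly p s / s ^ k) \<longlongrightarrow> 0) (at 0)"
        by (rule vanishes_to_order_tendsto[OF vanishes_to_order_mono[OF van]]) (use less.prems in simp)
      moreover have "\<forall>\<^sub>F s in at 0. poly p s / s ^ k = poly q s"
        unfolding eventually_at by (rule exI[of _ 1]) (simp add: q poly_monom)
      ultimately have "(poly q \<longlongrightarrow> 0) (at 0)" by (rule Lim_transform_eventually)
      moreover have "(poly q \<longlongrightarrow> poly q 0) (at 0)" using poly_isCont[where p = q and x = 0] by (simp add: isCont_def)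
      ultimately have "0 = poly q 0" by (intro tendsto_unique[OF trivial_limit_at])
      then show ?case by (simp add: q coeff_monom_mult poly_0_coeff_0)
    qed
  qed
qed

text \<open>The asymptotic expansion of \<open>g\<close> at the origin by a power series, possibly a divergent one, with
  coefficients \<open>c\<close>.\<close>

definition expands :: "(complex \<Rightarrow> complex) \<Rightarrow> (nat \<Rightarrow> complex) \<Rightarrow> bool" where
  "expands g c \<longleftrightarrow> (\<forall>N. \<exists>p. (\<forall>k<N. coeff p k = c k) \<and> vanishes_to_order N (\<lambda>s. g s - poly p s))"

lemma expandsE:
  assumes "expands g c"
  obtains p where "\<And>k. k < N \<Longrightarrow> coeff p k = c k" "vanishes_to_order N (\<lambda>s. g s - poly p s)"
  using assms unfolding expands_def by blast

lemma expands_poly: "expands (poly p) (coeff p)"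
  unfolding expands_def by (auto intro!: exI[of _ p] vanishes_to_orderI[of 1 _ 0])

lemma expands_unique_below:
  assumes "expands f b" "expands g c" "vanishes_to_order N (\<lambda>s. f s - g s)" "k < N"
  shows "b k = c k"
proof -
  obtain p where p: "\<And>k. k < N \<Longrightarrow> coeff p k = b k" "vanishes_to_order N (\<lambda>s. f s - poly p s)"
    using assms(1) by (rule expandsE) blast
  obtain q where q: "\<And>k. k < N \<Longrightarrow> coeff q k = c k" "vanishes_to_order N (\<lambda>s. g s - poly q s)"
    using assms(2) by (rule expandsE) blast
  have "vanishes_to_order N (\<lambda>s. (f s - g s) + (g s - poly q s) - (f s - poly p s))"
    by (rule vanishes_to_order_diff[OF vanishes_to_order_add[OF assms(3) q(2)] p(2)])
  moreover have "poly (p - q) = (\<lambda>s. (f s - g s) + (g s - poly q s) - (f s - poly p s))" by auto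
  ultimately have "vanishes_to_order N (poly (p - q))" by simp
  then have "coeff (p - q) k = 0" unfolding vanishes_to_order_poly_iff using assms(4) by blast
  then show ?thesis using p(1) q(1) assms(4) by simp
qed

lemma expands_unique: "expands g b \<Longrightarrow> expands g c \<Longrightarrow> b = c"
  by (rule ext, rule expands_unique_below[of g b g c "Suc _"]) (auto intro: vanishes_to_orderI[of 1 _ 0])

lemma expands_add:
  assumes "expands f b" "expands g c"
  shows "expands (\<lambda>s. f s + g s) (\<lambda>k. b k + c k)"
  unfolding expands_def
proof
  fix N
  obtain p where p: "\<And>k. k < N \<Longrightarrow> coeff p k = b k" "vanishes_to_order N (\<lambda>s. f s - poly p s)"
    using assms(1) by (rule expandsE) blast
  obtain q where q: "\<And>k. k < N \<Longrightarrow> coeff q k = c k" "vanishes_to_order N (\<lambda>s. g s - poly q s)"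
    using assms(2) by (rule expandsE) blast
  show "\<exists>r. (\<forall>k<N. coeff r k = b k + c k) \<and> vanishes_to_order N (\<lambda>s. f s + g s - poly r s)"
    using vanishes_to_order_add[OF p(2) q(2)] p(1) q(1)
    by (intro exI[of _ "p + q"]) (simp add: algebra_simps)
qed

lemma expands_mult:
  assumes "expands f b" "expands g c"
  shows "expands (\<lambda>s. f s * g s) (\<lambda>k. \<Sum>i\<le>k. b i * c (k - i))"
  unfolding expands_def
proof
  fix N
  obtain p where p: "\<And>k. k < N \<Longrightarrow> coeff p k = b k" "vanishes_to_order N (\<lambda>s. f s - poly p s)"
    using assms(1) by (rule expandsE) blast
  obtain q where q: "\<And>k. k < N \<Longrightarrow> coeff q k = c k" "vanishes_to_order N (\<lambda>s. g s - poly q s)"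
    using assms(2) by (rule expandsE) blast
  have "vanishes_to_order 0 (\<lambda>s. (g s - poly q s) + poly q s)"
    using vanishes_to_order_mono[OF q(2)] vanishes_to_order_poly_bounded by (intro vanishes_to_order_add) auto
  then have "vanishes_to_order 0 g" by simp
  from vanishes_to_order_add[OF vanishes_to_order_mult[OF p(2) this, unfolded add_0_right]
      vanishes_to_order_mult[OF vanishes_to_order_poly_bounded[of p] q(2), unfolded add_0]]
  have "vanishes_to_order N (\<lambda>s. f s * g s - poly (p * q) s)"
    by (simp add: algebra_simps)
  moreover have "coeff (p * q) k = (\<Sum>i\<le>k. b i * c (k - i))" if "k < N" for k
    unfolding coeff_mult by (rule sum.cong) (use p(1) q(1) that in auto)
  ultimately show "\<exists>r. (\<forall>k<N. coeff r k = (\<Sum>i\<le>k. b i * c (k - i))) \<and>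
      vanishes_to_order N (\<lambda>s. f s * g s - poly r s)"
    by blast
qed

lemma expands_limit:
  assumes "expands g c" "\<And>k. k < d \<Longrightarrow> c k = 0"
  shows "((\<lambda>s. g s / s ^ d) \<longlongrightarrow> c d) (at 0)"
proof -
  obtain p where p: "\<And>k. k < Suc d \<Longrightarrow> coeff p k = c k" "vanishes_to_order (Suc d) (\<lambda>s. g s - poly p s)"
    using assms(1) by (rule expandsE) blast
  have "monom 1 d dvd p" using p(1) assms(2) by (simp add: monom_1_dvd_iff')
  then obtain q where q: "p = monom 1 d * q" by (elim dvdE)
  have "(poly q \<longlongrightarrow> poly q 0) (at 0)" using poly_isCont[where p = q and x = 0] by (simp add: isCont_def)
  moreover have "poly q 0 = c d" using p(1)[of d] by (simp add: q coeff_monom_mult poly_0_coeff_0)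
  ultimately have "(poly q \<longlongrightarrow> c d) (at 0)" by simp
  from tendsto_add[OF vanishes_to_order_tendsto[OF p(2)] this]
  have "((\<lambda>s. (g s - poly p s) / s ^ d + poly q s) \<longlongrightarrow> c d) (at 0)" by simp
  moreover have "\<forall>\<^sub>F s in at 0. (g s - poly p s) / s ^ d + poly q s = g s / s ^ d"
    unfolding eventually_at
    by (rule exI[of _ 1]) (simp add: q poly_monom diff_divide_distrib)
  ultimately show ?thesis by (rule Lim_transform_eventually)
qed

lemma finite_multi_indices: "finite {\<alpha> \<in> multi_indices n. mdegree n \<alpha> < N}"
proof (rule finite_subset)
  show "{\<alpha> \<in> multi_indices n. mdegree n \<alpha> < N} \<subseteq> {f. \<forall>x. (x \<in> {..<n} \<longrightarrow> f x \<in> {..<N}) \<and> (x \<notin> {..<n} \<longrightarrow> f x = 0)}"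
  proof
    fix \<alpha> assume \<alpha>: "\<alpha> \<in> {\<alpha> \<in> multi_indices n. mdegree n \<alpha> < N}"
    have "\<alpha> x \<le> mdegree n \<alpha>" if "x < n" for x
      unfolding mdegree_def using that by (intro member_le_sum) auto
    then show "\<alpha> \<in> {f. \<forall>x. (x \<in> {..<n} \<longrightarrow> f x \<in> {..<N}) \<and> (x \<notin> {..<n} \<longrightarrow> f x = 0)}"
      using \<alpha> by (auto simp: multi_indices_def intro: le_less_trans)
  qed
  show "finite {f. \<forall>x. (x \<in> {..<n} \<longrightarrow> f x \<in> {..<N}) \<and> (x \<notin> {..<n} \<longrightarrow> f x = (0::nat))}"
    by (rule finite_set_of_finite_funs) auto
qed

text \<open>A monomial of degree at least \<open>N\<close> gains at least \<open>(\<delta> / r) ^ N\<close> when the radius shrinks from \<open>r\<close> to \<open>\<delta>\<close>.\<close>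

lemma power_series_remainder:
  assumes "power_series_bound n a r B F"
  obtains c where "\<And>N w \<delta>. 0 \<le> \<delta> \<Longrightarrow> \<delta> < r \<Longrightarrow> (\<And>i. i < n \<Longrightarrow> norm (w i - a i) \<le> \<delta>) \<Longrightarrow>
    norm (F w - (\<Sum>\<alpha> | \<alpha> \<in> multi_indices n \<and> mdegree n \<alpha> < N. c \<alpha> * mpower n a w \<alpha>)) \<le> B * (\<delta> / r) ^ N"
proof -
  let ?M = "multi_indices n"
  obtain c B' where c: "((\<lambda>\<beta>. norm (c \<beta>) * r ^ mdegree n \<beta>) has_sum B') ?M" "B' \<le> B"
    "\<And>w. w \<in> polydisc n a r \<Longrightarrow> ((\<lambda>\<beta>. c \<beta> * mpower n a w \<beta>) has_sum F w) ?M" and r: "0 < r"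
    using assms(1) unfolding power_series_bound_def by blast
  show thesis
  proof (rule that)
    fix N w \<delta> assume \<delta>: "0 \<le> \<delta>" "\<delta> < r" and w: "\<And>i. i < n \<Longrightarrow> norm (w i - a i) \<le> \<delta>"
    let ?L = "{\<alpha>. \<alpha> \<in> ?M \<and> mdegree n \<alpha> < N}"
    have disc: "w \<in> polydisc n a r" using w \<delta> by (auto simp: polydisc_def intro: le_less_trans)
    have "((\<lambda>\<beta>. c \<beta> * mpower n a w \<beta>) has_sum (\<Sum>\<alpha>\<in>?L. c \<alpha> * mpower n a w \<alpha>)) ?L"
      by (rule has_sum_finite) (use finite_multi_indices[of n N] in simp)
    then have diff: "((\<lambda>\<beta>. c \<beta> * mpower n a w \<beta>) has_sum (F w - (\<Sum>\<alpha>\<in>?L. c \<alpha> * mpower n a w \<alpha>))) (?M - ?L)"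
      by (intro has_sum_Diff[OF c(3)[OF disc]]) auto
    have s1: "(\<lambda>\<beta>. norm (c \<beta>) * r ^ mdegree n \<beta> * (\<delta> / r) ^ N) summable_on ?M"
      using has_sum_cmult_left[OF c(1)] has_sum_imp_summable by blast
    then have s2: "(\<lambda>\<beta>. norm (c \<beta>) * r ^ mdegree n \<beta> * (\<delta> / r) ^ N) summable_on (?M - ?L)"
      by (rule summable_on_subset_banach) auto
    have "norm (F w - (\<Sum>\<alpha>\<in>?L. c \<alpha> * mpower n a w \<alpha>)) \<le>
        infsum (\<lambda>\<beta>. norm (c \<beta>) * r ^ mdegree n \<beta> * (\<delta> / r) ^ N) (?M - ?L)"
    proof (rule norm_infsum_le[OF diff has_sum_infsum[OF s2]])
      fix \<beta> assume "\<beta> \<in> ?M - ?L"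
      then have N: "N \<le> mdegree n \<beta>" by auto
      have "norm (mpower n a w \<beta>) = (\<Prod>i<n. norm (w i - a i) ^ \<beta> i)"
        by (simp add: mpower_def prod_norm[symmetric] norm_power)
      also have "\<dots> \<le> (\<Prod>i<n. \<delta> ^ \<beta> i)" using w by (intro prod_mono) (auto intro!: power_mono)
      also have "\<dots> = \<delta> ^ mdegree n \<beta>" by (simp add: mdegree_def power_sum)
      also have "\<dots> = r ^ mdegree n \<beta> * (\<delta> / r) ^ mdegree n \<beta>" using r by (simp add: power_divide)
      also have "\<dots> \<le> r ^ mdegree n \<beta> * (\<delta> / r) ^ N"
        using r \<delta> N by (intro mult_left_mono power_decreasing) auto
      finally show "norm (c \<beta> * mpower n a w \<beta>) \<le> norm (c \<beta>) * r ^ mdegree n \<beta> * (\<delta> / r) ^ N"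
        by (simp add: norm_mult mult.assoc mult_left_mono)
    qed
    also have "\<dots> \<le> infsum (\<lambda>\<beta>. norm (c \<beta>) * r ^ mdegree n \<beta> * (\<delta> / r) ^ N) ?M"
      by (rule infsum_mono2[OF s2 s1]) (use r \<delta> in auto)
    also have "\<dots> = B' * (\<delta> / r) ^ N" using has_sum_cmult_left[OF c(1)] by (rule infsumI)
    also have "\<dots> \<le> B * (\<delta> / r) ^ N" using c(2) r \<delta> by (intro mult_right_mono) auto
    finally show "norm (F w - (\<Sum>\<alpha>\<in>?L. c \<alpha> * mpower n a w \<alpha>)) \<le> B * (\<delta> / r) ^ N" .
  qed
qed

section \<open>The scaling action on the affine variety and jets of holomorphic maps\<close>

context graded_algebra
begin

abbreviation "Z \<equiv> affine_points A"

abbreviation coordinates :: "((('v \<Rightarrow> complex) \<Rightarrow> complex) \<Rightarrow> complex) set" where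
  "coordinates \<equiv> {\<lambda>z. z h | h. h \<in> A}"

lemma point_const: "z \<in> Z \<Longrightarrow> z (\<lambda>_. c) = c"
  and point_add: "z \<in> Z \<Longrightarrow> f \<in> A \<Longrightarrow> h \<in> A \<Longrightarrow> z (f + h) = z f + z h"
  and point_mult: "z \<in> Z \<Longrightarrow> f \<in> A \<Longrightarrow> h \<in> A \<Longrightarrow> z (f * h) = z f * z h"
  and point_extensional: "z \<in> Z \<Longrightarrow> z \<in> extensional A"
  by (auto simp: affine_points_def)

lemma point_zero: "z \<in> Z \<Longrightarrow> z 0 = 0"
  using point_const[of z 0] by (simp add: zero_fun_def)

lemma point_diff: "z \<in> Z \<Longrightarrow> f \<in> A \<Longrightarrow> h \<in> A \<Longrightarrow> z (f - h) = z f - z h"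
  using point_add[of z "f - h" h] diff_mem[of f h] by simp

lemma point_sum: "z \<in> Z \<Longrightarrow> (\<And>i. i \<in> I \<Longrightarrow> f i \<in> A) \<Longrightarrow> z (\<Sum>i\<in>I. f i) = (\<Sum>i\<in>I. z (f i))"
  by (induction I rule: infinite_finite_induct) (auto simp: point_zero point_add sum_mem)

lemma point_one: "z \<in> Z \<Longrightarrow> z 1 = 1"
  using point_const[of z 1] by (simp add: one_fun_def)

lemma point_power: "z \<in> Z \<Longrightarrow> f \<in> A \<Longrightarrow> z (f ^ k) = z f ^ k"
  by (induction k) (auto simp: point_one point_mult power_mem)

lemma point_prod: "z \<in> Z \<Longrightarrow> (\<And>i. i \<in> I \<Longrightarrow> f i \<in> A) \<Longrightarrow> z (\<Prod>i\<in>I. f i) = (\<Prod>i\<in>I. z (f i))"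
  by (induction I rule: infinite_finite_induct) (auto simp: point_one point_mult prod_mem)

lemma point_eqI: "y \<in> Z \<Longrightarrow> z \<in> Z \<Longrightarrow> (\<And>f. f \<in> A \<Longrightarrow> y f = z f) \<Longrightarrow> y = z"
  using point_extensional extensionalityI by blast

lemma affine_pointsI:
  assumes "\<And>c. z (\<lambda>_. c) = c" "\<And>f h. f \<in> A \<Longrightarrow> h \<in> A \<Longrightarrow> z (f + h) = z f + z h"
    "\<And>f h. f \<in> A \<Longrightarrow> h \<in> A \<Longrightarrow> z (f * h) = z f * z h"
  shows "restrict z A \<in> Z"
  using assms by (simp add: affine_points_def const_mem add_mem mult_mem)

text \<open>The image of \<open>v\<close> under the morphism to the affine variety of \<open>A\<close>.\<close>

definition eval_point :: "'v \<Rightarrow> ('v \<Rightarrow> complex) \<Rightarrow> complex" where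
  "eval_point v = restrict (\<lambda>f. f v) A"

lemma eval_point_in: "eval_point v \<in> Z"
  unfolding eval_point_def by (rule affine_pointsI) (auto simp: fun_apply)

lemma eval_point_apply: "f \<in> A \<Longrightarrow> eval_point v f = f v"
  by (simp add: eval_point_def)

text \<open>The function \<open>s \<mapsto> f (s \<cdot> z)\<close> for the action of the multiplicative monoid of complex numbers on
  the variety that is given by the grading.\<close>

definition orbit_poly :: "(('v \<Rightarrow> complex) \<Rightarrow> complex) \<Rightarrow> ('v \<Rightarrow> complex) \<Rightarrow> complex poly" where
  "orbit_poly z f = Abs_poly (\<lambda>d. z (hc d f))"

lemma coeff_orbit_poly:
  assumes "z \<in> Z" "f \<in> A"
  shows "coeff (orbit_poly z f) d = z (hc d f)"
proof -
  obtain D where "\<forall>d>D. hc d f = 0" using hcomp_eventually_0[OF mem_polys[OF assms(2)]] ..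
  then have "\<forall>d>D. z (hc d f) = 0" using point_zero[OF assms(1)] by simp
  then have "\<forall>\<^sub>\<infinity>d. z (hc d f) = 0" unfolding MOST_nat ..
  then show ?thesis by (simp add: orbit_poly_def Abs_poly_inverse)
qed

lemma orbit_poly_add:
  "z \<in> Z \<Longrightarrow> f \<in> A \<Longrightarrow> h \<in> A \<Longrightarrow> orbit_poly z (f + h) = orbit_poly z f + orbit_poly z h"
  by (rule poly_eqI) (simp add: coeff_orbit_poly add_mem hcomp_add mem_polys point_add hcomp_closed)

lemma orbit_poly_mult:
  "z \<in> Z \<Longrightarrow> f \<in> A \<Longrightarrow> h \<in> A \<Longrightarrow> orbit_poly z (f * h) = orbit_poly z f * orbit_poly z h"
  by (rule poly_eqI)
    (simp add: coeff_orbit_poly mult_mem hcomp_mult mem_polys point_mult hcomp_closed point_sum coeff_mult)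

lemma orbit_poly_const: "z \<in> Z \<Longrightarrow> orbit_poly z (\<lambda>_. c) = [:c:]"
  by (rule poly_eqI)
    (auto simp: coeff_orbit_poly const_mem hcomp_const point_const point_zero coeff_pCons split: nat.splits)

lemma orbit_poly_homog:
  assumes "z \<in> Z" "f \<in> homog d"
  shows "orbit_poly z f = monom (z f) d"
  by (rule poly_eqI) (use assms in \<open>auto simp: coeff_orbit_poly homog_mem hcomp_homog point_zero\<close>)

lemma poly_orbit_poly:
  assumes "z \<in> Z" "f \<in> A" "\<And>d. d > D \<Longrightarrow> hc d f = 0"
  shows "poly (orbit_poly z f) s = (\<Sum>d\<le>D. s ^ d * z (hc d f))"
proof -
  have "degree (orbit_poly z f) \<le> D"
    using assms by (intro degree_le) (simp add: coeff_orbit_poly point_zero)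
  then have "(\<Sum>d\<le>degree (orbit_poly z f). coeff (orbit_poly z f) d * s ^ d) = (\<Sum>d\<le>D. coeff (orbit_poly z f) d * s ^ d)"
    by (intro sum.mono_neutral_left) (auto simp: not_le coeff_eq_0)
  then show ?thesis using assms by (simp add: poly_altdef coeff_orbit_poly mult.commute)
qed

definition scale_point :: "complex \<Rightarrow> (('v \<Rightarrow> complex) \<Rightarrow> complex) \<Rightarrow> ('v \<Rightarrow> complex) \<Rightarrow> complex" where
  "scale_point s z = restrict (\<lambda>f. poly (orbit_poly z f) s) A"

lemma scale_point_in: "z \<in> Z \<Longrightarrow> scale_point s z \<in> Z"
  unfolding scale_point_def
  by (rule affine_pointsI) (auto simp: orbit_poly_const orbit_poly_add orbit_poly_mult)

lemma scale_point_apply: "f \<in> A \<Longrightarrow> scale_point s z f = poly (orbit_poly z f) s"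
  by (simp add: scale_point_def)

lemma scale_point_homog: "z \<in> Z \<Longrightarrow> f \<in> homog d \<Longrightarrow> scale_point s z f = s ^ d * z f"
  by (simp add: scale_point_apply homog_mem orbit_poly_homog poly_monom mult.commute)

lemma scale_point_scale_point:
  assumes "z \<in> Z"
  shows "scale_point s (scale_point t z) = scale_point (s * t) z"
proof (rule point_eqI)
  fix f assume f: "f \<in> A"
  have "orbit_poly (scale_point t z) f = pcompose (orbit_poly z f) [:0, t:]"
    using assms f scale_point_in[OF assms]
    by (intro poly_eqI) (simp add: coeff_orbit_poly coeff_pcompose_linear scale_point_homog[OF _ hcomp_mem_homog])
  then show "scale_point s (scale_point t z) f = scale_point (s * t) z f"
    using f by (simp add: scale_point_apply poly_pcompose mult.commute)
qed (use assms scale_point_in in auto)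

lemma scale_point_1:
  assumes "z \<in> Z"
  shows "scale_point 1 z = z"
proof (rule point_eqI)
  fix f assume f: "f \<in> A"
  obtain D where D: "\<And>d. d > D \<Longrightarrow> hc d f = 0" using hcomp_eventually_0 mem_polys f by metis
  have "(\<Sum>d\<le>D. z (hc d f)) = z (\<Sum>d\<le>D. hc d f)" using assms f hcomp_closed by (simp add: point_sum)
  then show "scale_point 1 z f = z f"
    using sum_hcomp[OF mem_polys[OF f] D] poly_orbit_poly[OF assms f D] f by (simp add: scale_point_apply)
qed (use assms scale_point_in in auto)

lemma scale_point_0: "z \<in> Z \<Longrightarrow> scale_point 0 z = eval_point 0"
  by (rule point_eqI)
    (auto simp: scale_point_in eval_point_in scale_point_apply eval_point_apply poly_0_coeff_0
      coeff_orbit_poly hcomp_0 mem_polys point_const)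

text \<open>The polynomial functions \<open>q N\<close> approximate \<open>g\<close> at the origin: algebraically they form a Cauchy
  sequence for the ideal powers, and analytically \<open>g\<close> and \<open>q N\<close> agree to order \<open>N\<close> along every curve
  through the origin.\<close>

definition germ :: "((('v \<Rightarrow> complex) \<Rightarrow> complex) \<Rightarrow> complex) \<Rightarrow> (nat \<Rightarrow> 'v \<Rightarrow> complex) \<Rightarrow> bool" where
  "germ g q \<longleftrightarrow> (\<forall>N. q N \<in> A \<and> max_ideal_power A 0 N (q (Suc N) - q N)) \<and>
     (\<forall>y N. (\<forall>s. y s \<in> Z) \<longrightarrow> (\<forall>h\<in>A. vanishes_to_order 1 (\<lambda>s. y s h - h 0)) \<longrightarrow>
        vanishes_to_order N (\<lambda>s. g (y s) - y s (q N)))"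

lemma monomial_max_ideal_power:
  fixes n :: nat
  assumes "\<And>i. i < n \<Longrightarrow> h i \<in> A"
  shows "max_ideal_power A 0 (mdegree n \<alpha>) (\<Prod>i<n. (h i - (\<lambda>_. h i 0)) ^ \<alpha> i)"
  using assms
proof (induction n)
  case 0
  then show ?case by (auto simp: mdegree_def intro: max_ideal_power.intros one_mem)
next
  case (Suc n)
  have "max_ideal_power A 0 k ((h n - (\<lambda>_. h n 0)) ^ k)" for k
  proof (induction k)
    case (Suc k)
    have "(h n - (\<lambda>_. h n 0)) 0 = 0" by (simp add: fun_apply)
    moreover have "h n - (\<lambda>_. h n 0) \<in> A" using \<open>\<And>i. i < Suc n \<Longrightarrow> h i \<in> A\<close> by (simp add: diff_mem const_mem)
    ultimately show ?case unfolding power_Suc using Suc.IH by (intro max_ideal_power.mult)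
  qed (auto intro: max_ideal_power.intros one_mem)
  then show ?case
    using max_ideal_power_mult_mult[OF Suc.IH, of "\<alpha> n"] Suc.prems by (simp add: mdegree_def)
qed

text \<open>The polynomial \<open>q N\<close> truncates the power series of a local representation of \<open>g\<close> in variables
  \<open>h i \<in> A\<close>, centred at \<open>h i 0\<close>. The monomials of degree \<open>N\<close> in the differences \<open>h i - h i 0\<close> lie in the
  \<open>N\<close>-th ideal power, and along a curve through the origin these differences are of order one.\<close>

lemma germ_exists:
  assumes "holomorphic_at Z coordinates (eval_point 0) g"
  shows "\<exists>q. germ g q"
proof -
  obtain n p F where n: "\<forall>i<n. p i \<in> coordinates" "holomorphic_near n (tuple n p (eval_point 0)) F"
    "nbhd Z coordinates (eval_point 0) {y. g y = F (tuple n p y)}"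
    using assms by (rule holomorphic_atE) (rule that)
  have "\<forall>i. \<exists>h. i < n \<longrightarrow> h \<in> A \<and> p i = (\<lambda>z. z h)" using n(1) by blast
  then obtain h where h: "\<And>i. i < n \<Longrightarrow> h i \<in> A" "\<And>i. i < n \<Longrightarrow> p i = (\<lambda>z. z (h i))" by metis
  let ?a = "tuple n p (eval_point 0)"
  have a: "?a i = h i 0" if "i < n" for i using h that by (simp add: tuple_def eval_point_apply)
  obtain r B where F: "power_series_bound n ?a r B F" using n(2) unfolding holomorphic_near_iff by blast
  have r: "0 < r" using F by (simp add: power_series_bound_def)
  obtain c where c: "\<And>N w \<delta>. 0 \<le> \<delta> \<Longrightarrow> \<delta> < r \<Longrightarrow> (\<And>i. i < n \<Longrightarrow> norm (w i - ?a i) \<le> \<delta>) \<Longrightarrow>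
    norm (F w - (\<Sum>\<alpha> | \<alpha> \<in> multi_indices n \<and> mdegree n \<alpha> < N. c \<alpha> * mpower n ?a w \<alpha>)) \<le> B * (\<delta> / r) ^ N"
    using power_series_remainder[OF F] by blast
  let ?L = "\<lambda>N. {\<alpha>. \<alpha> \<in> multi_indices n \<and> mdegree n \<alpha> < N}"
  let ?m = "\<lambda>\<alpha>. \<Prod>i<n. (h i - (\<lambda>_. h i 0)) ^ \<alpha> i"
  have mA: "?m \<alpha> \<in> A" for \<alpha>
    using h by (intro prod_mem power_mem diff_mem const_mem) auto
  define q where "q N = (\<Sum>\<alpha>\<in>?L N. (\<lambda>_. c \<alpha>) * ?m \<alpha>)" for N
  have qA: "q N \<in> A" for N
    unfolding q_def using mA by (intro sum_mem mult_mem const_mem)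
  have "max_ideal_power A 0 N (q (Suc N) - q N)" for N
  proof -
    have "q (Suc N) = (\<Sum>\<alpha>\<in>?L (Suc N) - ?L N. (\<lambda>_. c \<alpha>) * ?m \<alpha>) + q N"
      unfolding q_def using finite_multi_indices[of n "Suc N"] by (intro sum.subset_diff) auto
    then have "q (Suc N) - q N = (\<Sum>\<alpha>\<in>?L (Suc N) - ?L N. (\<lambda>_. c \<alpha>) * ?m \<alpha>)" by simp
    moreover have "max_ideal_power A 0 N ((\<lambda>_. c \<alpha>) * ?m \<alpha>)" if "\<alpha> \<in> ?L (Suc N) - ?L N" for \<alpha>
    proof -
      have "mdegree n \<alpha> = N" using that by auto
      then show ?thesis
        using monomial_max_ideal_power[of n h \<alpha>, OF h(1)] by (intro max_ideal_power_mult const_mem) simp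
    qed
    ultimately show ?thesis by (simp only: max_ideal_power_sum)
  qed
  moreover have "vanishes_to_order N (\<lambda>s. g (y s) - y s (q N))"
    if y: "\<And>s. y s \<in> Z" "\<And>h. h \<in> A \<Longrightarrow> vanishes_to_order 1 (\<lambda>s. y s h - h 0)" for y N
  proof -
    have small: "\<exists>K d. 0 \<le> K \<and> 0 < d \<and> (\<forall>s. 0 < norm s \<and> norm s < d \<longrightarrow>
        (\<forall>i<m. norm (y s (f i) - f i 0) \<le> K * norm s))"
      if "\<And>i. i < m \<Longrightarrow> f i \<in> A" for m :: nat and f
      using that
    proof (induction m)
      case 0
      show ?case by (intro exI[of _ 0] exI[of _ 1]) simp
    next
      case (Suc m)
      then obtain K d where K: "0 \<le> K" "0 < d"
        "\<And>s i. 0 < norm s \<Longrightarrow> norm s < d \<Longrightarrow> i < m \<Longrightarrow> norm (y s (f i) - f i 0) \<le> K * norm s"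
        by (metis less_SucI)
      have "vanishes_to_order 1 (\<lambda>s. y s (f m) - f m 0)" using y(2) Suc.prems by simp
      then obtain C e where C: "0 \<le> C" "0 < e"
        "\<And>s. 0 < norm s \<Longrightarrow> norm s < e \<Longrightarrow> norm (y s (f m) - f m 0) \<le> C * norm s ^ 1"
        by (rule vanishes_to_orderE) blast
      have "norm (y s (f i) - f i 0) \<le> max K C * norm s" if s: "0 < norm s" "norm s < min d e" "i < Suc m" for s i
      proof (cases "i < m")
        case True
        then have "norm (y s (f i) - f i 0) \<le> K * norm s" using K s by simp
        also have "\<dots> \<le> max K C * norm s" by (intro mult_right_mono) auto
        finally show ?thesis .
      next
        case False
        then have "norm (y s (f i) - f i 0) \<le> C * norm s" using C(3)[of s] s by (simp add: less_Suc_eq)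
        also have "\<dots> \<le> max K C * norm s" by (intro mult_right_mono) auto
        finally show ?thesis .
      qed
      then show ?case using K C by (intro exI[of _ "max K C"] exI[of _ "min d e"]) auto
    qed
    obtain K d where K: "0 \<le> K" "0 < d"
      "\<forall>s. 0 < norm s \<and> norm s < d \<longrightarrow> (\<forall>i<n. norm (y s (h i) - h i 0) \<le> K * norm s)"
      using small[of n h, OF h(1)] by blast
    obtain m :: nat and u \<rho> where m: "0 < \<rho>" "\<forall>i<m. u i \<in> coordinates"
      "\<forall>y\<in>Z. (\<forall>i<m. norm (u i y - u i (eval_point 0)) < \<rho>) \<longrightarrow> y \<in> {y. g y = F (tuple n p y)}"
      using n(3) by (rule nbhdE) (rule that)
    have "\<forall>i. \<exists>h. i < m \<longrightarrow> h \<in> A \<and> u i = (\<lambda>z. z h)" using m(2) by blast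
    then obtain k where k: "\<And>i. i < m \<Longrightarrow> k i \<in> A" "\<And>i. i < m \<Longrightarrow> u i = (\<lambda>z. z (k i))" by metis
    obtain L e where L: "0 \<le> L" "0 < e"
      "\<forall>s. 0 < norm s \<and> norm s < e \<longrightarrow> (\<forall>i<m. norm (y s (k i) - k i 0) \<le> L * norm s)"
      using small[of m k, OF k(1)] by blast
    define d' where "d' = min (min d e) (min (r / (K + 1)) (\<rho> / (L + 1)))"
    have d': "0 < d'" using K L r m(1) by (simp add: d'_def)
    show ?thesis
    proof (rule vanishes_to_orderI[OF d', of _ "B * (K / r) ^ N"])
      fix s :: complex assume s: "0 < norm s" "norm s < d'"
      have Ks: "K * norm s < r"
      proof -
        have "norm s * (K + 1) < r" using s K by (simp add: d'_def pos_less_divide_eq)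
        moreover have "norm s * (K + 1) = K * norm s + norm s" by (simp add: algebra_simps)
        ultimately show ?thesis using s(1) by linarith
      qed
      have Ls: "L * norm s < \<rho>"
      proof -
        have "norm s * (L + 1) < \<rho>" using s L by (simp add: d'_def pos_less_divide_eq)
        moreover have "norm s * (L + 1) = L * norm s + norm s" by (simp add: algebra_simps)
        ultimately show ?thesis using s(1) by linarith
      qed
      have "norm (u i (y s) - u i (eval_point 0)) < \<rho>" if "i < m" for i
      proof -
        have "norm (y s (k i) - k i 0) \<le> L * norm s" using L(3) s that by (simp add: d'_def)
        then show ?thesis using Ls k that by (simp add: eval_point_apply)
      qed
      then have gF: "g (y s) = F (tuple n p (y s))" using m(3) y(1) by blast
      have yq: "y s (q N) = (\<Sum>\<alpha>\<in>?L N. c \<alpha> * mpower n ?a (tuple n p (y s)) \<alpha>)"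
      proof -
        have "y s (?m \<alpha>) = mpower n ?a (tuple n p (y s)) \<alpha>" for \<alpha>
        proof -
          have "y s (?m \<alpha>) = (\<Prod>i<n. y s ((h i - (\<lambda>_. h i 0)) ^ \<alpha> i))"
            by (rule point_prod[OF y(1)]) (auto intro: power_mem diff_mem const_mem h(1))
          also have "\<dots> = (\<Prod>i<n. (y s (h i) - h i 0) ^ \<alpha> i)"
            by (rule prod.cong) (auto simp: point_power point_diff point_const y(1) h(1) diff_mem const_mem)
          also have "\<dots> = mpower n ?a (tuple n p (y s)) \<alpha>"
            unfolding mpower_def using a h(2) by (intro prod.cong) (auto simp: tuple_def)
          finally show ?thesis .
        qed
        then show ?thesis
          unfolding q_def using y(1) mA
          by (simp add: point_sum point_mult point_const const_mem mult_mem)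
      qed
      have "norm (tuple n p (y s) i - ?a i) \<le> K * norm s" if "i < n" for i
        using K(3) s that a[OF that] h(2)[OF that] by (simp add: d'_def tuple_def)
      then have "norm (g (y s) - y s (q N)) \<le> B * (K * norm s / r) ^ N"
        unfolding gF yq using c[of "K * norm s" "tuple n p (y s)" N] Ks K(1) by simp
      then show "norm (g (y s) - y s (q N)) \<le> B * (K / r) ^ N * norm s ^ N"
        by (simp add: power_mult_distrib power_divide)
    qed
  qed
  ultimately show ?thesis unfolding germ_def using qA by blast
qed

lemma germ_mem: "germ g q \<Longrightarrow> q N \<in> A"
  by (simp add: germ_def)

lemma germ_along_curve:
  "germ g q \<Longrightarrow> (\<And>s. y s \<in> Z) \<Longrightarrow> (\<And>h. h \<in> A \<Longrightarrow> vanishes_to_order 1 (\<lambda>s. y s h - h 0)) \<Longrightarrow>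
    vanishes_to_order N (\<lambda>s. g (y s) - y s (q N))"
  unfolding germ_def by blast

lemma germ_Cauchy:
  assumes "germ g q" "M \<le> N"
  shows "max_ideal_power A 0 M (q N - q M)"
  using assms(2)
proof (induction N rule: dec_induct)
  case base
  then show ?case by (simp add: max_ideal_power_zero)
next
  case (step n)
  have "max_ideal_power A 0 M (q (Suc n) - q n)"
    using assms(1) step max_ideal_power_antimono[of M n] by (simp add: germ_def)
  from max_ideal_power.add[OF this step.IH] show ?case by simp
qed

lemma germ_hcomp:
  assumes "germ g q" "k < N"
  shows "hc k (q N) = hc k (q (Suc k))"
proof -
  have "hc k (q N - q (Suc k)) = 0"
    using hcomp_max_ideal_power[OF germ_Cauchy[OF assms(1), of "Suc k" N]] assms(2) by simp
  then show ?thesis using germ_mem[OF assms(1)] by (simp add: hcomp_diff mem_polys)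
qed

lemma germ_approximates:
  assumes "germ g q"
  shows "approximates N (\<lambda>k. hc k (q (Suc k))) (q N)"
proof -
  have "max_ideal_power A 0 N (hc i (q (Suc i)) - hc i (q N))" for i
  proof (cases "i < N")
    case True
    then show ?thesis using germ_hcomp[OF assms, of i N] by (simp add: max_ideal_power_zero)
  next
    case False
    then have "max_ideal_power A 0 N (q (Suc i) - q N)" by (intro germ_Cauchy[OF assms]) simp
    from max_ideal_power_hcomp_closed[OF this, of i] show ?thesis
      using germ_mem[OF assms] by (simp add: hcomp_diff mem_polys)
  qed
  then show ?thesis using germ_mem[OF assms] by (simp add: approximates_def)
qed

lemma scale_curve:
  assumes "z \<in> Z" "h \<in> A"
  shows "vanishes_to_order 1 (\<lambda>s. scale_point s z h - h 0)"
proof -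
  have "vanishes_to_order 1 (poly (orbit_poly z h - [:h 0:]))"
    unfolding vanishes_to_order_poly_iff
    using assms by (simp add: coeff_orbit_poly hcomp_0 mem_polys point_const)
  moreover have "poly (orbit_poly z h - [:h 0:]) = (\<lambda>s. scale_point s z h - h 0)"
    using assms by (auto simp: scale_point_apply)
  ultimately show ?thesis by simp
qed

lemma germ_at_0:
  assumes "germ g q"
  shows "q 1 0 = g (eval_point 0)"
proof -
  have "vanishes_to_order 1 (\<lambda>s::complex. g (eval_point 0) - eval_point 0 (q 1))"
    by (rule germ_along_curve[OF assms]) (auto simp: eval_point_in eval_point_apply intro: vanishes_to_orderI[of 1 _ 0])
  from vanishes_to_order_const[OF this] show ?thesis
    using germ_mem[OF assms, of 1] by (simp add: eval_point_apply)
qed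

lemma germ_expands:
  assumes "germ g q" "z \<in> Z"
  shows "expands (\<lambda>s. g (scale_point s z)) (\<lambda>k. z (hc k (q (Suc k))))"
  unfolding expands_def
proof
  fix N
  have "vanishes_to_order N (\<lambda>s. g (scale_point s z) - scale_point s z (q N))"
    by (rule germ_along_curve[OF assms(1) scale_point_in[OF assms(2)] scale_curve[OF assms(2)]])
  then have "vanishes_to_order N (\<lambda>s. g (scale_point s z) - poly (orbit_poly z (q N)) s)"
    using germ_mem[OF assms(1)] by (simp add: scale_point_apply)
  moreover have "coeff (orbit_poly z (q N)) k = z (hc k (q (Suc k)))" if "k < N" for k
    using germ_hcomp[OF assms(1) that] germ_mem[OF assms(1)] assms(2) by (simp add: coeff_orbit_poly)
  ultimately show "\<exists>p. (\<forall>k<N. coeff p k = z (hc k (q (Suc k)))) \<and>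
      vanishes_to_order N (\<lambda>s. g (scale_point s z) - poly p s)"
    by blast
qed

text \<open>The homogeneous components at the origin of the pullback of \<open>f\<close> under \<open>\<phi>\<close>.\<close>

definition jet :: "((('v \<Rightarrow> complex) \<Rightarrow> complex) \<Rightarrow> ('v \<Rightarrow> complex) \<Rightarrow> complex) \<Rightarrow>
    ('v \<Rightarrow> complex) \<Rightarrow> nat \<Rightarrow> 'v \<Rightarrow> complex" where
  "jet \<phi> f k = hc k ((SOME q. germ (\<lambda>z. \<phi> z f) q) (Suc k))"

text \<open>Only the behaviour of \<open>\<phi>\<close> near the image of the origin enters into its jets.\<close>

definition fixes_origin where
  "fixes_origin \<phi> \<longleftrightarrow> \<phi> \<in> Z \<rightarrow> Z \<and> \<phi> (eval_point 0) = eval_point 0 \<and>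
     (\<forall>f\<in>A. holomorphic_at Z coordinates (eval_point 0) (\<lambda>z. \<phi> z f))"

lemma jet_germ:
  assumes "fixes_origin \<phi>" "f \<in> A"
  obtains q where "germ (\<lambda>z. \<phi> z f) q" "jet \<phi> f = (\<lambda>k. hc k (q (Suc k)))"
proof -
  have "\<exists>q. germ (\<lambda>z. \<phi> z f) q"
    by (rule germ_exists) (use assms in \<open>simp add: fixes_origin_def\<close>)
  then have "germ (\<lambda>z. \<phi> z f) (SOME q. germ (\<lambda>z. \<phi> z f) q)" by (rule someI_ex)
  then show thesis by (rule that) (rule ext, rule jet_def)
qed

lemma jet_expands:
  assumes "fixes_origin \<phi>" "f \<in> A" "z \<in> Z"
  shows "expands (\<lambda>s. \<phi> (scale_point s z) f) (\<lambda>k. z (jet \<phi> f k))"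
proof -
  obtain q where q: "germ (\<lambda>z. \<phi> z f) q" "jet \<phi> f = (\<lambda>k. hc k (q (Suc k)))"
    using jet_germ[OF assms(1,2)] by blast
  show ?thesis unfolding q(2) by (rule germ_expands[OF q(1) assms(3)])
qed

lemma jet_map_mem:
  assumes "fixes_origin \<phi>" "f \<in> A"
  shows "jet \<phi> f k \<in> homog k"
proof -
  obtain q where q: "germ (\<lambda>z. \<phi> z f) q" "jet \<phi> f = (\<lambda>k. hc k (q (Suc k)))"
    using jet_germ[OF assms] by blast
  show ?thesis unfolding q(2) using germ_mem[OF q(1)] by (rule hcomp_mem_homog)
qed

text \<open>Identities between jets follow from the uniqueness of asymptotic expansions, applied on the
  lines through the origin.\<close>

lemma jet_eqI:
  assumes "fixes_origin \<phi>" "f \<in> A" "\<And>k. G k \<in> A"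
    and "\<And>z. z \<in> Z \<Longrightarrow> expands (\<lambda>s. \<phi> (scale_point s z) f) (\<lambda>k. z (G k))"
  shows "jet \<phi> f k = G k"
proof
  fix v
  have "(\<lambda>k. eval_point v (jet \<phi> f k)) = (\<lambda>k. eval_point v (G k))"
    using jet_expands[OF assms(1,2) eval_point_in] assms(4)[OF eval_point_in] by (rule expands_unique)
  then show "jet \<phi> f k v = G k v"
    using homog_mem[OF jet_map_mem[OF assms(1,2)]] assms(3) by (auto simp: fun_eq_iff eval_point_apply)
qed

lemma jet_map_jet:
  assumes \<phi>: "fixes_origin \<phi>"
  shows "jet_map smul A (jet \<phi>)"
proof -
  have \<phi>Z: "\<phi> (scale_point s z) \<in> Z" if "z \<in> Z" for s z
    using \<phi> scale_point_in[OF that] by (auto simp: fixes_origin_def)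
  have mem: "jet \<phi> f k \<in> A" if "f \<in> A" for f k using jet_map_mem[OF \<phi> that] homog_mem by blast
  show ?thesis
  proof unfold_locales
    show "jet \<phi> f k \<in> homog k" if "f \<in> A" for f k using jet_map_mem[OF \<phi> that] .
    show "jet \<phi> (f + h) k = jet \<phi> f k + jet \<phi> h k" if "f \<in> A" "h \<in> A" for f h k
    proof (rule jet_eqI[OF \<phi>, of "f + h" "\<lambda>k. jet \<phi> f k + jet \<phi> h k"])
      show "expands (\<lambda>s. \<phi> (scale_point s z) (f + h)) (\<lambda>k. z (jet \<phi> f k + jet \<phi> h k))" if z: "z \<in> Z" for z
        using expands_add[OF jet_expands[OF \<phi> \<open>f \<in> A\<close> z] jet_expands[OF \<phi> \<open>h \<in> A\<close> z]]
          \<phi>Z[OF z] z \<open>f \<in> A\<close> \<open>h \<in> A\<close> mem by (simp add: point_add)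
    qed (use that mem add_mem in auto)
    show "jet \<phi> (f * h) k = (\<Sum>i\<le>k. jet \<phi> f i * jet \<phi> h (k - i))" if "f \<in> A" "h \<in> A" for f h k
    proof (rule jet_eqI[OF \<phi>, of "f * h" "\<lambda>k. \<Sum>i\<le>k. jet \<phi> f i * jet \<phi> h (k - i)"])
      show "expands (\<lambda>s. \<phi> (scale_point s z) (f * h)) (\<lambda>k. z (\<Sum>i\<le>k. jet \<phi> f i * jet \<phi> h (k - i)))"
        if z: "z \<in> Z" for z
        using expands_mult[OF jet_expands[OF \<phi> \<open>f \<in> A\<close> z] jet_expands[OF \<phi> \<open>h \<in> A\<close> z]]
          \<phi>Z[OF z] z \<open>f \<in> A\<close> \<open>h \<in> A\<close> mem by (simp add: point_mult point_sum mult_mem)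
    qed (use that mem mult_mem in \<open>auto intro: sum_mem\<close>)
    show "jet \<phi> (\<lambda>_. c) k = (if k = 0 then (\<lambda>_. c) else 0)" for c k
    proof (rule jet_eqI[OF \<phi>, of "\<lambda>_. c" "\<lambda>k. if k = 0 then (\<lambda>_. c) else 0"])
      show "expands (\<lambda>s. \<phi> (scale_point s z) (\<lambda>_. c)) (\<lambda>k. z (if k = 0 then (\<lambda>_. c) else 0))" if z: "z \<in> Z" for z
      proof -
        have "(\<lambda>k. z (if k = 0 then (\<lambda>_. c) else 0)) = coeff [:c:]"
          using z by (auto simp: fun_eq_iff point_const point_zero coeff_pCons split: nat.splits)
        moreover have "(\<lambda>s. \<phi> (scale_point s z) (\<lambda>_. c)) = poly [:c:]"
          using \<phi>Z[OF z] by (auto simp: point_const)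
        ultimately show ?thesis using expands_poly[of "[:c:]"] by simp
      qed
    qed (auto intro: const_mem zero_mem)
    show "jet \<phi> f 0 = (\<lambda>_. f 0)" if f: "f \<in> A" for f
    proof -
      obtain q where q: "germ (\<lambda>z. \<phi> z f) q" "jet \<phi> f = (\<lambda>k. hc k (q (Suc k)))"
        using jet_germ[OF \<phi> f] by blast
      have "q 1 0 = f 0"
        using germ_at_0[OF q(1)] \<phi> f by (simp add: fixes_origin_def eval_point_apply)
      then show ?thesis unfolding q(2) using germ_mem[OF q(1)] by (simp add: hcomp_0 mem_polys)
    qed
  qed
qed

lemma fixes_origin_curve:
  assumes "fixes_origin \<psi>" "z \<in> Z" "h \<in> A"
  shows "vanishes_to_order 1 (\<lambda>s. \<psi> (scale_point s z) h - h 0)"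
proof -
  interpret J: jet_map smul A "jet \<psi>" by (rule jet_map_jet) fact
  obtain p where p: "\<And>k. k < 1 \<Longrightarrow> coeff p k = z (jet \<psi> h k)"
    "vanishes_to_order 1 (\<lambda>s. \<psi> (scale_point s z) h - poly p s)"
    using jet_expands[OF assms(1,3,2)] by (rule expandsE) blast
  have "coeff p 0 = h 0" using p(1)[of 0] J.jet_0[OF assms(3)] assms(2) by (simp add: point_const)
  then have "vanishes_to_order 1 (poly (p - [:h 0:]))" unfolding vanishes_to_order_poly_iff by simp
  from vanishes_to_order_add[OF p(2) this] show ?thesis by simp
qed

text \<open>Let \<open>q\<close> approximate the germ of \<open>f \<circ> \<phi>\<close> to order \<open>N\<close>. On the images under \<open>\<psi>\<close> of the lines through
  the origin, \<open>q\<close> then agrees to order \<open>N\<close> with \<open>f \<circ> \<phi> \<circ> \<psi> = f\<close>.\<close>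

lemma inverse_jet_maps_jet:
  assumes \<phi>: "fixes_origin \<phi>" and \<psi>: "fixes_origin \<psi>" and inv: "\<And>z. z \<in> Z \<Longrightarrow> \<phi> (\<psi> z) = z"
  shows "inverse_jet_maps smul A (jet \<phi>) (jet \<psi>)"
proof -
  interpret T: jet_map smul A "jet \<phi>" by (rule jet_map_jet) fact
  interpret S: jet_map smul A "jet \<psi>" by (rule jet_map_jet) fact
  show ?thesis
  proof unfold_locales
    fix f N assume f: "f \<in> A"
    obtain q where q: "germ (\<lambda>z. \<phi> z f) q" "jet \<phi> f = (\<lambda>k. hc k (q (Suc k)))"
      using jet_germ[OF \<phi> f] by blast
    have qA: "q N \<in> A" by (rule germ_mem[OF q(1)])
    have "jet \<psi> (q N) k = hc k f" if "k < N" for k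
    proof
      fix v
      let ?y = "\<lambda>s. \<psi> (scale_point s (eval_point v))"
      have y: "?y s \<in> Z" for s
        using \<psi> scale_point_in[OF eval_point_in] by (auto simp: fixes_origin_def)
      have "vanishes_to_order N (\<lambda>s. \<phi> (?y s) f - ?y s (q N))"
        by (rule germ_along_curve[OF q(1) y fixes_origin_curve[OF \<psi> eval_point_in]])
      moreover have "\<phi> (?y s) f = poly (orbit_poly (eval_point v) f) s" for s
        using inv[OF scale_point_in[OF eval_point_in]] f by (simp add: scale_point_apply)
      ultimately have "vanishes_to_order N (\<lambda>s. poly (orbit_poly (eval_point v) f) s - ?y s (q N))" by simp
      from expands_unique_below[OF expands_poly jet_expands[OF \<psi> qA eval_point_in] this that]
      show "jet \<psi> (q N) k v = hc k f v"
        using f qA by (simp add: coeff_orbit_poly eval_point_in eval_point_apply hcomp_closed S.jet_mem)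
    qed
    moreover have "approximates N (jet \<phi> f) (q N)"
      unfolding q(2) by (rule germ_approximates[OF q(1)])
    ultimately show "\<exists>q. approximates N (jet \<phi> f) q \<and> (\<forall>k<N. jet \<psi> q k = hc k f)" by blast
  qed
qed

end

section \<open>The family of rescaled maps\<close>

text \<open>The assumption \<open>low\<close> says that the expansion of \<open>f (t\<^sup>-\<^sup>1 \<cdot> \<phi> (t \<cdot> z))\<close> at \<open>t = 0\<close> has no negative powers
  of \<open>t\<close>. Its constant term is the value of \<open>leading f\<close> at \<open>z\<close>, which is therefore the member of the
  family at \<open>0\<close>.\<close>

locale degree_preserving_map = graded_algebra smul A
  for smul :: "complex \<Rightarrow> 'v::ab_group_add \<Rightarrow> 'v" and A +
  fixes \<phi> :: "(('v \<Rightarrow> complex) \<Rightarrow> complex) \<Rightarrow> (('v \<Rightarrow> complex) \<Rightarrow> complex)"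
  assumes maps: "\<phi> \<in> affine_points A \<rightarrow> affine_points A"
    and holomorphic: "f \<in> A \<Longrightarrow> z \<in> affine_points A \<Longrightarrow>
      holomorphic_at (affine_points A) {\<lambda>z. z h | h. h \<in> A} z (\<lambda>z. \<phi> z f)"
    and origin: "\<phi> (eval_point 0) = eval_point 0"
    and low: "f \<in> homog d \<Longrightarrow> k < d \<Longrightarrow> jet \<phi> f k = 0"
begin

lemma fixes_origin: "fixes_origin \<phi>"
  using maps holomorphic origin eval_point_in by (auto simp: fixes_origin_def)

sublocale J: jet_map smul A "jet \<phi>"
  by (rule jet_map_jet) (rule fixes_origin)

lemma maps_point: "z \<in> Z \<Longrightarrow> \<phi> z \<in> Z"
  using maps by auto

definition leading :: "('v \<Rightarrow> complex) \<Rightarrow> 'v \<Rightarrow> complex" where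
  "leading f = (\<Sum>d | hc d f \<noteq> 0. jet \<phi> (hc d f) d)"

lemma leading_eq:
  assumes "\<forall>d>D. hc d f = 0"
  shows "leading f = (\<Sum>d\<le>D. jet \<phi> (hc d f) d)"
  unfolding leading_def
proof (rule sum.mono_neutral_left)
  show "{d. hc d f \<noteq> 0} \<subseteq> {..D}" using assms not_le by auto
qed (auto simp: J.jet_zero)

lemma leading_homog: "f \<in> homog d \<Longrightarrow> leading f = jet \<phi> f d"
proof -
  assume f: "f \<in> homog d"
  have "leading f = (\<Sum>e\<le>d. jet \<phi> (hc e f) e)"
    by (rule leading_eq) (simp add: hcomp_homog[OF f])
  also have "\<dots> = (\<Sum>e\<le>d. if e = d then jet \<phi> f d else 0)"
    by (rule sum.cong) (auto simp: hcomp_homog[OF f] J.jet_zero)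
  finally show ?thesis by simp
qed

lemma degree_bound:
  assumes "f \<in> A"
  obtains D where "\<forall>d>D. hc d f = 0"
  using hcomp_eventually_0[OF mem_polys[OF assms]] by blast

lemma leading_mem:
  assumes "f \<in> A"
  shows "leading f \<in> A"
proof -
  obtain D where D: "\<forall>d>D. hc d f = 0" using degree_bound[OF assms] by blast
  show ?thesis unfolding leading_eq[OF D] using assms by (intro sum_mem J.jet_mem hcomp_closed)
qed

lemma hcomp_leading:
  assumes "f \<in> A"
  shows "hc e (leading f) = jet \<phi> (hc e f) e"
proof -
  obtain D where D: "\<forall>d>D. hc d f = 0" using degree_bound[OF assms] by blast
  have jA: "jet \<phi> (hc d f) d \<in> A" for d using assms by (intro J.jet_mem hcomp_closed)
  have "hc e (leading f) = (\<Sum>d\<le>D. hc e (jet \<phi> (hc d f) d))"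
    unfolding leading_eq[OF D] using jA mem_polys by (intro hcomp_sum) auto
  also have "\<dots> = (\<Sum>d\<le>D. if d = e then jet \<phi> (hc e f) e else 0)"
    by (rule sum.cong) (auto simp: hcomp_homog[OF J.jet_homog[OF hcomp_closed[OF assms]]])
  also have "\<dots> = jet \<phi> (hc e f) e" using D by (auto simp: not_le J.jet_zero)
  finally show ?thesis .
qed

definition family :: "complex \<Rightarrow> (('v \<Rightarrow> complex) \<Rightarrow> complex) \<Rightarrow> ('v \<Rightarrow> complex) \<Rightarrow> complex" where
  "family t z = restrict (\<lambda>f. if t = 0 then z (leading f)
     else scale_point (inverse t) (\<phi> (scale_point t z)) f) A"

lemma family_nonzero:
  assumes "t \<noteq> 0" "z \<in> Z"
  shows "family t z = scale_point (inverse t) (\<phi> (scale_point t z))"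
proof -
  have "scale_point (inverse t) (\<phi> (scale_point t z)) \<in> extensional A"
    using assms by (intro point_extensional scale_point_in maps_point)
  then show ?thesis using assms by (auto simp: family_def extensional_def)
qed

lemma family_zero: "f \<in> A \<Longrightarrow> family 0 z f = z (leading f)"
  by (simp add: family_def)

lemma family_nonzero_in: "t \<noteq> 0 \<Longrightarrow> z \<in> Z \<Longrightarrow> family t z \<in> Z"
  by (simp add: family_nonzero scale_point_in maps_point)

lemma family_nonzero_homog:
  "t \<noteq> 0 \<Longrightarrow> z \<in> Z \<Longrightarrow> f \<in> homog d \<Longrightarrow> family t z f = \<phi> (scale_point t z) f / t ^ d"
  by (simp add: family_nonzero scale_point_homog scale_point_in maps_point divide_inverse power_inverse mult.commute)

lemma family_sum:
  assumes "z \<in> Z" "f \<in> A" "\<forall>d>D. hc d f = 0"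
  shows "family t z f = (\<Sum>d\<le>D. family t z (hc d f))"
proof (cases "t = 0")
  case True
  have "z (leading f) = (\<Sum>d\<le>D. z (jet \<phi> (hc d f) d))"
    unfolding leading_eq[OF assms(3)] by (rule point_sum[OF assms(1)]) (auto intro: J.jet_mem hcomp_closed assms(2))
  then show ?thesis
    using True assms by (simp add: family_zero hcomp_closed leading_homog[OF hcomp_mem_homog])
next
  case False
  have "family t z (\<Sum>d\<le>D. hc d f) = (\<Sum>d\<le>D. family t z (hc d f))"
    by (rule point_sum[OF family_nonzero_in[OF False assms(1)]]) (auto intro: hcomp_closed assms(2))
  then show ?thesis using sum_hcomp[OF mem_polys[OF assms(2)] assms(3)[rule_format]] by simp
qed

lemma family_tendsto:
  assumes "z \<in> Z" "f \<in> A"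
  shows "((\<lambda>t. family t z f) \<longlongrightarrow> family 0 z f) (at 0)"
proof -
  have homog: "((\<lambda>t. family t z f) \<longlongrightarrow> family 0 z f) (at 0)" if f: "f \<in> homog d" for f d
  proof -
    have fA: "f \<in> A" using f by (rule homog_mem)
    have "((\<lambda>t. \<phi> (scale_point t z) f / t ^ d) \<longlongrightarrow> z (jet \<phi> f d)) (at 0)"
      by (rule expands_limit[OF jet_expands[OF fixes_origin fA assms(1)]])
        (simp add: low[OF f] point_zero[OF assms(1)])
    moreover have "\<forall>\<^sub>F t in at 0. \<phi> (scale_point t z) f / t ^ d = family t z f"
      unfolding eventually_at
      by (rule exI[of _ 1]) (simp add: family_nonzero_homog[OF _ assms(1) f])
    ultimately have "((\<lambda>t. family t z f) \<longlongrightarrow> z (jet \<phi> f d)) (at 0)" by (rule Lim_transform_eventually)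
    then show ?thesis using fA by (simp add: family_zero leading_homog[OF f])
  qed
  obtain D where D: "\<forall>d>D. hc d f = 0" using degree_bound[OF assms(2)] by blast
  show ?thesis
    unfolding family_sum[OF assms D] by (intro tendsto_sum homog[OF hcomp_mem_homog[OF assms(2)]])
qed

text \<open>For \<open>t = 0\<close> this is an algebra homomorphism as the limit of the other members.\<close>

lemma family_in:
  assumes "z \<in> Z"
  shows "family t z \<in> Z"
proof (cases "t = 0")
  case True
  have ev: "\<forall>\<^sub>F t in at 0. P t" if "\<And>t. t \<noteq> 0 \<Longrightarrow> P t" for P :: "complex \<Rightarrow> bool"
    unfolding eventually_at by (rule exI[of _ 1]) (use that in auto)
  have "restrict (family 0 z) A \<in> Z"
  proof (rule affine_pointsI)
    fix c
    have "((\<lambda>t. family t z (\<lambda>_. c)) \<longlongrightarrow> c) (at 0)"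
      by (rule Lim_transform_eventually[OF tendsto_const], rule ev)
        (use point_const[OF family_nonzero_in[OF _ assms]] in simp)
    then show "family 0 z (\<lambda>_. c) = c"
      by (rule tendsto_unique[OF trivial_limit_at family_tendsto[OF assms const_mem]])
  next
    fix f h assume fh: "f \<in> A" "h \<in> A"
    have "((\<lambda>t. family t z (f + h)) \<longlongrightarrow> family 0 z f + family 0 z h) (at 0)"
      by (rule Lim_transform_eventually[OF tendsto_add[OF family_tendsto family_tendsto]], rule assms, rule fh, rule assms, rule fh, rule ev)
        (use point_add[OF family_nonzero_in[OF _ assms] fh] in simp)
    then show "family 0 z (f + h) = family 0 z f + family 0 z h"
      by (rule tendsto_unique[OF trivial_limit_at family_tendsto[OF assms add_mem[OF fh]]])
    have "((\<lambda>t. family t z (f * h)) \<longlongrightarrow> family 0 z f * family 0 z h) (at 0)"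
      by (rule Lim_transform_eventually[OF tendsto_mult[OF family_tendsto family_tendsto]], rule assms, rule fh, rule assms, rule fh, rule ev)
        (use point_mult[OF family_nonzero_in[OF _ assms] fh] in simp)
    then show "family 0 z (f * h) = family 0 z f * family 0 z h"
      by (rule tendsto_unique[OF trivial_limit_at family_tendsto[OF assms mult_mem[OF fh]]])
  qed
  moreover have "restrict (family 0 z) A = family 0 z" by (auto simp: family_def restrict_def)
  ultimately show ?thesis using True by simp
next
  case False
  then show ?thesis using family_nonzero_in assms by blast
qed

abbreviation "X \<equiv> (UNIV :: complex set) \<times> Z"

abbreviation family_coordinates :: "(complex \<times> (('v \<Rightarrow> complex) \<Rightarrow> complex) \<Rightarrow> complex) set" where
  "family_coordinates \<equiv> insert fst {\<lambda>p. snd p h | h. h \<in> A}"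

lemma holomorphic_at_fst: "holomorphic_at X family_coordinates x fst"
  by (rule holomorphic_at_generator) simp

lemma holomorphic_at_snd: "h \<in> A \<Longrightarrow> holomorphic_at X family_coordinates x (\<lambda>p. snd p h)"
  by (rule holomorphic_at_generator) auto

lemma holomorphic_at_scale_point:
  assumes "x \<in> X" "h \<in> A"
  shows "holomorphic_at X family_coordinates x (\<lambda>p. scale_point (fst p) (snd p) h)"
proof -
  obtain D where D: "\<forall>d>D. hc d h = 0" using degree_bound[OF assms(2)] by blast
  have "holomorphic_at X family_coordinates x (\<lambda>p. \<Sum>d\<le>D. fst p ^ d * snd p (hc d h))"
    by (intro holomorphic_at_sum holomorphic_at_mult holomorphic_at_power holomorphic_at_fst
        holomorphic_at_snd hcomp_closed assms)
  then show ?thesis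
    by (rule holomorphic_at_cong_all[OF assms(1)])
      (use poly_orbit_poly[OF _ assms(2) D[rule_format]] in \<open>auto simp: scale_point_apply assms(2)\<close>)
qed

lemma holomorphic_at_map_scale_point:
  assumes "x \<in> X" "f \<in> A"
  shows "holomorphic_at X family_coordinates x (\<lambda>p. \<phi> (scale_point (fst p) (snd p)) f)"
proof (rule holomorphic_at_pullback[where \<mu> = "\<lambda>p. scale_point (fst p) (snd p)" and f = "\<lambda>z. \<phi> z f"
      and Y = Z and S = coordinates])
  show "holomorphic_at Z coordinates (scale_point (fst x) (snd x)) (\<lambda>z. \<phi> z f)"
    using assms by (intro holomorphic scale_point_in) auto
  show "holomorphic_at X family_coordinates x (\<lambda>y. q (scale_point (fst y) (snd y)))"
    if "q \<in> coordinates" for q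
    using that holomorphic_at_scale_point[OF assms(1)] by auto
qed (use assms scale_point_in in auto)

lemma family_holomorphic_nonzero:
  assumes "t \<noteq> 0" "z \<in> Z" "f \<in> homog d"
  shows "holomorphic_at X family_coordinates (t, z) (\<lambda>p. family (fst p) (snd p) f)"
proof -
  have x: "(t, z) \<in> X" using assms by simp
  have "holomorphic_at X family_coordinates (t, z)
      (\<lambda>p. \<phi> (scale_point (fst p) (snd p)) f * inverse (fst p) ^ d)"
    using assms
    by (intro holomorphic_at_mult[OF x] holomorphic_at_power[OF x] holomorphic_at_inverse[OF x]
        holomorphic_at_map_scale_point[OF x] holomorphic_at_fst homog_mem) auto
  moreover have "nbhd X family_coordinates (t, z) {p. norm (fst p - fst (t, z)) < norm t}"
    using assms(1) by (intro nbhd_generator) auto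
  then have "nbhd X family_coordinates (t, z)
      {p. family (fst p) (snd p) f = \<phi> (scale_point (fst p) (snd p)) f * inverse (fst p) ^ d}"
  proof (rule nbhd_mono)
    fix p assume p: "p \<in> X" "p \<in> {p. norm (fst p - fst (t, z)) < norm t}"
    then have "fst p \<noteq> 0" by auto
    then show "p \<in> {p. family (fst p) (snd p) f = \<phi> (scale_point (fst p) (snd p)) f * inverse (fst p) ^ d}"
      using p family_nonzero_homog[OF _ _ assms(3)] by (auto simp: divide_inverse power_inverse)
  qed
  ultimately show ?thesis by (rule holomorphic_at_cong[OF x])
qed

text \<open>Removal of a zero along \<open>t = 0\<close>: in a local representation of \<open>g\<close> in which \<open>t\<close> is the first of
  the variables and no other variable depends on \<open>t\<close>, the power series is divided by this variable.
  The remainder does not vanish as a power series, but it is zero on the variety.\<close>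

lemma holomorphic_at_divide:
  assumes z0: "z0 \<in> Z" and g: "holomorphic_at X family_coordinates (0, z0) g"
    and zero: "\<And>z. z \<in> Z \<Longrightarrow> g (0, z) = 0"
    and lim: "\<And>z. z \<in> Z \<Longrightarrow> ((\<lambda>t. g (t, z) / t) \<longlongrightarrow> G z) (at 0)"
  shows "holomorphic_at X family_coordinates (0, z0) (\<lambda>p. if fst p = 0 then G (snd p) else g p / fst p)"
proof -
  let ?x = "(0, z0) :: complex \<times> (('v \<Rightarrow> complex) \<Rightarrow> complex)"
  obtain n p F where n: "\<forall>i<n. p i \<in> family_coordinates" "holomorphic_near n (tuple n p ?x) F"
    "nbhd X family_coordinates ?x {y. g y = F (tuple n p y)}"
    using g by (rule holomorphic_atE) (rule that)
  obtain m :: nat and u s where m: "0 < s" "\<forall>i<m. u i \<in> family_coordinates"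
    "\<forall>y\<in>X. (\<forall>i<m. norm (u i y - u i ?x) < s) \<longrightarrow> y \<in> {y. g y = F (tuple n p y)}"
    using n(3) by (rule nbhdE) (rule that)
  define p' where "p' j = (if j = 0 then fst else if p (j - 1) = fst then (\<lambda>q. snd q 1) else p (j - 1))" for j
  define e where "e i = (if p i = fst then 0 else Suc i)" for i
  have p'_fst: "p' 0 = fst" by (simp add: p'_def)
  have p'_R: "p' i \<in> family_coordinates" if "i < Suc n" for i
  proof (cases "i = 0")
    case False
    then have "p (i - 1) \<in> family_coordinates" using n(1) that by simp
    then show ?thesis using one_mem by (auto simp: p'_def)
  qed (simp add: p'_def)
  have p'_snd: "p' i (t, z) = p' i (t', z)" if "i < Suc n" "i \<noteq> 0" for i t t' z
  proof -
    have "p (i - 1) \<in> family_coordinates" using n(1) that by simp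
    then show ?thesis using that by (auto simp: p'_def)
  qed
  have tup: "(\<lambda>i. if i < n then tuple (Suc n) p' y (e i) else 0) = tuple n p y" for y
    by (auto simp: tuple_def p'_def e_def)
  define F' where "F' = (\<lambda>w. F (\<lambda>i. if i < n then w (e i) else 0))"
  have F': "F' (tuple (Suc n) p' y) = F (tuple n p y)" for y by (simp add: F'_def tup)
  let ?a = "tuple (Suc n) p' ?x"
  have "holomorphic_near (Suc n) ?a F'"
    unfolding F'_def by (rule holomorphic_near_reindex, simp only: tup, rule n(2)) (simp add: e_def)
  moreover have "?a 0 = 0" by (simp add: tuple_def p'_fst)
  ultimately have "\<exists>H C r. holomorphic_near (Suc n) ?a H \<and> 0 < r \<and> (\<forall>w\<in>polydisc (Suc n) ?a r.
      F' w = F' (w(0 := 0)) + w 0 * H w \<and> norm (H w - H (w(0 := 0))) \<le> C * norm (w 0))"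
    by (rule holomorphic_near_divide)
  then obtain H C r where "holomorphic_near (Suc n) ?a H \<and> 0 < r \<and> (\<forall>w\<in>polydisc (Suc n) ?a r.
      F' w = F' (w(0 := 0)) + w 0 * H w \<and> norm (H w - H (w(0 := 0))) \<le> C * norm (w 0))"
    by (elim exE)
  then have H: "holomorphic_near (Suc n) ?a H" "0 < r"
    "\<And>w. w \<in> polydisc (Suc n) ?a r \<Longrightarrow> F' w = F' (w(0 := 0)) + w 0 * H w"
    "\<And>w. w \<in> polydisc (Suc n) ?a r \<Longrightarrow> norm (H w - H (w(0 := 0))) \<le> C * norm (w 0)"
    by simp_all
  define U where "U = {y\<in>X. (\<forall>i<m. norm (u i y - u i ?x) < s) \<and> (\<forall>i<Suc n. norm (p' i y - p' i ?x) < r)}"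
  have U_shift: "(t', z) \<in> U" if U: "(t, z) \<in> U" and t': "norm t' < min s r" for t t' z
  proof -
    have "norm (u i (t', z) - u i ?x) < s" if "i < m" for i
    proof (cases "u i = fst")
      case False
      then have "u i (t', z) = u i (t, z)" using m(2) that by auto
      then show ?thesis using U that by (simp add: U_def)
    qed (use t' in simp)
    moreover have "norm (p' i (t', z) - p' i ?x) < r" if "i < Suc n" for i
    proof (cases "i = 0")
      case False
      then have "p' i (t', z) = p' i (t, z)" using p'_snd that by blast
      then show ?thesis using U that by (simp add: U_def)
    qed (use t' in \<open>simp add: p'_fst\<close>)
    ultimately show ?thesis using U by (auto simp: U_def)
  qed
  let ?w = "\<lambda>y. tuple (Suc n) p' y"
  have disc: "?w y \<in> polydisc (Suc n) ?a r" if "y \<in> U" for y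
    using that by (auto simp: U_def polydisc_def tuple_def)
  have gF: "g y = F' (?w y)" if "y \<in> U" for y
    using that m(3) by (auto simp: U_def F')
  have w0: "(?w (t, z))(0 := 0) = ?w (0, z)" for t z
    using p'_snd by (auto simp: tuple_def p'_fst fun_eq_iff)
  have w0': "?w (t, z) 0 = t" for t z by (simp add: tuple_def p'_fst)
  have g_eq: "g (t, z) = t * H (?w (t, z))" if U: "(t, z) \<in> U" for t z
  proof -
    have "(0, z) \<in> U" using U_shift[OF U, of 0] m(1) H(2) by simp
    moreover have "z \<in> Z" using U by (simp add: U_def)
    ultimately have "F' (?w (0, z)) = 0" using gF zero by metis
    then show ?thesis using H(3)[OF disc[OF U]] gF[OF U] by (simp only: w0 w0' add_0)
  qed
  have G_eq: "G z = H (?w (0, z))" if U: "(0, z) \<in> U" for z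
  proof -
    have z: "z \<in> Z" using U by (simp add: U_def)
    have ev: "\<forall>\<^sub>F t in at 0. (t, z) \<in> U \<and> t \<noteq> 0"
      unfolding eventually_at using U_shift[OF U] m(1) H(2) by (intro exI[of _ "min s r"]) auto
    have "((\<lambda>t::complex. C * norm t) \<longlongrightarrow> C * norm (0::complex)) (at 0)" by (intro tendsto_intros)
    then have "((\<lambda>t::complex. C * norm t) \<longlongrightarrow> 0) (at 0)" by simp
    then have "((\<lambda>t. H (?w (t, z)) - H (?w (0, z))) \<longlongrightarrow> 0) (at 0)"
    proof (rule Lim_null_comparison[rotated])
      show "\<forall>\<^sub>F t in at 0. norm (H (?w (t, z)) - H (?w (0, z))) \<le> C * norm t"
        using ev
      proof eventually_elim
        case (elim t)
        then show ?case using H(4)[OF disc, of "(t, z)"] by (simp only: w0 w0')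
      qed
    qed
    then have "((\<lambda>t. H (?w (t, z))) \<longlongrightarrow> H (?w (0, z))) (at 0)" by (simp add: LIM_zero_iff)
    moreover have "\<forall>\<^sub>F t in at 0. H (?w (t, z)) = g (t, z) / t"
      using ev
    proof eventually_elim
      case (elim t)
      then show ?case using g_eq[of t z] by simp
    qed
    ultimately have "((\<lambda>t. g (t, z) / t) \<longlongrightarrow> H (?w (0, z))) (at 0)" by (rule Lim_transform_eventually)
    with lim[OF z] show ?thesis by (rule tendsto_unique[OF trivial_limit_at])
  qed
  show ?thesis
  proof (rule holomorphic_atI[of "Suc n" p' _ _ H])
    show "p' i \<in> family_coordinates" if "i < Suc n" for i using p'_R[OF that] .
    have "nbhd X family_coordinates ?x ({y. \<forall>i<m. y \<in> {y. norm (u i y - u i ?x) < s}} \<inter>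
        {y. \<forall>i<Suc n. y \<in> {y. norm (p' i y - p' i ?x) < r}})"
      using m(1,2) H(2) p'_R by (intro nbhd_Int nbhd_ball nbhd_generator) auto
    then show "nbhd X family_coordinates ?x
        {y. (if fst y = 0 then G (snd y) else g y / fst y) = H (tuple (Suc n) p' y)}"
    proof (rule nbhd_mono)
      fix y assume y: "y \<in> X" "y \<in> {y. \<forall>i<m. y \<in> {y. norm (u i y - u i ?x) < s}} \<inter>
        {y. \<forall>i<Suc n. y \<in> {y. norm (p' i y - p' i ?x) < r}}"
      obtain t z where tz: "y = (t, z)" by (cases y)
      have U: "(t, z) \<in> U" using y unfolding tz U_def by blast
      show "y \<in> {y. (if fst y = 0 then G (snd y) else g y / fst y) = H (tuple (Suc n) p' y)}"
        using g_eq[OF U] G_eq[of z] U by (cases "t = 0") (auto simp: tz)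
    qed
  qed (rule H(1))
qed

text \<open>The function \<open>\<phi> (t \<cdot> z) f\<close> is divided by \<open>t\<close> as often as the degree of \<open>f\<close> tells. In each step the
  value at \<open>t = 0\<close> is a jet of lower degree, which vanishes by \<open>low\<close>.\<close>

lemma family_holomorphic_zero:
  assumes z0: "z0 \<in> Z" and f: "f \<in> homog d"
  shows "holomorphic_at X family_coordinates (0, z0) (\<lambda>p. family (fst p) (snd p) f)"
proof -
  have fA: "f \<in> A" using f by (rule homog_mem)
  have x: "(0, z0) \<in> X" using z0 by simp
  define g where "g k p = (if fst p = 0 then snd p (jet \<phi> f k) else \<phi> (scale_point (fst p) (snd p)) f / fst p ^ k)"
    for k and p :: "complex \<times> (('v \<Rightarrow> complex) \<Rightarrow> complex)"
  have "holomorphic_at X family_coordinates (0, z0) (g k)" if "k \<le> d" for k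
    using that
  proof (induction k)
    case 0
    have "g 0 p = \<phi> (scale_point (fst p) (snd p)) f" if "p \<in> X" for p
    proof -
      have "snd p \<in> Z" using that by auto
      then show ?thesis
        using fA by (simp add: g_def scale_point_0 origin J.jet_0 point_const eval_point_apply)
    qed
    then show ?case by (rule holomorphic_at_cong_all[OF x holomorphic_at_map_scale_point[OF x fA]])
  next
    case (Suc k)
    have "holomorphic_at X family_coordinates (0, z0)
        (\<lambda>p. if fst p = 0 then snd p (jet \<phi> f (Suc k)) else g k p / fst p)"
    proof (rule holomorphic_at_divide[OF z0])
      show "holomorphic_at X family_coordinates (0, z0) (g k)" using Suc by simp
      show "g k (0, z) = 0" if "z \<in> Z" for z
        using low[OF f, of k] Suc.prems point_zero[OF that] by (simp add: g_def)
      show "((\<lambda>t. g k (t, z) / t) \<longlongrightarrow> z (jet \<phi> f (Suc k))) (at 0)" if z: "z \<in> Z" for z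
      proof -
        have "((\<lambda>t. \<phi> (scale_point t z) f / t ^ Suc k) \<longlongrightarrow> z (jet \<phi> f (Suc k))) (at 0)"
          by (rule expands_limit[OF jet_expands[OF fixes_origin fA z]])
            (use Suc.prems low[OF f] point_zero[OF z] in simp)
        moreover have "\<forall>\<^sub>F t in at 0. \<phi> (scale_point t z) f / t ^ Suc k = g k (t, z) / t"
          unfolding eventually_at by (rule exI[of _ 1]) (simp add: g_def)
        ultimately show ?thesis by (rule Lim_transform_eventually)
      qed
    qed
    then show ?case by (rule holomorphic_at_cong_all[OF x]) (simp add: g_def)
  qed
  then have "holomorphic_at X family_coordinates (0, z0) (g d)" by simp
  then show ?thesis
  proof (rule holomorphic_at_cong_all[OF x])
    show "family (fst p) (snd p) f = g d p" if "p \<in> X" for p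
      using that fA f by (auto simp: g_def family_zero leading_homog family_nonzero_homog)
  qed
qed

lemma family_holomorphic:
  assumes x: "x \<in> X" and f: "f \<in> A"
  shows "holomorphic_at X family_coordinates x (\<lambda>p. family (fst p) (snd p) f)"
proof -
  obtain t z where tz: "x = (t, z)" by (cases x)
  have homog: "holomorphic_at X family_coordinates x (\<lambda>p. family (fst p) (snd p) f)" if "f \<in> homog d" for f d
    using family_holomorphic_nonzero[of t z f d] family_holomorphic_zero[of z f d] that x
    unfolding tz by (cases "t = 0") auto
  obtain D where D: "\<forall>d>D. hc d f = 0" using degree_bound[OF f] by blast
  have "holomorphic_at X family_coordinates x (\<lambda>p. \<Sum>d\<le>D. family (fst p) (snd p) (hc d f))"
    by (intro holomorphic_at_sum[OF x] homog[OF hcomp_mem_homog[OF f]])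
  then show ?thesis
    by (rule holomorphic_at_cong_all[OF x]) (use family_sum[OF _ f D] in auto)
qed

lemma holomorphic_family_family: "holomorphic_family A (\<lambda>t. restrict (family t) Z)"
  unfolding holomorphic_family_def
proof (intro conjI allI ballI)
  show "restrict (family t) Z \<in> Z \<rightarrow> Z" for t using family_in by auto
  fix f assume f: "f \<in> A"
  have R: "insert (\<lambda>(t, z). t) {\<lambda>(t, z). z h | h. h \<in> A} = family_coordinates"
    by (auto simp: case_prod_unfold)
  have "holomorphic_at X family_coordinates x (\<lambda>(t, z). restrict (family t) Z z f)" if "x \<in> X" for x
    by (rule holomorphic_at_cong_all[OF that family_holomorphic[OF that f]]) auto
  then show "holomorphic_fun X (insert (\<lambda>(t, z). t) {\<lambda>(t, z). z h | h. h \<in> A})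
      (\<lambda>(t, z). restrict (family t) Z z f)"
    unfolding R holomorphic_fun_iff by blast
qed

lemma holomorphic_self_map_family:
  assumes "\<And>z. z \<in> Z \<Longrightarrow> \<psi> z = family t z"
  shows "holomorphic_self_map A \<psi>"
  unfolding holomorphic_self_map_def holomorphic_fun_iff
proof (intro conjI ballI)
  show "\<psi> \<in> Z \<rightarrow> Z" using assms family_in by auto
  fix f z assume f: "f \<in> A" and z: "z \<in> Z"
  have "holomorphic_at Z coordinates z (\<lambda>z. family (fst (t, z)) (snd (t, z)) f)"
  proof (rule holomorphic_at_pullback[where \<mu> = "\<lambda>z. (t, z)" and Y = X and S = family_coordinates
        and f = "\<lambda>p. family (fst p) (snd p) f"])
    show "holomorphic_at X family_coordinates (t, z) (\<lambda>p. family (fst p) (snd p) f)"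
      using z f by (intro family_holomorphic) auto
    show "holomorphic_at Z coordinates z (\<lambda>y. q (t, y))" if q: "q \<in> family_coordinates" for q
    proof (cases "q = fst")
      case True
      then show ?thesis by (simp add: holomorphic_at_const)
    next
      case False
      then obtain h where "h \<in> A" "q = (\<lambda>p. snd p h)" using q by blast
      then show ?thesis by (intro holomorphic_at_generator) auto
    qed
  qed (use z in auto)
  then show "holomorphic_at Z coordinates z (\<lambda>z. \<psi> z f)"
    by (rule holomorphic_at_cong_all[OF z]) (simp add: assms)
qed

end

locale inverse_degree_preserving_maps =
  \<Phi>: degree_preserving_map smul A \<phi> + \<Psi>: degree_preserving_map smul A \<psi>
  for smul :: "complex \<Rightarrow> 'v::ab_group_add \<Rightarrow> 'v" and A \<phi> \<psi> +
  assumes inv1: "z \<in> affine_points A \<Longrightarrow> \<phi> (\<psi> z) = z"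
    and inv2: "z \<in> affine_points A \<Longrightarrow> \<psi> (\<phi> z) = z"
begin

lemma family_inverse:
  assumes z: "z \<in> affine_points A"
  shows "\<Psi>.family t (\<Phi>.family t z) = z"
proof (cases "t = 0")
  case False
  have \<phi>z: "\<phi> (\<Phi>.scale_point t z) \<in> affine_points A"
    by (rule \<Phi>.maps_point[OF \<Phi>.scale_point_in[OF z]])
  have "\<Psi>.family t (\<Phi>.family t z) = \<Phi>.scale_point (inverse t) (\<psi> (\<Phi>.scale_point t (\<Phi>.family t z)))"
    by (rule \<Psi>.family_nonzero[OF False \<Phi>.family_in[OF z]])
  also have "\<Phi>.scale_point t (\<Phi>.family t z) = \<phi> (\<Phi>.scale_point t z)"
    unfolding \<Phi>.family_nonzero[OF False z] \<Phi>.scale_point_scale_point[OF \<phi>z] right_inverse[OF False]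
    by (rule \<Phi>.scale_point_1[OF \<phi>z])
  also have "\<psi> \<dots> = \<Phi>.scale_point t z" by (rule inv2[OF \<Phi>.scale_point_in[OF z]])
  also have "\<Phi>.scale_point (inverse t) \<dots> = z"
    unfolding \<Phi>.scale_point_scale_point[OF z] left_inverse[OF False] by (rule \<Phi>.scale_point_1[OF z])
  finally show ?thesis .
next
  case True
  interpret inverse_jet_maps smul A "\<Phi>.jet \<psi>" "\<Phi>.jet \<phi>"
    by (rule \<Phi>.inverse_jet_maps_jet[of \<psi> \<phi>]) (rule \<Psi>.fixes_origin \<Phi>.fixes_origin inv2, assumption?)+
  show ?thesis
  proof (rule \<Phi>.point_eqI[OF \<Psi>.family_in[OF \<Phi>.family_in[OF z]] z])
    fix f assume f: "f \<in> A"
    obtain D where D: "\<forall>d>D. hcomp smul d f = 0" using \<Phi>.degree_bound[OF f] by blast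
    have "\<forall>d>D. hcomp smul d (\<Psi>.leading f) = 0"
      using D by (simp add: \<Psi>.hcomp_leading[OF f] \<Psi>.J.jet_zero)
    then have "\<Phi>.leading (\<Psi>.leading f) = (\<Sum>d\<le>D. \<Phi>.jet \<phi> (hcomp smul d (\<Psi>.leading f)) d)"
      by (rule \<Phi>.leading_eq)
    also have "\<dots> = (\<Sum>d\<le>D. hcomp smul d f)"
      unfolding \<Psi>.hcomp_leading[OF f]
      by (intro sum.cong refl leading_jet_inverse[OF \<Psi>.low \<Phi>.low] \<Phi>.hcomp_mem_homog f)
    also have "\<dots> = f" by (rule \<Phi>.sum_hcomp[OF \<Phi>.mem_polys[OF f] D[rule_format]])
    finally show "\<Psi>.family t (\<Phi>.family t z) f = z f"
      using f True by (simp add: \<Psi>.family_zero \<Phi>.family_zero \<Psi>.leading_mem)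
  qed
qed

end

text \<open>A homogeneous polynomial of degree \<open>d\<close> lies in the \<open>d\<close>-th power of the maximal ideal at the origin,
  and \<open>P\<close> takes it to the power \<open>d - k > 0\<close>.\<close>

lemma (in complex_space) homogeneous_vanishes:
  assumes "has_order_at_most k polys P" "f \<in> polys" "hc d f = f" "k < d"
  shows "P f 0 = 0"
proof -
  have "max_ideal_power polys 0 ((d - k) + k) f"
    using max_ideal_power_hcomp[OF assms(2), of d] assms(3,4) by simp
  then have "max_ideal_power polys 0 (d - k) (P f)"
    by (rule polys.has_order_max_ideal_power[OF assms(1)])
  then show ?thesis using polys.max_ideal_power_vanish assms(4) by simp
qed

context reductive_module
begin

text \<open>The two halves of admissibility: invariant operators on \<open>V\<close> restrict to operators on the quotient,
  and every operator on the quotient arises in this way without loss of order.\<close>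

lemma admissible_detect:
  assumes adm: "admissible G smul \<rho>" and g: "g \<in> homog k" "g \<noteq> 0"
  shows "\<exists>P \<mu>. has_order_at_most k invs P \<and> (\<forall>h\<in>invs. P h 0 = \<mu> (hc k h)) \<and> \<mu> g = (1::complex)"
proof -
  obtain P \<mu> where P: "P \<in> invariant_diff_ops k G smul \<rho>"
    "\<And>h. h \<in> polys \<Longrightarrow> P h 0 = \<mu> (hc k h)" "\<mu> g = 1"
    using invariant_op_detects[OF g] by blast
  have "restrict P invs \<in> diff_ops k invs"
    using adm P(1) unfolding admissible_def by blast
  then have "has_order_at_most k invs (restrict P invs)" by (simp add: diff_ops_def)
  moreover have "\<forall>h\<in>invs. restrict P invs h 0 = \<mu> (hc k h)" using P(2) mem_polys by simp
  ultimately show ?thesis using P(3) by (intro exI[of _ "restrict P invs"] exI[of _ \<mu>]) simp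
qed

lemma admissible_kill:
  assumes adm: "admissible G smul \<rho>" and P: "has_order_at_most k invs P" and f: "f \<in> homog d" "k < d"
  shows "P f 0 = 0"
proof -
  have "has_order_at_most k invs (restrict P invs)"
    by (rule has_order_at_most_cong[OF P]) simp
  then have "restrict P invs \<in> diff_ops k invs" by (simp add: diff_ops_def)
  then have "restrict P invs \<in> (\<lambda>P. restrict P invs) ` invariant_diff_ops k G smul \<rho>"
    using adm unfolding admissible_def by simp
  then obtain R where R: "R \<in> invariant_diff_ops k G smul \<rho>" "restrict P invs = restrict R invs" by blast
  have fA: "f \<in> invs" using f(1) by (rule homog_mem)
  have "R f 0 = 0"
    using R(1) f mem_polys[OF fA] hcomp_homog[OF f(1), of d]
    by (intro homogeneous_vanishes[of k R f d]) (auto simp: invariant_diff_ops_def diff_ops_def)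
  moreover have "P f = R f" using fun_cong[OF R(2), of f] fA by simp
  ultimately show ?thesis by simp
qed

end

theorem theorem1p5:
  fixes G :: "(complex^'n^'n) set"
    and smul :: "complex \<Rightarrow> 'v::ab_group_add \<Rightarrow> 'v"
    and \<rho> :: "complex^'n^'n \<Rightarrow> 'v \<Rightarrow> 'v"
    and \<phi> :: "(('v \<Rightarrow> complex) \<Rightarrow> complex) \<Rightarrow> (('v \<Rightarrow> complex) \<Rightarrow> complex)"
  assumes "reductive_group G"
    and "rational_module G smul UNIV \<rho>"
    and "admissible G smul \<rho>"
    and "\<phi> \<in> holomorphic_automorphisms (invariants G smul \<rho>)"
    and "\<phi> (git_quotient_map G smul \<rho> 0) = git_quotient_map G smul \<rho> 0"
  shows "\<exists>\<Phi> :: complex \<Rightarrow> (('v \<Rightarrow> complex) \<Rightarrow> complex) \<Rightarrow> (('v \<Rightarrow> complex) \<Rightarrow> complex).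
           (\<forall>t. \<Phi> t \<in> holomorphic_automorphisms (invariants G smul \<rho>)) \<and>
           holomorphic_family (invariants G smul \<rho>) \<Phi> \<and>
           \<Phi> 0 \<in> quasilinear_automorphisms G smul \<rho> \<and>
           \<Phi> 1 = \<phi>"
proof -
  interpret complex_space smul
    using assms(2) unfolding rational_module_def complex_space_def by blast
  interpret reductive_module smul G \<rho>
    by unfold_locales (fact assms)+
  define \<psi> where "\<psi> = inv_into Z \<phi>"
  have \<phi>: "\<phi> \<in> extensional Z" "bij_betw \<phi> Z Z" "holomorphic_self_map invs \<phi>" "holomorphic_self_map invs \<psi>"
    using assms(4) by (auto simp: holomorphic_automorphisms_def \<psi>_def)
  have o: "git_quotient_map G smul \<rho> 0 = eval_point 0"
    by (simp add: git_quotient_map_def eval_point_def)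
  have \<phi>o: "\<phi> (eval_point 0) = eval_point 0" using assms(5) by (simp add: o)
  have \<phi>\<psi>: "\<phi> (\<psi> z) = z" if "z \<in> Z" for z
    unfolding \<psi>_def using that \<phi>(2) by (simp add: bij_betw_def f_inv_into_f)
  have \<psi>\<phi>: "\<psi> (\<phi> z) = z" if "z \<in> Z" for z
    unfolding \<psi>_def using that \<phi>(2) by (simp add: bij_betw_def inv_into_f_f)
  have \<psi>o: "\<psi> (eval_point 0) = eval_point 0" using \<psi>\<phi>[OF eval_point_in, of 0] \<phi>o by simp
  have hol: "\<eta> \<in> Z \<rightarrow> Z" "\<And>f z. f \<in> invs \<Longrightarrow> z \<in> Z \<Longrightarrow> holomorphic_at Z coordinates z (\<lambda>z. \<eta> z f)"
    if "holomorphic_self_map invs \<eta>" for \<eta>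
    using that by (auto simp: holomorphic_self_map_def holomorphic_fun_iff)
  have fo: "fixes_origin \<phi>" "fixes_origin \<psi>"
    using hol[OF \<phi>(3)] hol[OF \<phi>(4)] \<phi>o \<psi>o eval_point_in by (auto simp: fixes_origin_def)
  \<comment> \<open>Both directions are needed: the leading parts of \<open>\<phi>\<close> and \<open>\<psi>\<close> shall be inverse to each other.\<close>
  interpret T: inverse_jet_maps smul invs "jet \<phi>" "jet \<psi>"
    by (rule inverse_jet_maps_jet[of \<phi> \<psi>]) (rule fo \<phi>\<psi>, assumption?)+
  interpret S: inverse_jet_maps smul invs "jet \<psi>" "jet \<phi>"
    by (rule inverse_jet_maps_jet[of \<psi> \<phi>]) (rule fo \<psi>\<phi>, assumption?)+
  have low_\<phi>: "jet \<phi> f k = 0" if f: "f \<in> homog d" "k < d" for f k d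
  proof (rule T.jet_low_degree_vanishes[OF _ _ f])
    show "\<exists>P \<mu>. has_order_at_most k invs P \<and> (\<forall>h\<in>invs. P h 0 = \<mu> (hc k h)) \<and> \<mu> g = (1::complex)"
      if "g \<in> homog k" "g \<noteq> 0" for g k using that by (rule admissible_detect[OF assms(3)])
    show "P f 0 = 0" if "has_order_at_most k invs P" "f \<in> homog d" "k < d" for P f k d
      using that by (rule admissible_kill[OF assms(3)])
  qed
  have low_\<psi>: "jet \<psi> f k = 0" if f: "f \<in> homog d" "k < d" for f k d
  proof (rule S.jet_low_degree_vanishes[OF _ _ f])
    show "\<exists>P \<mu>. has_order_at_most k invs P \<and> (\<forall>h\<in>invs. P h 0 = \<mu> (hc k h)) \<and> \<mu> g = (1::complex)"
      if "g \<in> homog k" "g \<noteq> 0" for g k using that by (rule admissible_detect[OF assms(3)])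
    show "P f 0 = 0" if "has_order_at_most k invs P" "f \<in> homog d" "k < d" for P f k d
      using that by (rule admissible_kill[OF assms(3)])
  qed
  interpret P: degree_preserving_map smul invs \<phi>
    by unfold_locales (use hol[OF \<phi>(3)] \<phi>o low_\<phi> in blast)+
  interpret Q: degree_preserving_map smul invs \<psi>
    by unfold_locales (use hol[OF \<phi>(4)] \<psi>o low_\<psi> in blast)+
  interpret PQ: inverse_degree_preserving_maps smul invs \<phi> \<psi>
    by unfold_locales (use \<phi>\<psi> \<psi>\<phi> in auto)
  interpret QP: inverse_degree_preserving_maps smul invs \<psi> \<phi>
    by unfold_locales (use \<phi>\<psi> \<psi>\<phi> in auto)
  define \<Phi> where "\<Phi> = (\<lambda>t. restrict (P.family t) Z)"
  have \<Phi>: "\<Phi> t z = P.family t z" if "z \<in> Z" for t z using that by (simp add: \<Phi>_def)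
  have bij: "bij_betw (\<Phi> t) Z Z" for t
    by (rule bij_betwI[where g = "Q.family t"])
      (auto simp: \<Phi> P.family_in Q.family_in PQ.family_inverse QP.family_inverse)
  have inv: "inv_into Z (\<Phi> t) z = Q.family t z" if "z \<in> Z" for t z
    by (rule inv_into_f_eq[OF bij_betw_imp_inj_on[OF bij]])
      (auto simp: \<Phi> Q.family_in QP.family_inverse that)
  have "\<Phi> t \<in> holomorphic_automorphisms invs" for t
    unfolding holomorphic_automorphisms_def
    using bij P.holomorphic_self_map_family[of "\<Phi> t" t] Q.holomorphic_self_map_family[of "inv_into Z (\<Phi> t)" t] \<Phi> inv
    by (simp add: \<Phi>_def)
  moreover have "holomorphic_family invs \<Phi>"
    unfolding \<Phi>_def by (rule P.holomorphic_family_family)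
  moreover have "\<Phi> 0 \<in> quasilinear_automorphisms G smul \<rho>"
  proof -
    have "\<exists>h\<in>invs. \<forall>z\<in>Z. \<Phi> 0 z f = z h" if "f \<in> invs" for f
      using that by (intro bexI[of _ "P.leading f"]) (auto simp: \<Phi> P.family_zero P.leading_mem)
    moreover have "\<exists>h\<in>invs. \<forall>z\<in>Z. inv_into Z (\<Phi> 0) z f = z h" if "f \<in> invs" for f
      using that by (intro bexI[of _ "Q.leading f"]) (auto simp: inv Q.family_zero Q.leading_mem)
    moreover have "homogeneous_invariants G smul \<rho> d = homog d" for d
      by (simp add: homogeneous_invariants_def homog_def)
    moreover have "\<exists>h\<in>homog d. \<forall>z\<in>Z. \<Phi> 0 z f = z h" if "f \<in> homog d" for f d
      using that homog_mem[OF that]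
      by (intro bexI[of _ "jet \<phi> f d"]) (auto simp: \<Phi> P.family_zero P.leading_homog jet_map_mem[OF fo(1)])
    ultimately show ?thesis
      using bij[of 0] unfolding quasilinear_automorphisms_def algebraic_automorphisms_def git_quotient_def
      by (simp add: \<Phi>_def)
  qed
  moreover have "\<Phi> 1 = \<phi>"
  proof (rule extensionalityI[where A = Z])
    show "\<Phi> 1 z = \<phi> z" if "z \<in> Z" for z
      using that by (simp add: \<Phi> P.family_nonzero scale_point_1 P.maps_point)
  qed (auto simp: \<Phi>_def \<phi>(1))
  ultimately show ?thesis by blast
qed

end
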